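(* Let $T>0$ and let $N,M\ge1$ be integers. Let $H_j:\mathbb{R}^N\times\mathbb{R}^N\times\mathbb{R}^M\times\mathbb{R}^N\to\mathbb{R}$, $j=1,\dots,M$, be continuous functions satisfying the structural assumptions (S) and the monotonicity condition (Mon) stated in the context, and let $u_0=(u_{0,1},\dots,u_{0,M}):\mathbb{R}^N\to\mathbb{R}^M$ be bounded and uniformly continuous. Let $\overline H_1,\dots,\overline H_M$ be the effective Hamiltonians defined in the context. Then there exists a unique viscosity solution $u=(u_1,\dots,u_M)\in BUC(\mathbb{R}^N\times[0,T])$ of $$\begin{cases}\dfrac{\partial u_i}{\partial t}+\overline H_i(x,u,Du_i)=0 & (x,t)\in\mathbb{R}^N\times(0,T],\\ u_i(x,0)=u_{0,i}(x) & x\in\mathbb{R}^N,\end{cases}\qquad i=1,\dots,M.$$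
   Context: A modulus of continuity is a nondecreasing continuous function $\omega:[0,\infty)\to[0,\infty)$ with $\omega(0)=0$. $BUC$ means bounded and uniformly continuous (componentwise for vector-valued functions). $B_N(0,R)$ is the ball of $\mathbb{R}^N$ of center $0$ and radius $R$. $\mathbb{T}^N=[0,1]^N$; periodic means $\mathbb{Z}^N$-periodic. Assumptions (S), for every $j=1,\dots,M$: (i) $H_j(x,y,r,p)$ is $\mathbb{Z}^N$-periodic in $y$ for any $(x,r,p)$; (ii) $\lim_{|p|\to+\infty}H_j(x,y,r,p)=+\infty$ uniformly in $(x,y,r)$; (iii) for all $R>0$, $H_j\in BUC(\mathbb{R}^N\times\mathbb{R}^N\times[-R,R]^M\times B_N(0,R))$; (iv) there exists a modulus of continuity $\omega$ such that $|H_j(x_1,y_1,r,p)-H_j(x_2,y_2,r,p)|\le\omega\big((1+|p|)(|x_1-x_2|+|y_1-y_2|)\big)$ for every $x_1,x_2,y_1,y_2,p\in\mathbb{R}^N$ and $r\in\mathbb{R}^M$. Condition (Mon): for every $j\in\{1,\dots,M\}$, if $r,s\in\mathbb{R}^M$ and $r_j-s_j=\max_{k=1,\dots,M}\{r_k-s_k\}\ge0$, then $H_j(x,y,r,p)-H_j(x,y,s,p)\ge0$ for all $x,y,p\in\mathbb{R}^N$. Effective Hamiltonians: for $i\in\{1,\dots,M\}$ and $(x,r,p)\in\mathbb{R}^N\times\mathbb{R}^M\times\mathbb{R}^N$, $\overline H_i(x,r,p)$ is the unique real number $\lambda$ such that the equation $H_i(x,y,r,p+Dv(y))=\lambda$,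 $y\in\mathbb{T}^N$, admits a Lipschitz continuous $\mathbb{Z}^N$-periodic viscosity solution $v$ (such a unique $\lambda$ exists under (S)). Viscosity solutions of the system: an upper semicontinuous (componentwise) $u:\mathbb{R}^N\times[0,T]\to\mathbb{R}^M$ is a viscosity subsolution if $u_i(\cdot,0)\le u_{0,i}$ for all $i$ and, whenever $\phi\in C^1$, $i\in\{1,\dots,M\}$ and $u_i-\phi$ attains a local maximum (relative to $\mathbb{R}^N\times[0,T]$) at $(x,t)$ with $t>0$, then $\partial_t\phi(x,t)+\overline H_i(x,u(x,t),D\phi(x,t))\le0$. A lower semicontinuous $v:\mathbb{R}^N\times[0,T]\to\mathbb{R}^M$ is a viscosity supersolution if $v_i(\cdot,0)\ge u_{0,i}$ for all $i$ and, whenever $\phi\in C^1$ and $v_i-\phi$ attains a local minimum at $(x,t)$ with $t>0$, then $\partial_t\phi(x,t)+\overline H_i(x,v(x,t),D\phi(x,t))\ge0$. A continuous function is a viscosity solution if it is both. *)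

theory Defs
  imports "HOL-Analysis.Analysis"
begin

text \<open>
  Points of $R^N$ are of type \<^typ>\<open>real^'n\<close> and points of $R^M$ of type \<^typ>\<open>real^'m\<close>; both
  dimensions are at least one because the index types are nonempty. A system of Hamiltonians
  is a function taking the arguments $j$, $x$, $y$, $r$, $p$ in this order.
\<close>

definition modulus_of_continuity :: "(real \<Rightarrow> real) \<Rightarrow> bool" where
  "modulus_of_continuity \<omega> \<longleftrightarrow>
     \<omega> ` {0..} \<subseteq> {0..} \<and> mono_on {0..} \<omega> \<and> continuous_on {0..} \<omega> \<and> \<omega> 0 = 0"

definition BUC :: "'a::metric_space set \<Rightarrow> ('a \<Rightarrow> real) \<Rightarrow> bool" where
  "BUC S f \<longleftrightarrow> bounded (f ` S) \<and> uniformly_continuous_on S f"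

definition integer_periodic :: "(real^'n \<Rightarrow> real) \<Rightarrow> bool" where
  "integer_periodic f \<longleftrightarrow> (\<forall>k. (\<forall>i. k $ i \<in> \<int>) \<longrightarrow> (\<forall>y. f (y + k) = f y))"

definition assumptions_S ::
  "('m::finite \<Rightarrow> real^'n \<Rightarrow> real^'n \<Rightarrow> real^'m \<Rightarrow> real^'n \<Rightarrow> real) \<Rightarrow> bool" where
  "assumptions_S H \<longleftrightarrow> (\<forall>j.
     (\<forall>x r p. integer_periodic (\<lambda>y. H j x y r p)) \<and>
     (\<forall>C. \<forall>\<^sub>F p in at_infinity. \<forall>x y r. C \<le> H j x y r p) \<and>
     (\<forall>R>0. BUC (UNIV \<times> UNIV \<times> {r. \<forall>k. r $ k \<in> {-R..R}} \<times> ball 0 R)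
              (\<lambda>(x, y, r, p). H j x y r p)) \<and>
     (\<exists>\<omega>. modulus_of_continuity \<omega> \<and>
        (\<forall>x1 x2 y1 y2 p r. \<bar>H j x1 y1 r p - H j x2 y2 r p\<bar>
           \<le> \<omega> ((1 + norm p) * (norm (x1 - x2) + norm (y1 - y2))))))"

definition condition_Mon ::
  "('m::finite \<Rightarrow> real^'n \<Rightarrow> real^'n \<Rightarrow> real^'m \<Rightarrow> real^'n \<Rightarrow> real) \<Rightarrow> bool" where
  "condition_Mon H \<longleftrightarrow> (\<forall>j r s.
     r $ j - s $ j = Max (range (\<lambda>k. r $ k - s $ k)) \<and> Max (range (\<lambda>k. r $ k - s $ k)) \<ge> 0 \<longrightarrow>
     (\<forall>x y p. H j x y r p - H j x y s p \<ge> 0))"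

text \<open>
  \<open>C1_with_gradient \<phi> D\<close> says that \<open>\<phi>\<close> is $C^1$ on the whole space and \<open>D\<close> is its gradient.
\<close>

definition C1_with_gradient :: "('a::real_inner \<Rightarrow> real) \<Rightarrow> ('a \<Rightarrow> 'a) \<Rightarrow> bool" where
  "C1_with_gradient \<phi> D \<longleftrightarrow> (\<forall>z. GDERIV \<phi> z :> D z) \<and> continuous_on UNIV D"

definition local_max_on :: "'a::topological_space set \<Rightarrow> ('a \<Rightarrow> real) \<Rightarrow> 'a \<Rightarrow> bool" where
  "local_max_on S f z \<longleftrightarrow> z \<in> S \<and> (\<forall>\<^sub>F w in at z within S. f w \<le> f z)"

definition local_min_on :: "'a::topological_space set \<Rightarrow> ('a \<Rightarrow> real) \<Rightarrow> 'a \<Rightarrow> bool" where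
  "local_min_on S f z \<longleftrightarrow> z \<in> S \<and> (\<forall>\<^sub>F w in at z within S. f z \<le> f w)"

definition usc_on :: "'a::topological_space set \<Rightarrow> ('a \<Rightarrow> real) \<Rightarrow> bool" where
  "usc_on S f \<longleftrightarrow> (\<forall>z\<in>S. \<forall>a>f z. \<forall>\<^sub>F w in at z within S. f w < a)"

definition lsc_on :: "'a::topological_space set \<Rightarrow> ('a \<Rightarrow> real) \<Rightarrow> bool" where
  "lsc_on S f \<longleftrightarrow> (\<forall>z\<in>S. \<forall>a<f z. \<forall>\<^sub>F w in at z within S. a < f w)"

text \<open>Continuous viscosity solutions of $F(y, Dv(y)) = c$ on the whole space.\<close>

definition stationary_viscosity_solution ::
  "(real^'n \<Rightarrow> real^'n \<Rightarrow> real) \<Rightarrow> real \<Rightarrow> (real^'n \<Rightarrow> real) \<Rightarrow> bool" where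
  "stationary_viscosity_solution F c v \<longleftrightarrow>
     continuous_on UNIV v \<and>
     (\<forall>\<phi> D y. C1_with_gradient \<phi> D \<and> local_max_on UNIV (\<lambda>w. v w - \<phi> w) y \<longrightarrow> F y (D y) \<le> c) \<and>
     (\<forall>\<phi> D y. C1_with_gradient \<phi> D \<and> local_min_on UNIV (\<lambda>w. v w - \<phi> w) y \<longrightarrow> F y (D y) \<ge> c)"

text \<open>
  Functions on the torus are identified with integer-periodic functions on the whole space.
\<close>

definition effective_Hamiltonian ::
  "('m::finite \<Rightarrow> real^'n \<Rightarrow> real^'n \<Rightarrow> real^'m \<Rightarrow> real^'n \<Rightarrow> real) \<Rightarrow>
     'm \<Rightarrow> real^'n \<Rightarrow> real^'m \<Rightarrow> real^'n \<Rightarrow> real" where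
  "effective_Hamiltonian H i x r p = (THE c. \<exists>v.
     (\<exists>L. L-lipschitz_on UNIV v) \<and> integer_periodic v \<and>
     stationary_viscosity_solution (\<lambda>y q. H i x y r (p + q)) c v)"

text \<open>
  The gradient at a point of space-time is the pair of the spatial gradient and the time
  derivative. Test functions are $C^1$ on the whole of space-time, whereas the local extrema are
  relative to \<^term>\<open>UNIV \<times> {0..T}\<close>, so that the terminal time is included.
\<close>

definition viscosity_subsolution ::
  "('m::finite \<Rightarrow> real^'n \<Rightarrow> real^'m \<Rightarrow> real^'n \<Rightarrow> real) \<Rightarrow> (real^'n \<Rightarrow> real^'m) \<Rightarrow> real \<Rightarrow>
     ((real^'n) \<times> real \<Rightarrow> real^'m) \<Rightarrow> bool" where
  "viscosity_subsolution G u0 T u \<longleftrightarrow>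
     (\<forall>i. usc_on (UNIV \<times> {0..T}) (\<lambda>z. u z $ i)) \<and>
     (\<forall>i x. u (x, 0) $ i \<le> u0 x $ i) \<and>
     (\<forall>\<phi> D i x t. C1_with_gradient \<phi> D \<and> t > 0 \<and>
        local_max_on (UNIV \<times> {0..T}) (\<lambda>z. u z $ i - \<phi> z) (x, t) \<longrightarrow>
        snd (D (x, t)) + G i x (u (x, t)) (fst (D (x, t))) \<le> 0)"

definition viscosity_supersolution ::
  "('m::finite \<Rightarrow> real^'n \<Rightarrow> real^'m \<Rightarrow> real^'n \<Rightarrow> real) \<Rightarrow> (real^'n \<Rightarrow> real^'m) \<Rightarrow> real \<Rightarrow>
     ((real^'n) \<times> real \<Rightarrow> real^'m) \<Rightarrow> bool" where
  "viscosity_supersolution G u0 T u \<longleftrightarrow>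
     (\<forall>i. lsc_on (UNIV \<times> {0..T}) (\<lambda>z. u z $ i)) \<and>
     (\<forall>i x. u (x, 0) $ i \<ge> u0 x $ i) \<and>
     (\<forall>\<phi> D i x t. C1_with_gradient \<phi> D \<and> t > 0 \<and>
        local_min_on (UNIV \<times> {0..T}) (\<lambda>z. u z $ i - \<phi> z) (x, t) \<longrightarrow>
        snd (D (x, t)) + G i x (u (x, t)) (fst (D (x, t))) \<ge> 0)"

definition viscosity_solution ::
  "('m::finite \<Rightarrow> real^'n \<Rightarrow> real^'m \<Rightarrow> real^'n \<Rightarrow> real) \<Rightarrow> (real^'n \<Rightarrow> real^'m) \<Rightarrow> real \<Rightarrow>
     ((real^'n) \<times> real \<Rightarrow> real^'m) \<Rightarrow> bool" where
  "viscosity_solution G u0 T u \<longleftrightarrow>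
     continuous_on (UNIV \<times> {0..T}) u \<and>
     viscosity_subsolution G u0 T u \<and> viscosity_supersolution G u0 T u"

text \<open>
  Functions on \<^term>\<open>UNIV \<times> {0..T}\<close> are represented by total functions whose values elsewhere are
  irrelevant; uniqueness is therefore asserted on that set only.
\<close>

end

theory Submission
  imports Defs "HOL-Complex_Analysis.Great_Picard"
begin

text \<open>
  The cell problem is solved by Perron's method for the discounted equation $\delta w + F(y, Dw) = 0$:
  by coercivity all subsolutions are Lipschitz with a constant independent of $\delta$, so a subsequence
  of $w_\delta - w_\delta(0)$ converges as $\delta \to 0$. Comparing cell solutions shows that the
  effective Hamiltonian inherits coercivity, monotonicity and local uniform continuity in all variables
  from $H$.

  For the evolution problem, doubling the variables gives more than comparison: a subsolution $u$ and a
  supersolution $v$ that are ordered near $t = 0$ satisfy $u(z) \le v(z') + \kappa$ whenever $z$ and $z'$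
  are close. Applied to Perron's maximal subsolution and its lower semicontinuous envelope this yields at
  once that they coincide and that the solution is uniformly continuous. Perron's class is cut off by the
  barrier $u_0 + At$, which is a supersolution because the Hamiltonian is bounded below, and is
  bounded below by $g - Ct$ for Lipschitz approximations $g \le u_0$.
\<close>

section \<open>Semicontinuous functions and test functions\<close>

text \<open>One Perron construction and one comparison theorem serve both problems. The cell
  equation is treated as a system with a single component, and its constant is identified by letting
  \<open>v - c t\<close> evolve. For the discounted equation the maximal subsolution is Lipschitz,
  hence equal to its own lower envelope, and this settles the supersolution property without
  comparison. The coupling is used in two strengths: Perron's method only uses that raising the
  other components lowers \<open>F i\<close>, whereas comparison uses the full (Mon), at the
  component where the doubled functional is largest. Two obstacles shape the evolution problem.
  Extrema are relative to a slab that contains the terminal time, so that gradients of touching test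
  functions agree in space but are only ordered in time. And the effective Hamiltonian is controlled
  only on bounded sets of gradients, so that each estimate first has to confine the gradient by
  coercivity.\<close>

lemma usc_on_iff:
  fixes f :: "'a::metric_space \<Rightarrow> real"
  shows "usc_on S f \<longleftrightarrow> (\<forall>z\<in>S. \<forall>a>f z. \<exists>d>0. \<forall>w\<in>S. dist w z < d \<longrightarrow> f w < a)"
  unfolding usc_on_def eventually_at
  by (intro ball_cong refl all_cong ex_cong1 conj_cong) auto

lemma lsc_on_iff_usc_on: "lsc_on S f \<longleftrightarrow> usc_on S (\<lambda>z. - f z)"
proof
  assume *: "lsc_on S f"
  show "usc_on S (\<lambda>z. - f z)"
    unfolding usc_on_def
  proof (intro ballI allI impI)
    fix z a assume "z \<in> S" "a > - f z"
    then have "\<forall>\<^sub>F w in at z within S. - a < f w"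
      using * unfolding lsc_on_def by (metis minus_less_iff)
    then show "\<forall>\<^sub>F w in at z within S. - f w < a"
      by eventually_elim auto
  qed
next
  assume *: "usc_on S (\<lambda>z. - f z)"
  show "lsc_on S f"
    unfolding lsc_on_def
  proof (intro ballI allI impI)
    fix z a assume "z \<in> S" "a < f z"
    then have "\<forall>\<^sub>F w in at z within S. - f w < - a"
      using * unfolding usc_on_def by (metis neg_less_iff_less)
    then show "\<forall>\<^sub>F w in at z within S. a < f w"
      by eventually_elim auto
  qed
qed

lemma local_max_on_iff:
  fixes f :: "'a::metric_space \<Rightarrow> real"
  shows "local_max_on S f z \<longleftrightarrow> z \<in> S \<and> (\<exists>d>0. \<forall>w\<in>S. dist w z < d \<longrightarrow> f w \<le> f z)"
  unfolding local_max_on_def eventually_at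
  by (intro conj_cong refl ex_cong1) auto

lemma local_min_on_iff_max: "local_min_on S f z \<longleftrightarrow> local_max_on S (\<lambda>w. - f w) z"
  unfolding local_max_on_def local_min_on_def by simp

lemma local_min_on_iff:
  fixes f :: "'a::metric_space \<Rightarrow> real"
  shows "local_min_on S f z \<longleftrightarrow> z \<in> S \<and> (\<exists>d>0. \<forall>w\<in>S. dist w z < d \<longrightarrow> f z \<le> f w)"
  unfolding local_min_on_iff_max local_max_on_iff by (simp only: neg_le_iff_le)

lemma continuous_on_imp_usc_on:
  fixes f :: "'a::metric_space \<Rightarrow> real"
  assumes "continuous_on S f"
  shows "usc_on S f"
  unfolding usc_on_def
  using assms by (auto simp: continuous_on_def intro: order_tendstoD)

lemma continuous_on_imp_lsc_on: "continuous_on S f \<Longrightarrow> lsc_on S f"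
  for f :: "'a::metric_space \<Rightarrow> real"
  unfolding lsc_on_iff_usc_on by (intro continuous_on_imp_usc_on continuous_on_minus)

lemma usc_on_subset: "usc_on S f \<Longrightarrow> K \<subseteq> S \<Longrightarrow> usc_on K f"
  for f :: "'a::metric_space \<Rightarrow> real"
  unfolding usc_on_iff by (meson subsetD)

lemma usc_on_add:
  fixes f g :: "'a::metric_space \<Rightarrow> real"
  assumes "usc_on S f" "usc_on S g"
  shows "usc_on S (\<lambda>z. f z + g z)"
  unfolding usc_on_def
proof (intro ballI allI impI)
  fix z a assume z: "z \<in> S" and a: "a > f z + g z"
  define e where "e = (a - f z - g z) / 2"
  have e: "e > 0" "a = (f z + e) + (g z + e)" using a by (auto simp: e_def field_simps)
  have "\<forall>\<^sub>F w in at z within S. f w < f z + e" "\<forall>\<^sub>F w in at z within S. g w < g z + e"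
    using assms z e(1) unfolding usc_on_def by auto
  then show "\<forall>\<^sub>F w in at z within S. f w + g w < a"
    by eventually_elim (use e(2) in linarith)
qed

lemma usc_on_compose:
  fixes f :: "'a::metric_space \<Rightarrow> real" and g :: "'b::metric_space \<Rightarrow> 'a"
  assumes "usc_on S f" "continuous_on K g" "g ` K \<subseteq> S"
  shows "usc_on K (\<lambda>z. f (g z))"
  unfolding usc_on_iff
proof (intro ballI allI impI)
  fix z a assume z: "z \<in> K" and a: "f (g z) < a"
  obtain d where d: "d > 0" "\<And>w. w \<in> S \<Longrightarrow> dist w (g z) < d \<Longrightarrow> f w < a"
    using assms(1,3) z a unfolding usc_on_iff by (metis image_subset_iff)
  obtain d' where "d' > 0" "\<And>w. w \<in> K \<Longrightarrow> dist w z < d' \<Longrightarrow> dist (g w) (g z) < d"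
    using assms(2) z d(1) unfolding continuous_on_iff by metis
  then show "\<exists>d>0. \<forall>w\<in>K. dist w z < d \<longrightarrow> f (g w) < a"
    using d(2) assms(3) by (metis image_subset_iff)
qed

text \<open>If every \<open>z\<close> were beaten by some \<open>W z\<close>, the neighbourhoods
  where \<open>f\<close> stays below \<open>f (W z)\<close> would cover \<open>K\<close>. In a
  finite subcover, the point \<open>W z\<close> with the largest value lies in one of the
  neighbourhoods and is therefore beaten by a value of the same finite list.\<close>

lemma usc_attains_max:
  fixes f :: "'a::metric_space \<Rightarrow> real"
  assumes "compact K" "K \<noteq> {}" "usc_on K f"
  shows "\<exists>z\<in>K. \<forall>w\<in>K. f w \<le> f z"
proof (rule ccontr)
  assume "\<not> ?thesis"
  then have "\<forall>z\<in>K. \<exists>w\<in>K. f z < f w"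
    by (meson not_le_imp_less)
  then obtain W where W: "\<And>z. z \<in> K \<Longrightarrow> W z \<in> K \<and> f z < f (W z)" by metis
  have "\<forall>z\<in>K. \<exists>d>0. \<forall>w\<in>K. dist w z < d \<longrightarrow> f w < f (W z)"
    using assms(3) W unfolding usc_on_iff by blast
  then obtain d where d: "\<And>z. z \<in> K \<Longrightarrow> d z > 0"
      "\<And>z w. z \<in> K \<Longrightarrow> w \<in> K \<Longrightarrow> dist w z < d z \<Longrightarrow> f w < f (W z)" by metis
  have "K \<subseteq> (\<Union>z\<in>K. ball z (d z))"
  proof
    fix x assume "x \<in> K"
    with d(1)[of x] show "x \<in> (\<Union>z\<in>K. ball z (d z))" by (intro UN_I) (auto simp only: centre_in_ball)
  qed
  then obtain F where F: "F \<subseteq> K" "finite F" "K \<subseteq> (\<Union>z\<in>F. ball z (d z))"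
    using compactE_image[OF assms(1), of K "\<lambda>z. ball z (d z)"] open_ball by metis
  with assms(2) have "F \<noteq> {}" by auto
  define m where "m = Max ((\<lambda>z. f (W z)) ` F)"
  have "m \<in> (\<lambda>z. f (W z)) ` F" unfolding m_def using F(2) \<open>F \<noteq> {}\<close> by (intro Max_in) auto
  then obtain z where z: "z \<in> F" "m = f (W z)" by auto
  then have "W z \<in> K" using F W by auto
  then obtain z' where z': "z' \<in> F" "dist (W z) z' < d z'"
    using F(3) by (auto simp: dist_commute)
  then have "f (W z) < f (W z')" using d(2) F(1) \<open>W z \<in> K\<close> by blast
  also have "\<dots> \<le> m" unfolding m_def using F(2) z'(1) by auto
  finally show False using z by simp
qed

section \<open>Test functions, their gradients, and stability of touching\<close>

lemma C1_with_gradient_iff: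
  "C1_with_gradient \<phi> D \<longleftrightarrow>
     (\<forall>z. (\<phi> has_derivative (\<lambda>h. h \<bullet> D z)) (at z)) \<and> continuous_on UNIV D"
  by (simp add: C1_with_gradient_def gderiv_def)

lemma C1_const: "C1_with_gradient (\<lambda>_. c) (\<lambda>_. 0)"
  by (simp add: C1_with_gradient_iff)

lemma C1_add:
  assumes "C1_with_gradient \<phi> D" "C1_with_gradient \<psi> E"
  shows "C1_with_gradient (\<lambda>z. \<phi> z + \<psi> z) (\<lambda>z. D z + E z)"
  using assms unfolding C1_with_gradient_iff
  by (simp add: inner_add_right continuous_on_add)

lemma C1_minus:
  assumes "C1_with_gradient \<phi> D"
  shows "C1_with_gradient (\<lambda>z. - \<phi> z) (\<lambda>z. - D z)"
  using assms unfolding C1_with_gradient_iff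
  by (simp add: continuous_on_minus)

lemma C1_shift:
  assumes "C1_with_gradient \<phi> D"
  shows "C1_with_gradient (\<lambda>z. \<phi> (z + k)) (\<lambda>z. D (z + k))"
  unfolding C1_with_gradient_iff
proof (intro conjI allI)
  fix z
  have "(\<phi> has_derivative (\<lambda>h. h \<bullet> D (z + k))) (at (z + k))"
    using assms unfolding C1_with_gradient_iff by auto
  moreover have "((\<lambda>w. w + k) has_derivative (\<lambda>h. h + 0)) (at z)"
    by (intro derivative_intros)
  ultimately have "((\<lambda>w. \<phi> (w + k)) has_derivative (\<lambda>h. (h + 0) \<bullet> D (z + k))) (at z)"
    by (rule has_derivative_compose[rotated])
  then show "((\<lambda>w. \<phi> (w + k)) has_derivative (\<lambda>h. h \<bullet> D (z + k))) (at z)"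
    by (simp only: add_0_right)
next
  have "continuous_on UNIV D" using assms unfolding C1_with_gradient_iff by blast
  then show "continuous_on UNIV (\<lambda>z. D (z + k))"
    by (rule continuous_on_compose2) (intro continuous_intros subset_UNIV)+
qed

lemma C1_norm_power2: "C1_with_gradient (\<lambda>z. c * (norm (z - a))\<^sup>2) (\<lambda>z. (2 * c) *\<^sub>R (z - a))"
  unfolding C1_with_gradient_iff power2_norm_eq_inner
proof (intro conjI allI)
  fix z
  have "((\<lambda>z. c * ((z - a) \<bullet> (z - a))) has_derivative
      (\<lambda>h. c * ((z - a) \<bullet> (h - 0) + (h - 0) \<bullet> (z - a)))) (at z)"
    by (intro derivative_intros)
  then show "((\<lambda>z. c * ((z - a) \<bullet> (z - a))) has_derivative
      (\<lambda>h. h \<bullet> ((2 * c) *\<^sub>R (z - a)))) (at z)"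
    by (rule has_derivative_eq_rhs) (simp add: fun_eq_iff inner_commute)
qed (intro continuous_intros)

lemma C1_sqrt:
  assumes "e \<noteq> 0"
  shows "C1_with_gradient (\<lambda>z. c * sqrt (e\<^sup>2 + (norm (z - a))\<^sup>2))
           (\<lambda>z. (c / sqrt (e\<^sup>2 + (norm (z - a))\<^sup>2)) *\<^sub>R (z - a))"
  unfolding C1_with_gradient_iff
proof (intro conjI allI)
  have pos: "e\<^sup>2 + (norm (z - a))\<^sup>2 > 0" for z
    using assms by (simp add: add_pos_nonneg)
  fix z
  have "((\<lambda>z. 1 * (norm (z - a))\<^sup>2) has_derivative (\<lambda>h. h \<bullet> ((2 * 1) *\<^sub>R (z - a)))) (at z)"
    using C1_norm_power2[of 1 a] unfolding C1_with_gradient_iff by blast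
  then have g: "((\<lambda>z. (norm (z - a))\<^sup>2) has_derivative (\<lambda>h. h \<bullet> (2 *\<^sub>R (z - a)))) (at z)"
    by (simp only: mult_1 mult_1_right)
  have "((\<lambda>x. c * sqrt (e\<^sup>2 + x)) has_real_derivative
      c * (inverse (sqrt (e\<^sup>2 + (norm (z - a))\<^sup>2)) / 2 * (0 + 1))) (at ((norm (z - a))\<^sup>2))"
    by (intro DERIV_cmult DERIV_chain2[where f = sqrt and g = "\<lambda>x. e\<^sup>2 + x", OF DERIV_real_sqrt[OF pos]] DERIV_add DERIV_const DERIV_ident)
  then have "((\<lambda>x. c * sqrt (e\<^sup>2 + x)) has_derivative
      (*) (c * (inverse (sqrt (e\<^sup>2 + (norm (z - a))\<^sup>2)) / 2 * (0 + 1)))) (at ((norm (z - a))\<^sup>2))"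
    unfolding has_field_derivative_def .
  from has_derivative_compose[where f = "\<lambda>z. (norm (z - a))\<^sup>2" and g = "\<lambda>x. c * sqrt (e\<^sup>2 + x)", OF g this]
  show "((\<lambda>z. c * sqrt (e\<^sup>2 + (norm (z - a))\<^sup>2)) has_derivative
      (\<lambda>h. h \<bullet> ((c / sqrt (e\<^sup>2 + (norm (z - a))\<^sup>2)) *\<^sub>R (z - a)))) (at z)"
    by (rule has_derivative_eq_rhs) (rule ext, simp only: inner_scaleR_right divide_inverse, simp)
next
  have "sqrt (e\<^sup>2 + (norm (z - a))\<^sup>2) \<noteq> 0" for z
    using assms by (simp add: add_nonneg_eq_0_iff)
  then show "continuous_on UNIV (\<lambda>z. (c / sqrt (e\<^sup>2 + (norm (z - a))\<^sup>2)) *\<^sub>R (z - a))"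
    by (intro continuous_intros) auto
qed

lemma C1_space_time:
  fixes y x0 :: "'a::real_inner" and s a b c \<eta> :: real
  shows "C1_with_gradient
     (\<lambda>z. a * (norm (fst z - y))\<^sup>2 + b * (norm (fst z - x0))\<^sup>2 + c * (snd z - s)\<^sup>2 + \<eta> * snd z)
     (\<lambda>z. ((2 * a) *\<^sub>R (fst z - y) + (2 * b) *\<^sub>R (fst z - x0), 2 * c * (snd z - s) + \<eta>))"
  unfolding C1_with_gradient_iff
proof (intro conjI allI)
  have sq: "((\<lambda>z. c * (norm (fst z - y))\<^sup>2) has_derivative
      (\<lambda>h. fst h \<bullet> ((2 * c) *\<^sub>R (fst z - y)))) (at z)" for c y and z :: "'a \<times> real"
  proof -
    have "((\<lambda>x. c * (norm (x - y))\<^sup>2) has_derivative (\<lambda>h. h \<bullet> ((2 * c) *\<^sub>R (fst z - y)))) (at (fst z))"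
      using C1_norm_power2[of c y] unfolding C1_with_gradient_iff by blast
    from has_derivative_compose[where f = fst and g = "\<lambda>x. c * (norm (x - y))\<^sup>2",
        OF has_derivative_fst[OF has_derivative_ident] this] show ?thesis .
  qed
  have sq': "((\<lambda>z. c * (snd z - s)\<^sup>2) has_derivative
      (\<lambda>h. snd h * (2 * c * (snd z - s)))) (at z)" for z :: "'a \<times> real"
  proof -
    have "((\<lambda>t. c * (t - s)\<^sup>2) has_real_derivative c * (of_nat 2 * ((1 - 0) * (snd z - s) ^ (2 - Suc 0)))) (at (snd z))"
      by (intro DERIV_cmult DERIV_power DERIV_diff DERIV_const DERIV_ident)
    then have "((\<lambda>t. c * (t - s)\<^sup>2) has_real_derivative 2 * c * (snd z - s)) (at (snd z))"
      by (rule DERIV_cong) (simp add: algebra_simps)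
    then have "((\<lambda>t. c * (t - s)\<^sup>2) has_derivative (\<lambda>h. h * (2 * c * (snd z - s)))) (at (snd z))"
      by (simp only: has_field_derivative_def mult_commute_abs)
    from has_derivative_compose[where f = snd and g = "\<lambda>t. c * (t - s)\<^sup>2",
        OF has_derivative_snd[OF has_derivative_ident] this] show ?thesis .
  qed
  fix z :: "'a \<times> real"
  have "((\<lambda>z. a * (norm (fst z - y))\<^sup>2 + b * (norm (fst z - x0))\<^sup>2 + c * (snd z - s)\<^sup>2 + \<eta> * snd z)
     has_derivative
     (\<lambda>h. fst h \<bullet> ((2 * a) *\<^sub>R (fst z - y)) + fst h \<bullet> ((2 * b) *\<^sub>R (fst z - x0))
       + snd h * (2 * c * (snd z - s)) + \<eta> * snd h)) (at z)"
    by (intro has_derivative_add sq sq' derivative_intros)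
  then show "((\<lambda>z. a * (norm (fst z - y))\<^sup>2 + b * (norm (fst z - x0))\<^sup>2 + c * (snd z - s)\<^sup>2 + \<eta> * snd z)
     has_derivative
     (\<lambda>h. h \<bullet> ((2 * a) *\<^sub>R (fst z - y) + (2 * b) *\<^sub>R (fst z - x0), 2 * c * (snd z - s) + \<eta>))) (at z)"
    by (rule has_derivative_eq_rhs) (simp add: fun_eq_iff inner_prod_def inner_add_right algebra_simps)
qed (intro continuous_intros)

text \<open>Freezing the time turns a test function on space-time into one for the stationary cell
  equation.\<close>

lemma C1_slice:
  fixes \<phi> :: "'a::real_inner \<times> real \<Rightarrow> real"
  assumes "C1_with_gradient \<phi> D"
  shows "C1_with_gradient (\<lambda>x. \<phi> (x, t)) (\<lambda>x. fst (D (x, t)))"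
  unfolding C1_with_gradient_iff
proof (intro conjI allI)
  fix x
  have "(\<phi> has_derivative (\<lambda>h. h \<bullet> D (x, t))) (at (x, t))"
    using assms unfolding C1_with_gradient_iff by auto
  moreover have "((\<lambda>y. (y, t)) has_derivative (\<lambda>h. (h, 0))) (at x)"
    by (intro derivative_intros)
  ultimately have "((\<lambda>y. \<phi> (y, t)) has_derivative (\<lambda>h. (h, 0) \<bullet> D (x, t))) (at x)"
    by (rule has_derivative_compose[rotated])
  then show "((\<lambda>y. \<phi> (y, t)) has_derivative (\<lambda>h. h \<bullet> fst (D (x, t)))) (at x)"
    by (rule has_derivative_eq_rhs) (simp add: fun_eq_iff inner_prod_def)
next
  have "continuous_on UNIV D" using assms unfolding C1_with_gradient_iff by blast
  then have "continuous_on UNIV (\<lambda>x. D (x, t))"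
    by (rule continuous_on_compose2) (intro continuous_intros subset_UNIV)+
  then show "continuous_on UNIV (\<lambda>x. fst (D (x, t)))"
    by (rule continuous_on_fst)
qed

lemma C1_imp_continuous: "C1_with_gradient \<phi> D \<Longrightarrow> continuous_on UNIV \<phi>"
  unfolding C1_with_gradient_iff
  by (meson continuous_at_imp_continuous_on has_derivative_continuous)

lemma C1_imp_continuous_gradient: "C1_with_gradient \<phi> D \<Longrightarrow> continuous_on UNIV D"
  by (simp add: C1_with_gradient_iff)

lemma C1_directional:
  assumes "C1_with_gradient \<phi> D"
  shows "((\<lambda>s. \<phi> (z + s *\<^sub>R h)) has_real_derivative h \<bullet> D z) (at 0 within X)"
proof -
  have "(\<phi> has_derivative (\<lambda>h. h \<bullet> D z)) (at (z + 0 *\<^sub>R h))"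
    using assms unfolding C1_with_gradient_iff by auto
  moreover have "((\<lambda>s. z + s *\<^sub>R h) has_derivative (\<lambda>s. 0 + s *\<^sub>R h)) (at 0 within X)"
    by (intro derivative_intros)
  ultimately have "((\<lambda>s. \<phi> (z + s *\<^sub>R h)) has_derivative (\<lambda>s. (0 + s *\<^sub>R h) \<bullet> D z)) (at 0 within X)"
    by (rule has_derivative_compose[rotated])
  then show ?thesis
    by (simp add: has_field_derivative_def mult_commute_abs)
qed

text \<open>Near a touching point from above, \<open>\<phi>\<close> must grow at least as fast as
  \<open>f\<close>. Since only small positive multiples of \<open>h\<close> are used, the rule also
  applies on the boundary of \<open>S\<close>, in particular at the terminal time.\<close>

lemma local_max_directional:
  fixes z h :: "'a::real_inner"
  assumes C1: "C1_with_gradient \<phi> D" and max: "local_max_on S (\<lambda>w. f w - \<phi> w) z"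
    and ev: "\<forall>\<^sub>F s in at_right 0. z + s *\<^sub>R h \<in> S \<and> f z + c * s \<le> f (z + s *\<^sub>R h)"
  shows "c \<le> h \<bullet> D z"
proof -
  obtain d where d: "d > 0" "\<And>w. w \<in> S \<Longrightarrow> dist w z < d \<Longrightarrow> f w - \<phi> w \<le> f z - \<phi> z"
    using max unfolding local_max_on_iff by auto
  have "((\<lambda>s. dist (z + s *\<^sub>R h) z) \<longlongrightarrow> dist (z + 0 *\<^sub>R h) z) (at_right 0)"
    by (intro tendsto_intros)
  then have "\<forall>\<^sub>F s in at_right 0. dist (z + s *\<^sub>R h) z < d"
    using d(1) by (intro order_tendstoD(2)[of _ "dist (z + 0 *\<^sub>R h) z"]) auto
  with ev have ev': "\<forall>\<^sub>F s in at_right 0. c \<le> (\<phi> (z + s *\<^sub>R h) - \<phi> (z + 0 *\<^sub>R h)) / (s - 0)"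
    using eventually_at_right_less
  proof eventually_elim
    case (elim s)
    then have "f (z + s *\<^sub>R h) - \<phi> (z + s *\<^sub>R h) \<le> f z - \<phi> z" using d(2) by auto
    with elim have "c * s \<le> \<phi> (z + s *\<^sub>R h) - \<phi> z" by linarith
    with elim show ?case by (simp add: field_simps)
  qed
  have "((\<lambda>s. (\<phi> (z + s *\<^sub>R h) - \<phi> (z + 0 *\<^sub>R h)) / (s - 0)) \<longlongrightarrow> h \<bullet> D z) (at_right 0)"
    using C1_directional[OF C1, of z h "{0<..}"] unfolding has_field_derivative_iff .
  then show ?thesis
    using ev' by (rule tendsto_lowerbound) (rule trivial_limit_at_right_real)
qed

lemma C1_gradient_near:
  assumes "C1_with_gradient \<phi> D" "0 < e"
  obtains d where "0 < d" "\<And>y. dist y z < d \<Longrightarrow> norm (D y - D z) < e"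
  using C1_imp_continuous_gradient[OF assms(1)] assms(2)
  unfolding continuous_on_iff by (metis UNIV_I dist_norm)

lemma continuous_near:
  fixes f :: "'a::metric_space \<Rightarrow> real"
  assumes "continuous_on S f" "z \<in> S" "0 < e"
  obtains d where "0 < d" "\<And>y. y \<in> S \<Longrightarrow> dist y z < d \<Longrightarrow> \<bar>f y - f z\<bar> < e"
  using assms unfolding continuous_on_iff by (metis dist_real_def)

text \<open>Adding \<open>(norm (y - z))\<^sup>2\<close> to \<open>\<phi>\<close> makes the maximum
  strict. A function that stays below \<open>U + \<mu>\<close> near \<open>z\<close> and almost
  reaches \<open>U z\<close> at one nearby point must then be touched close to \<open>z\<close>,
  with nearly the same value and gradient. This covers suprema of subsolutions as well as uniform
  limits.\<close>

lemma touching_stability: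
  fixes z :: "'a::euclidean_space"
  assumes S: "closed S" and C1: "C1_with_gradient \<phi> D"
    and max: "local_max_on S (\<lambda>w. U w - \<phi> w) z" and e: "0 < e"
  obtains \<mu> where "0 < \<mu>"
    "\<And>w z'. usc_on S w \<Longrightarrow> (\<And>y. y \<in> S \<Longrightarrow> dist y z < e \<Longrightarrow> w y \<le> U y + \<mu>) \<Longrightarrow>
       z' \<in> S \<Longrightarrow> dist z' z < \<mu> \<Longrightarrow> U z - \<mu> < w z' \<Longrightarrow>
       \<exists>\<psi> E y. C1_with_gradient \<psi> E \<and> y \<in> S \<and> dist y z < e \<and> local_max_on S (\<lambda>x. w x - \<psi> x) y \<and>
         \<bar>w y - U z\<bar> < e \<and> norm (E y - D z) < e"
proof -
  obtain d where d: "d > 0" "\<And>w. w \<in> S \<Longrightarrow> dist w z < d \<Longrightarrow> U w - \<phi> w \<le> U z - \<phi> z"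
    using max unfolding local_max_on_iff by auto
  have c\<phi>: "continuous_on UNIV \<phi>" by (rule C1_imp_continuous[OF C1])
  obtain d1 where d1: "d1 > 0" "\<And>y. dist y z < d1 \<Longrightarrow> \<bar>\<phi> y - \<phi> z\<bar> < e / 4"
    using continuous_near[OF c\<phi>, of z "e / 4"] e by auto
  obtain d2 where d2: "d2 > 0" "\<And>y. dist y z < d2 \<Longrightarrow> norm (D y - D z) < e / 2"
    using C1_gradient_near[OF C1, of "e / 2" z] e by auto
  define \<rho> where "\<rho> = min (min d d1) (min d2 (e / 4)) / 2"
  have \<rho>: "0 < \<rho>" "\<rho> < d" "\<rho> < d1" "\<rho> < d2" "\<rho> < e / 4"
    using d(1) d1(1) d2(1) e by (auto simp: \<rho>_def min_def)
  \<comment> \<open>Four errors bound the squared distance of the new maximum point to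
    \<open>z\<close>: three are at most \<open>\<mu>\<close> and one, the variation of
    \<open>\<phi>\<close>, is below \<open>\<tau>\<close>. Their sum is less than
    \<open>4 * \<tau>\<close>, hence less than \<open>\<rho>\<^sup>2\<close>, so the maximum over
    the ball is interior.\<close>
  define \<tau> where "\<tau> = min (\<rho>\<^sup>2 / 8) (e / 8)"
  have \<tau>: "0 < \<tau>" "\<tau> \<le> \<rho>\<^sup>2 / 8" "\<tau> \<le> e / 8" using \<rho> e by (auto simp: \<tau>_def)
  obtain d3 where d3: "d3 > 0" "\<And>y. dist y z < d3 \<Longrightarrow> \<bar>\<phi> y - \<phi> z\<bar> < \<tau>"
    using continuous_near[OF c\<phi>, of z \<tau>] \<tau> by auto
  define \<mu> where "\<mu> = min (min \<tau> d3) (min 1 \<rho>)"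
  have \<mu>: "0 < \<mu>" "\<mu> \<le> \<tau>" "\<mu> \<le> d3" "\<mu> \<le> 1" "\<mu> \<le> \<rho>"
    using \<tau> d3 \<rho> by (auto simp: \<mu>_def)
  show thesis
  proof (rule that[OF \<mu>(1)])
    fix w z'
    assume w: "usc_on S w" "\<And>y. y \<in> S \<Longrightarrow> dist y z < e \<Longrightarrow> w y \<le> U y + \<mu>"
      and z': "z' \<in> S" "dist z' z < \<mu>" "U z - \<mu> < w z'"
    define \<psi> where "\<psi> y = \<phi> y + 1 * (norm (y - z))\<^sup>2" for y
    define E where "E y = D y + (2 * 1) *\<^sub>R (y - z)" for y
    have C1': "C1_with_gradient \<psi> E"
      unfolding \<psi>_def E_def by (intro C1_add C1 C1_norm_power2)
    let ?K = "S \<inter> cball z \<rho>"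
    have K: "compact ?K" using S by (simp add: closed_Int_compact)
    have "z' \<in> ?K" using z' \<mu> by (auto simp: dist_commute)
    then have ne: "?K \<noteq> {}" by blast
    have us: "usc_on ?K (\<lambda>y. w y + - \<psi> y)"
    proof (rule usc_on_add)
      show "usc_on ?K w" by (rule usc_on_subset[OF w(1)]) auto
      show "usc_on ?K (\<lambda>y. - \<psi> y)"
        by (intro continuous_on_imp_usc_on continuous_on_minus
            continuous_on_subset[OF C1_imp_continuous[OF C1']] subset_UNIV)
    qed
    obtain y where y: "y \<in> ?K" "\<And>x. x \<in> ?K \<Longrightarrow> w x - \<psi> x \<le> w y - \<psi> y"
      using usc_attains_max[OF K ne us] by auto
    have yd: "dist y z \<le> \<rho>" using y(1) by (auto simp: dist_commute)
    have Uy: "U y - \<phi> y \<le> U z - \<phi> z" using d(2) y(1) yd \<rho> by auto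
    have wy: "w y \<le> U y + \<mu>" using w(2) y(1) yd \<rho> e by auto
    have "(norm (z' - z))\<^sup>2 \<le> norm (z' - z)"
      using z'(2) \<mu>(4) by (auto simp: power2_eq_square dist_norm intro!: mult_left_le)
    then have z'2: "(norm (z' - z))\<^sup>2 \<le> \<mu>" using z'(2) by (simp add: dist_norm)
    have \<phi>z': "\<bar>\<phi> z' - \<phi> z\<bar> < \<tau>" using d3 z' \<mu> by auto
    have low: "w z' - \<psi> z' \<le> w y - \<psi> y" using y(2) \<open>z' \<in> ?K\<close> by auto
    have "(norm (y - z))\<^sup>2 < 4 * \<tau>"
      using low Uy wy z'(3) z'2 \<phi>z' \<mu>(2) unfolding \<psi>_def by linarith
    also have "\<dots> < \<rho>\<^sup>2"
      using \<tau>(2) zero_less_power[OF \<rho>(1), of 2] by linarith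
    finally have "norm (y - z) < \<rho>" using \<rho>(1) by (simp add: power2_less_imp_less)
    then have y\<rho>: "dist y z < \<rho>" by (simp add: dist_norm)
    have "local_max_on S (\<lambda>x. w x - \<psi> x) y"
      unfolding local_max_on_iff
    proof (intro conjI exI[of _ "\<rho> - dist y z"] ballI impI)
      fix x assume "x \<in> S" "dist x y < \<rho> - dist y z"
      then have "x \<in> ?K" using dist_triangle[of z x y] by (auto simp: dist_commute)
      then show "w x - \<psi> x \<le> w y - \<psi> y" using y by auto
    qed (use y y\<rho> in auto)
    moreover have "\<bar>\<phi> y - \<phi> z\<bar> < e / 4" using d1 y\<rho> \<rho> by auto
    then have "\<bar>w y - U z\<bar> < e"
      using low Uy wy z'(3) z'2 \<phi>z' \<mu>(2) \<tau>(3) e zero_le_power2[of "norm (y - z)"] unfolding \<psi>_def abs_less_iff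
      by (intro conjI) linarith+
    moreover have "norm (E y - D z) < e"
    proof -
      have "norm (E y - D z) \<le> norm (D y - D z) + norm ((2 * 1) *\<^sub>R (y - z))"
        unfolding E_def by (metis add_diff_eq add.commute norm_triangle_ineq)
      also have "\<dots> < e / 2 + 2 * \<rho>"
        using d2(2)[of y] y\<rho> \<rho> by (simp add: dist_norm)
      finally show ?thesis using \<rho> by linarith
    qed
    ultimately show "\<exists>\<psi> E y. C1_with_gradient \<psi> E \<and> y \<in> S \<and> dist y z < e \<and>
        local_max_on S (\<lambda>x. w x - \<psi> x) y \<and> \<bar>w y - U z\<bar> < e \<and> norm (E y - D z) < e"
      using C1' y(1) y\<rho> \<rho> e by (intro exI[of _ \<psi>] exI[of _ E] exI[of _ y]) auto
  qed
qed

section \<open>Lower semicontinuous envelopes\<close>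

definition lsc_env :: "'a::metric_space set \<Rightarrow> ('a \<Rightarrow> real) \<Rightarrow> 'a \<Rightarrow> real" where
  "lsc_env S f z = (SUP d\<in>{0<..}. INF w\<in>S \<inter> ball z d. f w)"

context
  fixes S :: "'a::metric_space set" and f :: "'a \<Rightarrow> real" and m :: real
  assumes bdd: "\<And>w. w \<in> S \<Longrightarrow> m \<le> f w"
begin

lemma INF_ball_le:
  assumes "z \<in> S" "0 < d"
  shows "(INF w\<in>S \<inter> ball z d. f w) \<le> f z"
  using assms bdd by (intro cINF_lower bdd_belowI[of _ m]) auto

lemma lsc_env_le: "z \<in> S \<Longrightarrow> lsc_env S f z \<le> f z"
  unfolding lsc_env_def using INF_ball_le
  by (intro cSUP_least) (auto intro: exI[of _ 1])

lemma INF_ball_le_lsc_env: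
  assumes "z \<in> S" "0 < d"
  shows "(INF w\<in>S \<inter> ball z d. f w) \<le> lsc_env S f z"
  unfolding lsc_env_def using assms INF_ball_le
  by (intro cSUP_upper bdd_aboveI[of _ "f z"]) auto

lemma lsc_env_ge:
  assumes "z \<in> S" "0 < d" "\<And>w. w \<in> S \<Longrightarrow> dist w z < d \<Longrightarrow> c \<le> f w"
  shows "c \<le> lsc_env S f z"
proof -
  have "c \<le> (INF w\<in>S \<inter> ball z d. f w)"
    using assms by (intro cINF_greatest) (auto simp: dist_commute)
  with INF_ball_le_lsc_env[OF assms(1,2)] show ?thesis by linarith
qed

lemma lsc_env_approx:
  assumes "z \<in> S" "0 < d" "lsc_env S f z < a"
  obtains w where "w \<in> S" "dist w z < d" "f w < a"
  using lsc_env_ge[OF assms(1,2), of a] assms(3) by force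

lemma lsc_env_greatest:
  assumes g: "lsc_on S g" "\<And>w. w \<in> S \<Longrightarrow> g w \<le> f w" and z: "z \<in> S"
  shows "g z \<le> lsc_env S f z"
proof (rule dense_le)
  fix a assume "a < g z"
  then have "- g z < - a" by simp
  then obtain d where "d > 0" "\<And>w. w \<in> S \<Longrightarrow> dist w z < d \<Longrightarrow> - g w < - a"
    using g(1) z unfolding lsc_on_iff_usc_on usc_on_iff by blast
  with g(2) show "a \<le> lsc_env S f z"
    by (intro lsc_env_ge[OF z, of d]) force+
qed

lemma lsc_env_lsc: "lsc_on S (lsc_env S f)"
  unfolding lsc_on_iff_usc_on usc_on_iff
proof (intro ballI allI impI)
  fix z a assume z: "z \<in> S" and a: "- lsc_env S f z < a"
  then have "- a < lsc_env S f z" by simp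
  then obtain d where d: "0 < d" "- a < (INF w\<in>S \<inter> ball z d. f w)"
    unfolding lsc_env_def using INF_ball_le[OF z]
    by (subst (asm) less_cSUP_iff) (auto intro!: bdd_aboveI[of _ "f z"] exI[of _ 1])
  show "\<exists>d>0. \<forall>w\<in>S. dist w z < d \<longrightarrow> - lsc_env S f w < a"
  proof (intro exI[of _ d] conjI ballI impI d(1))
    fix w assume w: "w \<in> S" "dist w z < d"
    have "(INF w\<in>S \<inter> ball z d. f w) \<le> lsc_env S f w"
    proof (rule lsc_env_ge[OF w(1), of "d - dist w z"])
      fix x assume "x \<in> S" "dist x w < d - dist w z"
      then have "x \<in> S \<inter> ball z d" using dist_triangle[of z x w] by (auto simp: dist_commute)
      then show "(INF w\<in>S \<inter> ball z d. f w) \<le> f x"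
        using bdd by (intro cINF_lower bdd_belowI[of _ m]) auto
    qed (use w in auto)
    then show "- lsc_env S f w < a" using d(2) by linarith
  qed
qed

end

lemma usc_on_vec_near:
  fixes w :: "'a::metric_space \<Rightarrow> real^'m"
  assumes "\<And>k. usc_on S (\<lambda>z. w z $ k)" "z \<in> S" "0 < e"
  obtains d where "0 < d" "\<And>y k. y \<in> S \<Longrightarrow> dist y z < d \<Longrightarrow> w y $ k < w z $ k + e"
proof -
  have "\<exists>d>0. \<forall>y\<in>S. dist y z < d \<longrightarrow> w y $ k < w z $ k + e" for k
    using assms unfolding usc_on_iff by auto
  then obtain d where d: "\<And>k. d k > 0" "\<And>k y. y \<in> S \<Longrightarrow> dist y z < d k \<Longrightarrow> w y $ k < w z $ k + e"
    by metis
  show thesis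
    by (rule that[of "Min (range d)"]) (use d in auto)
qed

lemma lsc_on_vec_near:
  fixes w :: "'a::metric_space \<Rightarrow> real^'m"
  assumes "\<And>k. lsc_on S (\<lambda>z. w z $ k)" "z \<in> S" "0 < e"
  obtains d where "0 < d" "\<And>y k. y \<in> S \<Longrightarrow> dist y z < d \<Longrightarrow> w z $ k - e < w y $ k"
proof -
  have "\<And>k. usc_on S (\<lambda>z. (- w z) $ k)"
    using assms(1) by (simp add: lsc_on_iff_usc_on)
  from usc_on_vec_near[OF this assms(2,3)] obtain d where
    "0 < d" "\<And>y k. y \<in> S \<Longrightarrow> dist y z < d \<Longrightarrow> (- w y) $ k < (- w z) $ k + e" by auto
  then have "w z $ k - e < w y $ k" if "y \<in> S" "dist y z < d" for y k
    using that unfolding vector_uminus_component by (smt (verit))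
  with \<open>0 < d\<close> show thesis by (rule that)
qed

text \<open>Closeness in \<open>r\<close> is required componentwise because Perron's method alters
  vectors one component at a time. The divisor \<open>real CARD('m) + 2\<close> pays for the l1
  bound on \<open>norm (s - r)\<close> and for the other two arguments.\<close>

lemma continuous_sign_near:
  fixes G :: "'a::metric_space \<Rightarrow> real^'m \<Rightarrow> 'b::real_normed_vector \<Rightarrow> real"
  assumes cont: "continuous_on UNIV (\<lambda>(z, r, p). G z r p)" and pos: "a < G z r p"
  obtains e where "0 < e"
    "\<And>y s q. dist y z < e \<Longrightarrow> (\<And>k. \<bar>s $ k - r $ k\<bar> < e) \<Longrightarrow> norm (q - p) < e \<Longrightarrow> a < G y s q"
proof -
  have "open {x. a < (\<lambda>(z, r, p). G z r p) x}"
    by (intro open_Collect_less cont continuous_on_const)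
  moreover have "(z, r, p) \<in> {x. a < (\<lambda>(z, r, p). G z r p) x}" using pos by simp
  ultimately obtain e where e: "e > 0" "ball (z, r, p) e \<subseteq> {x. a < (\<lambda>(z, r, p). G z r p) x}"
    by (metis openE)
  define e' where "e' = e / (real CARD('m) + 2)"
  have e': "e' > 0" "e' * (real CARD('m) + 2) = e" using e(1) by (auto simp: e'_def field_simps add_pos_pos)
  show thesis
  proof (rule that[OF e'(1)])
    fix y s q
    assume *: "dist y z < e'" "\<And>k. \<bar>s $ k - r $ k\<bar> < e'" "norm (q - p) < e'"
    have "norm (s - r) \<le> (\<Sum>k\<in>UNIV. \<bar>(s - r) $ k\<bar>)" by (rule norm_le_l1_cart)
    also have "\<dots> \<le> (\<Sum>k\<in>(UNIV::'m set). e')" using *(2) by (intro sum_mono) (auto intro: less_imp_le)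
    finally have "norm (s - r) \<le> CARD('m) * e'" by simp
    moreover have "dist (y, s, q) (z, r, p) \<le> dist y z + dist (s, q) (r, p)"
      unfolding dist_Pair_Pair[of y "(s, q)"] by (rule sqrt_sum_squares_le_sum) auto
    moreover have "dist (s, q) (r, p) \<le> dist s r + dist q p"
      unfolding dist_Pair_Pair by (rule sqrt_sum_squares_le_sum) auto
    ultimately have "dist (y, s, q) (z, r, p) < e"
      using * e'(2) by (simp add: dist_norm algebra_simps)
    with e(2) have "(y, s, q) \<in> {x. a < (\<lambda>(z, r, p). G z r p) x}"
      by (auto simp: dist_commute)
    then show "a < G y s q" by simp
  qed
qed

section \<open>Perron's method\<close>

text \<open>Extrema and semicontinuity are relative to \<open>S\<close>, while the equation is
  imposed on \<open>P\<close> only. The whole space is the case where both are \<open>UNIV\<close>;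
  in the evolution problem \<open>P\<close> omits the initial time but keeps the terminal
  one.\<close>

definition visc_sub ::
  "'a::real_inner set \<Rightarrow> 'a set \<Rightarrow> ('m::finite \<Rightarrow> 'a \<Rightarrow> real^'m \<Rightarrow> 'a \<Rightarrow> real) \<Rightarrow> ('a \<Rightarrow> real^'m) \<Rightarrow> bool"
where
  "visc_sub S P F w \<longleftrightarrow> (\<forall>i. usc_on S (\<lambda>z. w z $ i)) \<and>
     (\<forall>\<phi> D i z. C1_with_gradient \<phi> D \<and> z \<in> P \<and> local_max_on S (\<lambda>z. w z $ i - \<phi> z) z \<longrightarrow>
        F i z (w z) (D z) \<le> 0)"

definition visc_super ::
  "'a::real_inner set \<Rightarrow> 'a set \<Rightarrow> ('m::finite \<Rightarrow> 'a \<Rightarrow> real^'m \<Rightarrow> 'a \<Rightarrow> real) \<Rightarrow> ('a \<Rightarrow> real^'m) \<Rightarrow> bool"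
where
  "visc_super S P F w \<longleftrightarrow> (\<forall>i. lsc_on S (\<lambda>z. w z $ i)) \<and>
     (\<forall>\<phi> D i z. C1_with_gradient \<phi> D \<and> z \<in> P \<and> local_min_on S (\<lambda>z. w z $ i - \<phi> z) z \<longrightarrow>
        0 \<le> F i z (w z) (D z))"

lemma visc_subD:
  assumes "visc_sub S P F w" "C1_with_gradient \<phi> D" "z \<in> P" "local_max_on S (\<lambda>z. w z $ i - \<phi> z) z"
  shows "F i z (w z) (D z) \<le> 0"
  using assms unfolding visc_sub_def by blast

lemma visc_superD:
  assumes "visc_super S P F w" "C1_with_gradient \<phi> D" "z \<in> P" "local_min_on S (\<lambda>z. w z $ i - \<phi> z) z"
  shows "0 \<le> F i z (w z) (D z)"
  using assms unfolding visc_super_def by blast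

lemma visc_sub_cong:
  assumes "visc_sub S P F w" "P \<subseteq> S" "\<And>z. z \<in> S \<Longrightarrow> w z = v z"
  shows "visc_sub S P F v"
  unfolding visc_sub_def
proof (intro conjI allI impI)
  fix i show "usc_on S (\<lambda>z. v z $ i)"
    using assms(1) unfolding visc_sub_def usc_on_iff by (simp cong: ball_cong add: assms(3)[symmetric])
next
  fix \<phi> D i z
  assume *: "C1_with_gradient \<phi> D \<and> z \<in> P \<and> local_max_on S (\<lambda>z. v z $ i - \<phi> z) z"
  then have "local_max_on S (\<lambda>z. w z $ i - \<phi> z) z"
    unfolding local_max_on_iff by (simp cong: ball_cong add: assms(3))
  then have "F i z (w z) (D z) \<le> 0" using * by (intro visc_subD[OF assms(1)]) auto
  with * assms(2,3) show "F i z (v z) (D z) \<le> 0" by (simp add: subset_iff)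
qed

text \<open>\<open>gradient_mono\<close> stands for the equality of gradients at a touching point,
  which may fail in the time direction at the terminal time. \<open>barrier\<close> states that
  \<open>B\<close> is a supersolution in component \<open>i\<close> whatever admissible values the
  other components take: it is used where the candidate solution meets \<open>B\<close> in component
  \<open>i\<close> while the others may lie strictly below \<open>B\<close>.\<close>

locale perron =
  fixes S P :: "'a::euclidean_space set"
    and F :: "'m::finite \<Rightarrow> 'a \<Rightarrow> real^'m \<Rightarrow> 'a \<Rightarrow> real"
    and b B :: "'a \<Rightarrow> real^'m" and m M :: real
  assumes closed: "closed S" and P_subset: "P \<subseteq> S"
    and P_open: "\<And>z. z \<in> P \<Longrightarrow> \<exists>e>0. \<forall>y\<in>S. dist y z < e \<longrightarrow> y \<in> P"
    and cont: "\<And>i. continuous_on UNIV (\<lambda>(z, r, p). F i z r p)"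
    and quasimonotone: "\<And>i z r s p. r $ i = s $ i \<Longrightarrow> (\<And>k. r $ k \<le> s $ k) \<Longrightarrow> F i z s p \<le> F i z r p"
    and gradient_mono: "\<And>\<phi> D \<psi> E i z r. C1_with_gradient \<phi> D \<Longrightarrow> C1_with_gradient \<psi> E \<Longrightarrow>
        z \<in> P \<Longrightarrow> local_max_on S (\<lambda>x. \<phi> x - \<psi> x) z \<Longrightarrow> F i z r (E z) \<le> F i z r (D z)"
    and b_sub: "visc_sub S P F b" and b_le_B: "\<And>z i. z \<in> S \<Longrightarrow> b z $ i \<le> B z $ i"
    and B_cont: "\<And>i. continuous_on S (\<lambda>z. B z $ i)"
    and b_ge: "\<And>z i. z \<in> S \<Longrightarrow> m \<le> b z $ i" and B_le: "\<And>z i. z \<in> S \<Longrightarrow> B z $ i \<le> M"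
    and barrier: "\<And>\<phi> D i z r. C1_with_gradient \<phi> D \<Longrightarrow> z \<in> P \<Longrightarrow>
        local_min_on S (\<lambda>x. B x $ i - \<phi> x) z \<Longrightarrow> r $ i = B z $ i \<Longrightarrow>
        (\<And>k. m \<le> r $ k \<and> r $ k \<le> B z $ k) \<Longrightarrow> 0 \<le> F i z r (D z)"
begin

definition subs :: "('a \<Rightarrow> real^'m) set" where
  "subs = {w. visc_sub S P F w \<and> (\<forall>z\<in>S. \<forall>i. w z $ i \<le> B z $ i)}"

definition sup_sub :: "'m \<Rightarrow> 'a \<Rightarrow> real" where
  "sup_sub i z = (SUP w\<in>subs. w z $ i)"

text \<open>The upper semicontinuous envelope of the supremum of all subsolutions below
  \<open>B\<close>, written as minus the lower envelope of its negative.\<close>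

definition W :: "'a \<Rightarrow> real^'m" where
  "W z = (\<chi> i. - lsc_env S (\<lambda>y. - sup_sub i y) z)"

definition V :: "'a \<Rightarrow> real^'m" where
  "V z = (\<chi> i. lsc_env S (\<lambda>y. W y $ i) z)"

lemma b_in_subs: "b \<in> subs"
  using b_sub b_le_B by (auto simp: subs_def)

lemma le_sup_sub: "w \<in> subs \<Longrightarrow> z \<in> S \<Longrightarrow> w z $ i \<le> sup_sub i z"
  unfolding sup_sub_def by (intro cSUP_upper bdd_aboveI[of _ "B z $ i"]) (auto simp: subs_def)

lemma sup_sub_le: "z \<in> S \<Longrightarrow> sup_sub i z \<le> B z $ i"
  unfolding sup_sub_def using b_in_subs by (intro cSUP_least) (auto simp: subs_def)

lemma neg_sup_sub_ge: "z \<in> S \<Longrightarrow> - M \<le> - sup_sub i z"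
  using sup_sub_le B_le by (metis neg_le_iff_le order_trans)

lemma W_usc: "usc_on S (\<lambda>z. W z $ i)"
  using lsc_env_lsc[where S = S and f = "\<lambda>y. - sup_sub i y" and m = "- M"] neg_sup_sub_ge
  by (simp add: W_def lsc_on_iff_usc_on)

lemma subs_le_W: "w \<in> subs \<Longrightarrow> z \<in> S \<Longrightarrow> w z $ i \<le> W z $ i"
  using lsc_env_le[where S = S and f = "\<lambda>y. - sup_sub i y" and m = "- M"] neg_sup_sub_ge le_sup_sub[of w z i]
  unfolding W_def by fastforce

lemma W_le_B: "z \<in> S \<Longrightarrow> W z $ i \<le> B z $ i"
  using lsc_env_greatest[where S = S and f = "\<lambda>y. - sup_sub i y" and m = "- M" and g = "\<lambda>z. - B z $ i" and z = z]
    neg_sup_sub_ge sup_sub_le continuous_on_imp_lsc_on[OF continuous_on_minus[OF B_cont[of i]]]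
  unfolding W_def by fastforce

lemma W_approx:
  assumes "z \<in> S" "0 < d" "a < W z $ i"
  obtains w z' where "w \<in> subs" "z' \<in> S" "dist z' z < d" "a < w z' $ i"
proof -
  have "lsc_env S (\<lambda>y. - sup_sub i y) z < - a" using assms(3) by (simp add: W_def)
  then obtain z' where z': "z' \<in> S" "dist z' z < d" "- sup_sub i z' < - a"
    using lsc_env_approx[where S = S and f = "\<lambda>y. - sup_sub i y" and m = "- M"] neg_sup_sub_ge assms(1,2)
    by metis
  then have "a < (SUP w\<in>subs. w z' $ i)" by (simp add: sup_sub_def)
  then obtain w where "w \<in> subs" "a < w z' $ i"
    using b_in_subs z'(1)
    by (subst (asm) less_cSUP_iff) (auto simp: subs_def intro!: bdd_aboveI[of _ "B z' $ i"])
  with z' show thesis by (intro that) auto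
qed

text \<open>The touching points of the approximating subsolutions converge to \<open>z\<close>; quasimonotonicity lets
  one replace their other components by upper bounds that are close to those of \<open>W z\<close>.\<close>

lemma W_sub: "visc_sub S P F W"
  unfolding visc_sub_def
proof (intro conjI allI impI W_usc)
  fix \<phi> D i z
  assume *: "C1_with_gradient \<phi> D \<and> z \<in> P \<and> local_max_on S (\<lambda>z. W z $ i - \<phi> z) z"
  then have z: "z \<in> S" using P_subset by auto
  show "F i z (W z) (D z) \<le> 0"
  proof (rule ccontr)
    assume "\<not> ?thesis"
    then have "0 < F i z (W z) (D z)" by simp
    then obtain e where e: "0 < e" "\<And>y s q. dist y z < e \<Longrightarrow> (\<And>k. \<bar>s $ k - W z $ k\<bar> < e) \<Longrightarrow>
        norm (q - D z) < e \<Longrightarrow> 0 < F i y s q"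
      using continuous_sign_near[OF cont, of 0 i z "W z" "D z"] by metis
    obtain e1 where e1: "e1 > 0" "\<And>y. y \<in> S \<Longrightarrow> dist y z < e1 \<Longrightarrow> y \<in> P"
      using P_open * by blast
    obtain e2 where e2: "e2 > 0" "\<And>y k. y \<in> S \<Longrightarrow> dist y z < e2 \<Longrightarrow> W y $ k < W z $ k + e / 2"
      using usc_on_vec_near[of S W z "e / 2"] W_usc z e(1) by auto
    define \<epsilon> where "\<epsilon> = min e (min e1 e2)"
    have \<epsilon>: "0 < \<epsilon>" "\<epsilon> \<le> e" "\<epsilon> \<le> e1" "\<epsilon> \<le> e2" using e e1 e2 by (auto simp: \<epsilon>_def)
    obtain \<mu> where \<mu>: "0 < \<mu>"
      "\<And>w z'. usc_on S w \<Longrightarrow> (\<And>y. y \<in> S \<Longrightarrow> dist y z < \<epsilon> \<Longrightarrow> w y \<le> W y $ i + \<mu>) \<Longrightarrow>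
         z' \<in> S \<Longrightarrow> dist z' z < \<mu> \<Longrightarrow> W z $ i - \<mu> < w z' \<Longrightarrow>
         \<exists>\<psi> E y. C1_with_gradient \<psi> E \<and> y \<in> S \<and> dist y z < \<epsilon> \<and> local_max_on S (\<lambda>x. w x - \<psi> x) y \<and>
           \<bar>w y - W z $ i\<bar> < \<epsilon> \<and> norm (E y - D z) < \<epsilon>"
      using touching_stability[OF closed, of \<phi> D "\<lambda>x. W x $ i" z \<epsilon>] * \<epsilon>(1) by blast
    obtain w z' where w: "w \<in> subs" "z' \<in> S" "dist z' z < \<mu>" "W z $ i - \<mu> < w z' $ i"
      using W_approx[OF z \<mu>(1), of "W z $ i - \<mu>" i] \<mu>(1) by auto
    have ws: "visc_sub S P F w" using w(1) by (simp add: subs_def)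
    have "\<exists>\<psi> E y. C1_with_gradient \<psi> E \<and> y \<in> S \<and> dist y z < \<epsilon> \<and> local_max_on S (\<lambda>x. w x $ i - \<psi> x) y \<and>
           \<bar>w y $ i - W z $ i\<bar> < \<epsilon> \<and> norm (E y - D z) < \<epsilon>"
    proof (rule \<mu>(2)[of "\<lambda>x. w x $ i" z'])
      show "usc_on S (\<lambda>x. w x $ i)" using ws by (simp add: visc_sub_def)
      show "w y $ i \<le> W y $ i + \<mu>" if "y \<in> S" for y
        using subs_le_W[OF w(1) that, of i] \<mu>(1) by linarith
    qed (use w in auto)
    then obtain \<psi> E y where y: "C1_with_gradient \<psi> E" "y \<in> S" "dist y z < \<epsilon>"
      "local_max_on S (\<lambda>x. w x $ i - \<psi> x) y" "\<bar>w y $ i - W z $ i\<bar> < \<epsilon>" "norm (E y - D z) < \<epsilon>" by blast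
    have "y \<in> P" using e1(2) y(2,3) \<epsilon> by auto
    then have le: "F i y (w y) (E y) \<le> 0" using visc_subD[OF ws y(1) _ y(4)] by simp
    define r where "r = (\<chi> k. if k = i then w y $ i else W z $ k + e / 2)"
    have "F i y r (E y) \<le> F i y (w y) (E y)"
    proof (rule quasimonotone)
      show "w y $ k \<le> r $ k" for k
        using subs_le_W[OF w(1) y(2), of k] e2(2)[OF y(2), of k] y(3) \<epsilon> by (auto simp: r_def)
    qed (simp add: r_def)
    moreover have "0 < F i y r (E y)"
      using y \<epsilon> e(1) by (intro e(2)) (auto simp: r_def)
    ultimately show False using le by linarith
  qed
qed

lemma W_ge: "z \<in> S \<Longrightarrow> m \<le> W z $ i"
  using subs_le_W[OF b_in_subs] b_ge by (meson order_trans)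

lemma V_lsc: "lsc_on S (\<lambda>z. V z $ i)"
  using lsc_env_lsc[where S = S and f = "\<lambda>y. W y $ i" and m = m] W_ge by (simp add: V_def)

lemma V_le_W: "z \<in> S \<Longrightarrow> V z $ i \<le> W z $ i"
  using lsc_env_le[where S = S and f = "\<lambda>y. W y $ i" and m = m] W_ge by (simp add: V_def)

lemma V_greatest:
  assumes "lsc_on S g" "\<And>z. z \<in> S \<Longrightarrow> g z \<le> W z $ i" "z \<in> S"
  shows "g z \<le> V z $ i"
  using lsc_env_greatest[where S = S and f = "\<lambda>y. W y $ i" and m = m, OF W_ge assms] by (simp add: V_def)

lemma V_ge: "z \<in> S \<Longrightarrow> m \<le> V z $ i"
  by (rule V_greatest[of "\<lambda>_. m"]) (auto intro: W_ge continuous_on_imp_lsc_on)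

text \<open>Raising the test function that violates the supersolution property and taking the maximum with
  \<open>W\<close> near the touching point would give a larger subsolution.\<close>

lemma V_super: "visc_super S P F V"
  unfolding visc_super_def
proof (intro conjI allI impI V_lsc)
  fix \<phi> D i z
  assume *: "C1_with_gradient \<phi> D \<and> z \<in> P \<and> local_min_on S (\<lambda>z. V z $ i - \<phi> z) z"
  then have z: "z \<in> S" and C1: "C1_with_gradient \<phi> D" using P_subset by auto
  obtain d0 where d0: "d0 > 0" "\<And>w. w \<in> S \<Longrightarrow> dist w z < d0 \<Longrightarrow> V z $ i - \<phi> z \<le> V w $ i - \<phi> w"
    using * unfolding local_min_on_iff by auto
  have VB: "V y $ k \<le> B y $ k" if "y \<in> S" for y k
    using V_le_W[OF that] W_le_B[OF that] by (meson order_trans)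
  show "0 \<le> F i z (V z) (D z)"
  \<comment> \<open>Where \<open>V\<close> meets the upper barrier there is no room to raise
    anything, but a test function touching \<open>V\<close> from below also touches
    \<open>B\<close>, so \<open>barrier\<close> applies.\<close>
  proof (cases "V z $ i = B z $ i")
    case True
    have "local_min_on S (\<lambda>x. B x $ i - \<phi> x) z"
      unfolding local_min_on_iff
    proof (intro conjI exI[of _ d0] ballI impI d0(1) z)
      fix w assume "w \<in> S" "dist w z < d0"
      with d0(2)[of w] VB[of w i] True show "B z $ i - \<phi> z \<le> B w $ i - \<phi> w" by simp
    qed
    then show ?thesis
      using barrier[of \<phi> D z i "V z"] C1 * True V_ge[OF z] VB[OF z] by blast
  next
    case False
    show ?thesis
    proof (rule ccontr)
      assume "\<not> ?thesis"
      then have neg: "0 < - F i z (V z) (D z)" by simp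
      have "continuous_on UNIV (\<lambda>(z, r, p). - F i z r p)"
        using continuous_on_minus[OF cont[of i]] by (simp add: case_prod_unfold)
      from continuous_sign_near[OF this neg]
      obtain e where e: "0 < e" "\<And>y s q. dist y z < e \<Longrightarrow> (\<And>k. \<bar>s $ k - V z $ k\<bar> < e) \<Longrightarrow>
          norm (q - D z) < e \<Longrightarrow> F i y s q < 0"
        by (metis neg_0_less_iff_less)
      obtain d1 where d1: "d1 > 0" "\<And>y. y \<in> S \<Longrightarrow> dist y z < d1 \<Longrightarrow> y \<in> P"
        using P_open * by blast
      obtain d2 where d2: "d2 > 0" "\<And>y. dist y z < d2 \<Longrightarrow> norm (D y - D z) < e / 2"
        using C1_gradient_near[OF C1, of "e / 2" z] e by auto
      define g where "g = B z $ i - V z $ i"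
      have g: "g > 0" using False VB[OF z, of i] by (simp add: g_def)
      obtain d3 where d3: "d3 > 0" "\<And>y. dist y z < d3 \<Longrightarrow> \<bar>\<phi> y - \<phi> z\<bar> < min (e / 4) (g / 3)"
        using continuous_near[OF C1_imp_continuous[OF C1], of z "min (e / 4) (g / 3)"] e g by auto
      obtain d4 where d4: "d4 > 0" "\<And>y k. y \<in> S \<Longrightarrow> dist y z < d4 \<Longrightarrow> V z $ k - e / 2 < V y $ k"
        using lsc_on_vec_near[of S V z "e / 2"] V_lsc z e(1) by auto
      obtain d5 where d5: "d5 > 0" "\<And>y. y \<in> S \<Longrightarrow> dist y z < d5 \<Longrightarrow> \<bar>B y $ i - B z $ i\<bar> < g / 3"
        using continuous_near[OF B_cont[of i] z, of "g / 3"] g by auto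
      define \<rho> where "\<rho> = Min {d0, d1, d2, d3, d4, d5, e / 4, 1} / 2"
      have "0 < Min {d0, d1, d2, d3, d4, d5, e / 4, 1}"
        using d0(1) d1(1) d2(1) d3(1) d4(1) d5(1) e(1) by (subst Min_gr_iff) auto
      then have \<rho>0: "0 < \<rho>"
        unfolding \<rho>_def by (rule half_gt_zero)
      have \<rho>_le: "2 * \<rho> \<le> x" if "x \<in> {d0, d1, d2, d3, d4, d5, e / 4, 1}" for x
      proof -
        have "2 * \<rho> = Min {d0, d1, d2, d3, d4, d5, e / 4, 1}"
          unfolding \<rho>_def by (rule nonzero_mult_div_cancel_left[THEN trans[OF times_divide_eq_right]]) (rule zero_neq_numeral[symmetric])
        also have "\<dots> \<le> x" by (rule Min_le[OF _ that]) (intro finite.intros)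
        finally show ?thesis .
      qed
      have \<rho>: "0 < \<rho>" "\<rho> < d0" "\<rho> < d1" "\<rho> < d2" "\<rho> < d3" "\<rho> < d4" "\<rho> < d5" "\<rho> < e / 4" "\<rho> < 1"
        using \<rho>0 \<rho>_le[of d0] \<rho>_le[of d1] \<rho>_le[of d2] \<rho>_le[of d3] \<rho>_le[of d4] \<rho>_le[of d5] \<rho>_le[of "e / 4"] \<rho>_le[of 1]
        by simp_all
      have "\<rho> * \<rho> \<le> \<rho> * 1" using \<rho>(1,9) by (intro mult_left_mono) auto
      then have \<rho>2: "\<rho>\<^sup>2 \<le> e / 4" using \<rho>(8) unfolding power2_eq_square by linarith
      \<comment> \<open>The lift \<open>\<mu>\<close> is at most \<open>\<rho>\<^sup>2 / 8\<close>,
        while the quadratic term removes at least \<open>\<rho>\<^sup>2 / 4\<close> from distance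
        \<open>\<rho> / 2\<close> on: this puts the bump below \<open>W\<close> there. The bound
        \<open>g / 4\<close>, with the two variations \<open>g / 3\<close>, keeps it below
        \<open>B\<close>, and \<open>e / 4\<close> keeps its values near \<open>V z\<close>.\<close>
      define \<mu> where "\<mu> = min (\<rho>\<^sup>2 / 8) (min (g / 4) (e / 4))"
      have \<mu>: "0 < \<mu>" "\<mu> \<le> \<rho>\<^sup>2 / 8" "\<mu> \<le> g / 4" "\<mu> \<le> e / 4" using \<rho> g e by (auto simp: \<mu>_def)
      define h where "h y = \<phi> y + (- 1) * (norm (y - z))\<^sup>2 + (V z $ i - \<phi> z + \<mu>)" for y
      define E where "E y = D y + (2 * (- 1)) *\<^sub>R (y - z) + 0" for y
      have hC1: "C1_with_gradient h E"
        unfolding h_def E_def by (intro C1_add C1 C1_norm_power2 C1_const)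
      have hcont: "continuous_on UNIV h" by (rule C1_imp_continuous[OF hC1])
      have h_less: "h y < W y $ i" if "y \<in> S" "\<rho> / 2 \<le> dist y z" "dist y z < \<rho>" for y
      proof -
        have "(\<rho> / 2)\<^sup>2 \<le> (norm (y - z))\<^sup>2"
          using that \<rho>(1) by (intro power_mono) (auto simp: dist_norm)
        then have "\<rho>\<^sup>2 / 4 \<le> (norm (y - z))\<^sup>2" by (simp add: power_divide)
        moreover have "V z $ i - \<phi> z \<le> V y $ i - \<phi> y" using d0(2) that \<rho> by auto
        moreover have "0 < \<rho>\<^sup>2" using \<rho>(1) by simp
        ultimately have "h y < V y $ i" using \<mu>(2) unfolding h_def by linarith
        then show ?thesis using V_le_W[OF that(1), of i] by linarith
      qed
      \<comment> \<open>By \<open>h_less\<close> the maximum equals \<open>W\<close> on the annulus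
        between radii \<open>\<rho> / 2\<close> and \<open>\<rho>\<close>, so cutting off at
        \<open>\<rho>\<close> creates no jump.\<close>
      define X where "X y = (\<chi> k. if k = i \<and> dist y z < \<rho> then max (W y $ i) (h y) else W y $ k)" for y
      have XW: "W y $ k \<le> X y $ k" for y k by (auto simp: X_def)
      have Xk: "X y $ k = W y $ k" if "k \<noteq> i" for y k using that by (simp add: X_def)
      have Xi: "X y $ i = max (W y $ i) (h y)" if "dist y z < \<rho>" for y using that by (simp add: X_def)
      have Xo: "X y $ i = W y $ i" if "y \<in> S" "\<rho> / 2 \<le> dist y z" for y
        using h_less[OF that] by (auto simp: X_def)
      have h_bounds: "\<bar>h y - V z $ i\<bar> < e \<and> h y \<le> B y $ i" if "y \<in> S" "dist y z < \<rho>" for y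
      proof -
        have "(norm (y - z))\<^sup>2 \<le> \<rho>\<^sup>2" using that by (intro power_mono) (auto simp: dist_norm)
        moreover have "\<bar>\<phi> y - \<phi> z\<bar> < e / 4" and g3: "\<bar>\<phi> y - \<phi> z\<bar> < g / 3" "\<bar>B y $ i - B z $ i\<bar> < g / 3"
          using d3(2)[of y] d5(2)[of y] that \<rho> by auto
        ultimately have "\<bar>h y - V z $ i\<bar> < e"
          using \<rho>2 \<mu>(1,4) e(1) zero_le_power2[of "norm (y - z)"] unfolding h_def by linarith
        moreover have "h y \<le> \<phi> y - \<phi> z + V z $ i + g / 4"
          using \<mu>(3) zero_le_power2[of "norm (y - z)"] unfolding h_def by linarith
        then have "h y \<le> B y $ i" using g3 g g_def by linarith
        ultimately show ?thesis by blast
      qed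
      have "X \<in> subs"
        unfolding subs_def visc_sub_def
      proof (intro CollectI conjI allI impI ballI)
        fix k
        show "usc_on S (\<lambda>y. X y $ k)"
        proof (cases "k = i")
          case False
          then show ?thesis using W_usc[of k] by (simp add: Xk)
        next
          case True
          show ?thesis
            unfolding usc_on_iff True
          proof (intro ballI allI impI)
            fix y a assume y: "y \<in> S" and a: "X y $ i < a"
            then have "W y $ i < a" using XW[of y i] by linarith
            then obtain d where d: "d > 0" "\<And>x. x \<in> S \<Longrightarrow> dist x y < d \<Longrightarrow> W x $ i < a"
              using W_usc[of i] y unfolding usc_on_iff by blast
            show "\<exists>d>0. \<forall>x\<in>S. dist x y < d \<longrightarrow> X x $ i < a"
            proof (cases "dist y z < \<rho>")
              case True
              then have "h y < a" using a by (simp add: Xi)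
              then obtain d' where d': "d' > 0" "\<And>x. dist x y < d' \<Longrightarrow> h x < a"
                using continuous_on_imp_usc_on[OF hcont] unfolding usc_on_iff by blast
              show ?thesis
              proof (intro exI[of _ "min (min d d') (\<rho> - dist y z)"] conjI ballI impI)
                fix x assume x: "x \<in> S" "dist x y < min (min d d') (\<rho> - dist y z)"
                then have "dist x z < \<rho>" using dist_triangle[of x z y] by auto
                then show "X x $ i < a" using x d(2) d'(2) by (simp add: Xi)
              qed (use True d d' in auto)
            next
              case False
              show ?thesis
              proof (intro exI[of _ "min d (\<rho> / 2)"] conjI ballI impI)
                fix x assume x: "x \<in> S" "dist x y < min d (\<rho> / 2)"
                then have "\<rho> / 2 \<le> dist x z"
                  using dist_triangle[of y z x] False by (auto simp: dist_commute)
                then show "X x $ i < a" using x d(2) Xo by simp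
              qed (use \<rho> d in auto)
            qed
          qed
        qed
      next
        fix \<psi> E' j y
        assume **: "C1_with_gradient \<psi> E' \<and> y \<in> P \<and> local_max_on S (\<lambda>x. X x $ j - \<psi> x) y"
        then have y: "y \<in> S" using P_subset by auto
        obtain d where d: "d > 0" "\<And>x. x \<in> S \<Longrightarrow> dist x y < d \<Longrightarrow> X x $ j - \<psi> x \<le> X y $ j - \<psi> y"
          using ** unfolding local_max_on_iff by auto
        show "F j y (X y) (E' y) \<le> 0"
        \<comment> \<open>Where component \<open>j\<close> is unchanged, the test function also
          touches \<open>W\<close>, and raising component \<open>i\<close> can only lower
          \<open>F j\<close>. Otherwise it touches the smooth bump \<open>h\<close>, which is a
          strict classical subsolution near \<open>z\<close>.\<close>
        proof (cases "X y $ j = W y $ j")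
          case True
          have "local_max_on S (\<lambda>x. W x $ j - \<psi> x) y"
            unfolding local_max_on_iff
          proof (intro conjI exI[of _ d] ballI impI d(1) y)
            fix x assume "x \<in> S" "dist x y < d"
            with d(2)[of x] XW[of x j] True show "W x $ j - \<psi> x \<le> W y $ j - \<psi> y" by linarith
          qed
          then have "F j y (W y) (E' y) \<le> 0" using ** by (intro visc_subD[OF W_sub]) auto
          moreover have "F j y (X y) (E' y) \<le> F j y (W y) (E' y)"
            using True XW by (intro quasimonotone) auto
          ultimately show ?thesis by linarith
        next
          case False
          then have j: "j = i" using Xk by blast
          have yz: "dist y z < \<rho>" using False by (auto simp: X_def j split: if_splits)
          have Xy: "X y $ i = h y" using False Xi[OF yz] by (auto simp: j max_def split: if_splits)
          have "local_max_on S (\<lambda>x. h x - \<psi> x) y"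
            unfolding local_max_on_iff
          proof (intro conjI exI[of _ "min d (\<rho> - dist y z)"] ballI impI y)
            fix x assume x: "x \<in> S" "dist x y < min d (\<rho> - dist y z)"
            then have "dist x z < \<rho>" using dist_triangle[of x z y] by auto
            then have "h x \<le> X x $ i" by (simp add: Xi)
            then show "h x - \<psi> x \<le> h y - \<psi> y" using d(2)[of x] x Xy by (simp add: j)
          qed (use d yz in auto)
          then have "F i y (X y) (E' y) \<le> F i y (X y) (E y)"
            using gradient_mono[OF hC1] ** by blast
          \<comment> \<open>The other components of \<open>X y\<close> may be far above those of
            \<open>V z\<close>. Only a lower bound is at hand, and it suffices since larger
            components decrease \<open>F i\<close>.\<close>
          also define r where "r = (\<chi> k. if k = i then h y else V z $ k - e / 2)"
          have "F i y (X y) (E y) \<le> F i y r (E y)"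
          proof (rule quasimonotone)
            fix k
            have "V z $ k - e / 2 < V y $ k" using d4(2)[OF y] yz \<rho> by auto
            then show "r $ k \<le> X y $ k"
              using V_le_W[OF y, of k] XW[of y k] by (auto simp: r_def Xy)
          qed (simp add: r_def Xy)
          also have "F i y r (E y) < 0"
          proof (rule e(2))
            show "dist y z < e" using yz \<rho> e by linarith
            show "\<bar>r $ k - V z $ k\<bar> < e" for k
              using h_bounds[OF y yz] e(1) by (auto simp: r_def)
            have "norm (E y - D z) \<le> norm (D y - D z) + norm ((2 * (- 1)) *\<^sub>R (y - z))"
              unfolding E_def by (metis add_0_right add_diff_eq add.commute norm_triangle_ineq)
            also have "\<dots> < e / 2 + 2 * \<rho>"
              using d2(2)[of y] yz \<rho> by (simp add: dist_norm)
            finally show "norm (E y - D z) < e" using \<rho> by linarith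
          qed
          finally show ?thesis by (simp add: j)
        qed
      next
        fix y k assume y: "y \<in> S"
        show "X y $ k \<le> B y $ k"
          using W_le_B[OF y, of k] h_bounds[OF y] by (auto simp: X_def)
      qed
      then have XleW: "X y $ i \<le> W y $ i" if "y \<in> S" for y using subs_le_W that by blast
      obtain d6 where d6: "d6 > 0" "\<And>y. dist y z < d6 \<Longrightarrow> \<bar>h y - h z\<bar> < \<mu> / 2"
        using continuous_near[OF hcont, of z "\<mu> / 2"] \<mu>(1) by auto
      \<comment> \<open>By definition of the envelope, \<open>W\<close> comes arbitrarily close to
        \<open>V z\<close> near \<open>z\<close>, whereas \<open>h\<close> is there about
        \<open>V z + \<mu>\<close>. So \<open>X\<close> would exceed \<open>W\<close>, against the
        maximality of \<open>W\<close>.\<close>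
      have "lsc_env S (\<lambda>y. W y $ i) z < V z $ i + \<mu> / 2" using \<mu>(1) by (simp add: V_def)
      then obtain y where y: "y \<in> S" "dist y z < min \<rho> d6" "W y $ i < V z $ i + \<mu> / 2"
        using lsc_env_approx[where S = S and f = "\<lambda>y. W y $ i" and m = m and d = "min \<rho> d6"] W_ge z \<rho>(1) d6(1)
        by (metis min_less_iff_conj)
      have "h y \<le> X y $ i" using y(2) by (simp add: Xi)
      moreover have "h z = V z $ i + \<mu>" by (simp add: h_def)
      moreover have "\<bar>h y - h z\<bar> < \<mu> / 2" using d6(2) y(2) by simp
      ultimately show False using y(3) XleW[OF y(1)] by linarith
    qed
  qed
qed

end

section \<open>The evolution problem\<close>

definition evolution ::
  "('m::finite \<Rightarrow> real^'n \<Rightarrow> real^'m \<Rightarrow> real^'n \<Rightarrow> real) \<Rightarrow>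
     'm \<Rightarrow> (real^'n) \<times> real \<Rightarrow> real^'m \<Rightarrow> (real^'n) \<times> real \<Rightarrow> real" where
  "evolution G i z r q = snd q + G i (fst z) r (fst q)"

lemma viscosity_subsolution_iff:
  "viscosity_subsolution G u0 T u \<longleftrightarrow>
     visc_sub (UNIV \<times> {0..T}) (UNIV \<times> {0<..T}) (evolution G) u \<and> (\<forall>i x. u (x, 0) $ i \<le> u0 x $ i)"
  unfolding viscosity_subsolution_def visc_sub_def evolution_def
  by (fastforce simp: local_max_on_def)

lemma viscosity_supersolution_iff:
  "viscosity_supersolution G u0 T u \<longleftrightarrow>
     visc_super (UNIV \<times> {0..T}) (UNIV \<times> {0<..T}) (evolution G) u \<and> (\<forall>i x. u0 x $ i \<le> u (x, 0) $ i)"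
  unfolding viscosity_supersolution_def visc_super_def evolution_def
  by (fastforce simp: local_min_on_def)

text \<open>The properties that survive homogenization. All are uniform in \<open>x\<close>, and the
  modulus is local in \<open>r\<close> and \<open>p\<close>. \<open>mon\<close> is (Mon) with the
  maximum unfolded: \<open>i\<close> realizes the largest difference, which is nonnegative. The cell
  problem is the case of a one-element index type.\<close>

locale regular_hamiltonian =
  fixes G :: "'m::finite \<Rightarrow> real^'n \<Rightarrow> real^'m \<Rightarrow> real^'n \<Rightarrow> real"
  assumes coercive: "\<exists>P. \<forall>i x r p. P \<le> norm p \<longrightarrow> C \<le> G i x r p"
    and unif_cont: "0 < \<kappa> \<Longrightarrow> \<exists>\<rho>>0. \<forall>i x x' r r' p p'.
        (\<forall>k. \<bar>r $ k\<bar> \<le> R \<and> \<bar>r' $ k\<bar> \<le> R \<and> \<bar>r $ k - r' $ k\<bar> < \<rho>) \<and> norm p \<le> R \<and> norm p' \<le> R \<and>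
        norm (x - x') < \<rho> \<and> norm (p - p') < \<rho> \<longrightarrow> \<bar>G i x r p - G i x' r' p'\<bar> \<le> \<kappa>"
    and bounded: "\<exists>C. \<forall>i x r p. (\<forall>k. \<bar>r $ k\<bar> \<le> R) \<and> norm p \<le> R \<longrightarrow> \<bar>G i x r p\<bar> \<le> C"
    and mon: "(\<And>k. r $ k - s $ k \<le> r $ i - s $ i) \<Longrightarrow> s $ i \<le> r $ i \<Longrightarrow> G i x s p \<le> G i x r p"
begin

text \<open>Doubling of variables. The time penalty \<open>c\<close> is fixed first: it bounds the time derivative of the
  test function, hence by coercivity the spatial gradient, uniformly in the space penalty \<open>a\<close>.
  The quadratic term centred at a near maximum point replaces a penalization at infinity.\<close>

theorem comparison:
  fixes u v :: "(real^'n) \<times> real \<Rightarrow> real^'m" and T K \<kappa> :: real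
  defines "S \<equiv> UNIV \<times> {0..T}" and "P \<equiv> UNIV \<times> {0<..T}"
  assumes T: "0 < T" and K: "0 < K"
    and u: "visc_sub S P (evolution G) u" "\<And>z i. z \<in> S \<Longrightarrow> \<bar>u z $ i\<bar> \<le> K"
    and v: "visc_super S P (evolution G) v" "\<And>z i. z \<in> S \<Longrightarrow> \<bar>v z $ i\<bar> \<le> K"
    and init: "\<And>\<kappa>. 0 < \<kappa> \<Longrightarrow> \<exists>\<rho>>0. \<forall>i. \<forall>z\<in>S. \<forall>z'\<in>S. snd z < \<rho> \<and> snd z' < \<rho> \<and>
       norm (fst z - fst z') < \<rho> \<longrightarrow> u z $ i \<le> v z' $ i + \<kappa>"
    and \<kappa>: "0 < \<kappa>"
  shows "\<exists>\<rho>>0. \<forall>i. \<forall>z\<in>S. \<forall>z'\<in>S. dist z z' < \<rho> \<longrightarrow> u z $ i \<le> v z' $ i + \<kappa>"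
proof -
  \<comment> \<open>One third each goes to the bound on the doubled functional, to the time slope
    \<open>\<eta> * T\<close>, and to the quadratic penalties between close points.\<close>
  define \<kappa>' where "\<kappa>' = \<kappa> / 3"
  define \<eta> where "\<eta> = \<kappa>' / T"
  have \<kappa>': "0 < \<kappa>'" "\<kappa> = \<kappa>' + \<kappa>' + \<kappa>'" and \<eta>: "0 < \<eta>" "\<eta> * T = \<kappa>'"
    using \<kappa> T by (auto simp: \<kappa>'_def \<eta>_def)
  obtain \<rho> where \<rho>: "0 < \<rho>" "\<And>i z z'. z \<in> S \<Longrightarrow> z' \<in> S \<Longrightarrow> snd z < \<rho> \<Longrightarrow> snd z' < \<rho> \<Longrightarrow>
      norm (fst z - fst z') < \<rho> \<Longrightarrow> u z $ i \<le> v z' $ i + \<kappa>'"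
    using init[OF \<kappa>'(1)] by blast
  \<comment> \<open>Where the doubled functional is positive, each quadratic penalty is at most
    \<open>2 * K\<close>. The constant \<open>4 * K\<close> thus forces the times to differ by less
    than \<open>\<rho>\<close>, and the same choice for \<open>a\<close> below forces the space
    points to be closer than \<open>\<sigma>\<close>.\<close>
  define c where "c = 4 * K / \<rho>\<^sup>2"
  have c: "0 < c" "c * \<rho>\<^sup>2 = 4 * K" using K \<rho>(1) by (auto simp: c_def)
  \<comment> \<open>\<open>2 * c * \<rho>\<close> bounds the time derivative of the test function,
    so the subsolution inequality excludes spatial gradients of norm at least \<open>Q\<close>. As
    \<open>Q\<close> is independent of \<open>a\<close>, the modulus \<open>\<rho>'\<close> can be
    fixed before \<open>a\<close>.\<close>
  obtain Q where Q: "\<And>i x r p. Q \<le> norm p \<Longrightarrow> 2 * c * \<rho> + 1 \<le> G i x r p"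
    using coercive by metis
  define R where "R = max K (max Q 0 + 1)"
  have R: "K \<le> R" "Q + 1 \<le> R" by (auto simp: R_def)
  obtain \<rho>' where \<rho>': "0 < \<rho>'" "\<And>i x x' r r' p p'.
        (\<And>k. \<bar>r $ k\<bar> \<le> R \<and> \<bar>r' $ k\<bar> \<le> R \<and> \<bar>r $ k - r' $ k\<bar> < \<rho>') \<Longrightarrow> norm p \<le> R \<Longrightarrow> norm p' \<le> R \<Longrightarrow>
        norm (x - x') < \<rho>' \<Longrightarrow> norm (p - p') < \<rho>' \<Longrightarrow> \<bar>G i x r p - G i x' r' p'\<bar> \<le> \<eta> / 2"
    using unif_cont[of "\<eta> / 2" R] \<eta>(1) by (metis half_gt_zero)
  define \<sigma> where "\<sigma> = min \<rho> \<rho>'"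
  have \<sigma>: "0 < \<sigma>" "\<sigma> \<le> \<rho>" "\<sigma> \<le> \<rho>'" using \<rho> \<rho>' by (auto simp: \<sigma>_def)
  define a where "a = 4 * K / \<sigma>\<^sup>2"
  have a: "0 < a" "a * \<sigma>\<^sup>2 = 4 * K" using K \<sigma>(1) by (auto simp: a_def)
  \<comment> \<open>The localization contributes a gradient of norm at most
    \<open>4 * \<gamma>\<close>, which has to stay below both \<open>\<rho>'\<close> and the margin
    1 built into \<open>R\<close>.\<close>
  define \<gamma> where "\<gamma> = min (\<rho>' / 8) (1 / 8)"
  have \<gamma>: "0 < \<gamma>" "4 * \<gamma> < \<rho>'" "4 * \<gamma> < 1" using \<rho>'(1) by (auto simp: \<gamma>_def)
  define \<Phi> where "\<Phi> i z z' = u z $ i - v z' $ i - a * (norm (fst z - fst z'))\<^sup>2 - c * (snd z - snd z')\<^sup>2 - \<eta> * snd z"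
    for i z z'
  have pen: "0 \<le> a * (norm (fst z - fst z'))\<^sup>2" "0 \<le> c * (snd z - snd z')\<^sup>2" for z z' :: "(real^'n) \<times> real"
    using a c by auto
  have uv: "u z $ i - v z' $ i \<le> 2 * K" if "z \<in> S" "z' \<in> S" for i z z'
    using u(2)[OF that(1), of i] v(2)[OF that(2), of i] by linarith
  have pos: "0 \<le> \<eta> * snd z" if "z \<in> S" for z using that \<eta>(1) by (auto simp: S_def)
  have \<Phi>_le: "\<Phi> i z z' \<le> 2 * K" if "z \<in> S" "z' \<in> S" for i z z'
    using uv[OF that, of i] pen[of z z'] pos[OF that(1)] unfolding \<Phi>_def by linarith
  have close: "norm (fst z - fst z') < \<sigma>" "\<bar>snd z - snd z'\<bar> < \<rho>" if "z \<in> S" "z' \<in> S" "0 < \<Phi> i z z'" for i z z'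
  proof -
    have *: "a * (norm (fst z - fst z'))\<^sup>2 \<le> 2 * K" "c * (snd z - snd z')\<^sup>2 \<le> 2 * K"
      using that(3) uv[OF that(1,2), of i] pen[of z z'] pos[OF that(1)] unfolding \<Phi>_def by linarith+
    have "a * (norm (fst z - fst z'))\<^sup>2 < a * \<sigma>\<^sup>2" using *(1) a(2) K by linarith
    then have "(norm (fst z - fst z'))\<^sup>2 < \<sigma>\<^sup>2" using a(1) by simp
    then show "norm (fst z - fst z') < \<sigma>" using \<sigma>(1) by (simp add: power2_less_imp_less)
    have "c * (snd z - snd z')\<^sup>2 < c * \<rho>\<^sup>2" using *(2) c(2) K by linarith
    then have "\<bar>snd z - snd z'\<bar>\<^sup>2 < \<rho>\<^sup>2" using c(1) by simp
    then show "\<bar>snd z - snd z'\<bar> < \<rho>" using \<rho>(1) by (simp add: power2_less_imp_less)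
  qed
  have key: "\<Phi> i z z' \<le> \<kappa>'" if zS: "z \<in> S" "z' \<in> S" for i z z'
  proof (rule ccontr)
    assume "\<not> ?thesis"
    then have big: "\<kappa>' < \<Phi> i z z'" by simp
    define A where "A = {\<Phi> i z z' | i z z'. z \<in> S \<and> z' \<in> S}"
    have "\<Phi> i z z' \<in> A" using zS unfolding A_def by blast
    have bdd: "bdd_above A" using \<Phi>_le by (auto simp: A_def intro!: bdd_aboveI[of _ "2 * K"])
    have A_le: "\<Phi> j w w' \<le> Sup A" if "w \<in> S" "w' \<in> S" for j w w'
      using that by (intro cSup_upper bdd) (unfold A_def, blast)
    have "max \<kappa>' (Sup A - \<gamma>) < Sup A"
      using \<gamma>(1) big A_le[OF zS, of i] by simp
    then obtain l where "l \<in> A" "max \<kappa>' (Sup A - \<gamma>) < l"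
      using less_cSup_iff[OF _ bdd] \<open>\<Phi> i z z' \<in> A\<close> by blast
    then obtain i1 z1 z1' where z1: "z1 \<in> S" "z1' \<in> S" "\<kappa>' < \<Phi> i1 z1 z1'" "Sup A - \<gamma> < \<Phi> i1 z1 z1'"
      unfolding A_def by fastforce
    define x0 where "x0 = fst z1"
    \<comment> \<open>The point \<open>z1\<close> is within \<open>\<gamma>\<close> of the supremum,
      while the added term costs \<open>2 * \<gamma>\<close> at unit distance from
      \<open>x0\<close>. Hence every pair at least as good as the starting one lies in a compact
      set.\<close>
    define \<Psi> where "\<Psi> i z z' = \<Phi> i z z' - 2 * \<gamma> * (norm (fst z - x0))\<^sup>2" for i z z'
    define C1 where "C1 = cball x0 1 \<times> {0..T}"
    define C2 where "C2 = cball x0 (1 + \<sigma>) \<times> {0..T}"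
    have CS: "C1 \<subseteq> S" "C2 \<subseteq> S" by (auto simp: C1_def C2_def S_def)
    have \<Psi>1: "\<Psi> i1 z1 z1' = \<Phi> i1 z1 z1'" by (simp add: \<Psi>_def x0_def)
    have inC: "w \<in> C1 \<and> w' \<in> C2" if w: "w \<in> S" "w' \<in> S" "\<Psi> i1 z1 z1' \<le> \<Psi> j w w'" for j w w'
    proof -
      have sq: "0 \<le> 2 * \<gamma> * (norm (fst w - x0))\<^sup>2" using \<gamma>(1) by simp
      have "2 * \<gamma> * (norm (fst w - x0))\<^sup>2 < 2 * \<gamma> * 1"
        using w(3) z1(4) A_le[OF w(1,2), of j] \<gamma>(1) unfolding \<Psi>1 unfolding \<Psi>_def by linarith
      then have "(norm (fst w - x0))\<^sup>2 < 1\<^sup>2" using \<gamma>(1) by simp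
      then have 1: "norm (fst w - x0) < 1" by (rule power2_less_imp_less) simp
      have "0 < \<Phi> j w w'" using w(3) z1(3) \<kappa>'(1) sq unfolding \<Psi>1 unfolding \<Psi>_def by linarith
      from close(1)[OF w(1,2) this] have "dist (fst w) (fst w') < \<sigma>" by (simp add: dist_norm)
      with 1 have "dist x0 (fst w') \<le> 1 + \<sigma>"
        using dist_triangle[of x0 "fst w'" "fst w"] by (simp add: dist_norm norm_minus_commute)
      with 1 w show ?thesis
        by (auto simp: C1_def C2_def S_def mem_Times_iff dist_norm norm_minus_commute)
    qed
    have comp: "compact (C1 \<times> C2)" unfolding C1_def C2_def by (intro compact_Times compact_cball compact_Icc)
    have z1C: "(z1, z1') \<in> C1 \<times> C2" using inC[OF z1(1,2), of i1] by simp
    have "\<exists>w\<in>C1 \<times> C2. \<forall>w'\<in>C1 \<times> C2. \<Psi> j (fst w') (snd w') \<le> \<Psi> j (fst w) (snd w)" for j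
    proof (rule usc_attains_max[OF comp])
      show "C1 \<times> C2 \<noteq> {}" using z1C by blast
      have 1: "usc_on (C1 \<times> C2) (\<lambda>w. u (fst w) $ j)"
        by (rule usc_on_compose[where f = "\<lambda>z. u z $ j" and S = S])
          (use u(1) CS in \<open>auto simp: visc_sub_def intro: continuous_on_fst continuous_on_id\<close>)
      have 2: "usc_on (C1 \<times> C2) (\<lambda>w. - v (snd w) $ j)"
        by (rule usc_on_compose[where f = "\<lambda>z. - v z $ j" and S = S])
          (use v(1) CS in \<open>auto simp: visc_super_def lsc_on_iff_usc_on intro: continuous_on_snd continuous_on_id\<close>)
      have 3: "usc_on (C1 \<times> C2) (\<lambda>w. - (a * (norm (fst (fst w) - fst (snd w)))\<^sup>2)
          - c * (snd (fst w) - snd (snd w))\<^sup>2 - \<eta> * snd (fst w) - 2 * \<gamma> * (norm (fst (fst w) - x0))\<^sup>2)"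
        by (intro continuous_on_imp_usc_on continuous_intros)
      show "usc_on (C1 \<times> C2) (\<lambda>w. \<Psi> j (fst w) (snd w))"
        using usc_on_add[OF usc_on_add[OF 1 2] 3] unfolding \<Psi>_def \<Phi>_def by (simp add: algebra_simps)
    qed
    then obtain W where W: "\<And>j. W j \<in> C1 \<times> C2"
      "\<And>j w w'. w \<in> C1 \<Longrightarrow> w' \<in> C2 \<Longrightarrow> \<Psi> j w w' \<le> \<Psi> j (fst (W j)) (snd (W j))"
      by (metis fst_conv snd_conv mem_Sigma_iff)
    \<comment> \<open>The maximum is taken over the components too. At the maximizing
      \<open>j\<close> the difference of \<open>u\<close> and \<open>v\<close> is then the largest
      among all components, as \<open>mon\<close> demands.\<close>
    define L where "L j = \<Psi> j (fst (W j)) (snd (W j))" for j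
    have "Max (range L) \<in> range L" by (intro Max_in) auto
    then obtain j where j: "L j = Max (range L)" by (metis imageE)
    have L_le: "L k \<le> L j" for k unfolding j by (intro Max_ge) auto
    obtain x t where xt: "fst (W j) = (x, t)" by fastforce
    obtain y s where ys: "snd (W j) = (y, s)" by fastforce
    have xC: "(x, t) \<in> C1" and "(y, s) \<in> C2" using W(1)[of j] xt ys by (auto simp: mem_Times_iff)
    then have xS: "(x, t) \<in> S" and yS: "(y, s) \<in> S" using CS by auto
    have L1: "\<Psi> i1 z1 z1' \<le> L j"
      using W(2)[of z1 z1' i1] z1C L_le[of i1] unfolding L_def by fastforce
    have max: "\<Psi> k w w' \<le> \<Psi> j (x, t) (y, s)" if "w \<in> S" "w' \<in> S" for k w w'
    proof (cases "\<Psi> i1 z1 z1' \<le> \<Psi> k w w'")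
      case True
      from inC[OF that True] have "\<Psi> k w w' \<le> L k" using W(2) by (auto simp: L_def)
      with L_le[of k] show ?thesis by (simp add: L_def xt ys)
    next
      case False
      with L1 show ?thesis by (simp add: L_def xt ys)
    qed
    have sq: "0 \<le> 2 * \<gamma> * (norm (x - x0))\<^sup>2" using \<gamma>(1) by simp
    have \<Phi>big: "\<kappa>' < \<Phi> j (x, t) (y, s)"
      using L1 z1(3) sq unfolding \<Psi>1 L_def xt ys unfolding \<Psi>_def fst_conv snd_conv by linarith
    then have \<Phi>pos: "0 < \<Phi> j (x, t) (y, s)" using \<kappa>'(1) by linarith
    have xy: "norm (x - y) < \<sigma>" and ts: "\<bar>t - s\<bar> < \<rho>"
      using close[OF xS yS \<Phi>pos] by auto
    have gap: "\<kappa>' < u (x, t) $ j - v (y, s) $ j"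
      using \<Phi>big pen[of "(x, t)" "(y, s)"] pos[OF xS] unfolding \<Phi>_def by linarith
    have t0: "0 \<le> t" "t \<le> T" "0 \<le> s" "s \<le> T" using xS yS by (auto simp: S_def)
    \<comment> \<open>If one of the times vanished, the other would be below \<open>\<rho>\<close>,
      and the ordering near the initial time would contradict \<open>gap\<close>.\<close>
    have tpos: "0 < t \<and> 0 < s"
    proof (rule ccontr)
      assume "\<not> ?thesis"
      then have "t < \<rho>" "s < \<rho>" using t0 ts \<rho>(1) by auto
      then have "u (x, t) $ j \<le> v (y, s) $ j + \<kappa>'"
        using \<rho>(2)[OF xS yS] xy \<sigma> by auto
      then show False using gap by linarith
    qed
    define p where "p = (2 * a) *\<^sub>R (x - y)"
    define q where "q = (2 * (2 * \<gamma>)) *\<^sub>R (x - x0)"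
    define \<theta> where "\<theta> = 2 * c * (t - s)"
    have sub: "\<theta> + \<eta> + G j x (u (x, t)) (p + q) \<le> 0"
    proof -
      let ?\<phi> = "\<lambda>z. a * (norm (fst z - y))\<^sup>2 + (2 * \<gamma>) * (norm (fst z - x0))\<^sup>2 + c * (snd z - s)\<^sup>2 + \<eta> * snd z"
      have "local_max_on S (\<lambda>z. u z $ j - ?\<phi> z) (x, t)"
        unfolding local_max_on_iff
      proof (intro conjI exI[of _ 1] ballI impI xS)
        fix w assume "w \<in> S"
        from max[OF this yS, of j] show "u w $ j - ?\<phi> w \<le> u (x, t) $ j - ?\<phi> (x, t)"
          unfolding \<Psi>_def \<Phi>_def fst_conv snd_conv by linarith
      qed simp
      from visc_subD[OF u(1) C1_space_time _ this] show ?thesis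
        using tpos t0 by (simp add: P_def evolution_def p_def q_def \<theta>_def)
    qed
    have super: "0 \<le> \<theta> + G j y (v (y, s)) p"
    proof -
      let ?\<phi> = "\<lambda>z. (- a) * (norm (fst z - x))\<^sup>2 + 0 * (norm (fst z - x))\<^sup>2 + (- c) * (snd z - t)\<^sup>2 + 0 * snd z"
      have "local_min_on S (\<lambda>z. v z $ j - ?\<phi> z) (y, s)"
        unfolding local_min_on_iff
      proof (intro conjI exI[of _ 1] ballI impI yS)
        fix w assume "w \<in> S"
        from max[OF xS this, of j] show "v (y, s) $ j - ?\<phi> (y, s) \<le> v w $ j - ?\<phi> w"
          unfolding \<Psi>_def \<Phi>_def fst_conv snd_conv
          by (simp add: norm_minus_commute power2_commute)
      qed simp
      from visc_superD[OF v(1) C1_space_time _ this] show ?thesis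
        using tpos t0 by (simp add: P_def evolution_def p_def \<theta>_def algebra_simps)
    qed
    have "\<bar>\<theta>\<bar> = 2 * c * \<bar>t - s\<bar>" using c(1) by (simp add: \<theta>_def abs_mult)
    also have "\<dots> \<le> 2 * c * \<rho>" using ts c(1) by (intro mult_left_mono) auto
    finally have \<theta>: "\<bar>\<theta>\<bar> \<le> 2 * c * \<rho>" .
    have "norm (p + q) < Q"
      using Q[of "p + q" j x "u (x, t)"] sub \<theta> \<eta>(1) by (cases "Q \<le> norm (p + q)") auto
    have "norm (x - x0) \<le> 1" using xC by (auto simp: C1_def dist_norm norm_minus_commute)
    then have "norm q \<le> 4 * \<gamma> * 1" using \<gamma>(1) by (simp add: q_def)
    then have q: "norm q < \<rho>'" "norm q < 1" using \<gamma> by auto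
    have "norm p \<le> norm (p + q) + norm q" by (metis add_diff_cancel_right' norm_triangle_ineq4)
    then have pR: "norm p \<le> R" "norm (p + q) \<le> R" using q \<open>norm (p + q) < Q\<close> R by linarith+
    have "G j x (v (y, s)) (p + q) \<le> G j x (u (x, t)) (p + q)"
    proof (rule mon)
      show "u (x, t) $ k - v (y, s) $ k \<le> u (x, t) $ j - v (y, s) $ j" for k
        using max[OF xS yS, of k] unfolding \<Psi>_def \<Phi>_def by linarith
    qed (use gap \<kappa>'(1) in linarith)
    moreover have "\<bar>G j y (v (y, s)) p - G j x (v (y, s)) (p + q)\<bar> \<le> \<eta> / 2"
    proof (rule \<rho>'(2))
      show "\<bar>v (y, s) $ k\<bar> \<le> R \<and> \<bar>v (y, s) $ k\<bar> \<le> R \<and> \<bar>v (y, s) $ k - v (y, s) $ k\<bar> < \<rho>'" for k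
        using v(2)[OF yS, of k] R \<rho>'(1) by auto
      show "norm (y - x) < \<rho>'" using xy \<sigma> by (simp add: norm_minus_commute)
      show "norm (p - (p + q)) < \<rho>'" using q by simp
    qed (use pR in auto)
    ultimately show False using sub super \<eta>(1) by linarith
  qed
  define \<delta> where "\<delta> = sqrt (\<kappa>' / (a + c))"
  have \<delta>: "0 < \<delta>" "(a + c) * \<delta>\<^sup>2 = \<kappa>'" using \<kappa>'(1) a(1) c(1) by (auto simp: \<delta>_def)
  show ?thesis
  proof (intro exI[of _ \<delta>] conjI allI ballI impI \<delta>(1))
    fix i z z' assume z: "z \<in> S" "z' \<in> S" "dist z z' < \<delta>"
    have "norm (fst z - fst z') \<le> \<delta>" "\<bar>snd z - snd z'\<bar> \<le> \<delta>"
      using z(3) dist_fst_le[of z z'] dist_snd_le[of z z'] by (auto simp: dist_norm dist_real_def)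
    then have "(norm (fst z - fst z'))\<^sup>2 \<le> \<delta>\<^sup>2" "(snd z - snd z')\<^sup>2 \<le> \<delta>\<^sup>2"
      using power_mono[of "\<bar>snd z - snd z'\<bar>" \<delta> 2] by (auto intro: power_mono)
    then have "a * (norm (fst z - fst z'))\<^sup>2 \<le> a * \<delta>\<^sup>2" "c * (snd z - snd z')\<^sup>2 \<le> c * \<delta>\<^sup>2"
      using a(1) c(1) by auto
    moreover have "a * \<delta>\<^sup>2 + c * \<delta>\<^sup>2 = \<kappa>'" using \<delta>(2) by (simp add: distrib_right)
    moreover have "\<eta> * snd z \<le> \<eta> * T" using z(1) \<eta>(1) by (auto simp: S_def)
    ultimately show "u z $ i \<le> v z' $ i + \<kappa>"
      using key[OF z(1,2), of i] \<eta>(2) \<kappa>'(2) unfolding \<Phi>_def by linarith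
  qed
qed

end

section \<open>One-sided gradient inequalities and approximation of the data\<close>

lemma local_max_gradient:
  assumes "C1_with_gradient \<phi> D" "C1_with_gradient \<psi> E" "local_max_on S (\<lambda>w. \<phi> w - \<psi> w) z"
    and ev: "\<forall>\<^sub>F s in at_right 0. z + s *\<^sub>R h \<in> S"
  shows "h \<bullet> D z \<le> h \<bullet> E z"
proof (rule dense_le)
  fix a assume a: "a < h \<bullet> D z"
  have "((\<lambda>s. (\<phi> (z + s *\<^sub>R h) - \<phi> (z + 0 *\<^sub>R h)) / (s - 0)) \<longlongrightarrow> h \<bullet> D z) (at_right 0)"
    using C1_directional[OF assms(1), of z h "{0<..}"] unfolding has_field_derivative_iff .
  from order_tendstoD(1)[OF this a] ev eventually_at_right_less
  have "\<forall>\<^sub>F s in at_right 0. z + s *\<^sub>R h \<in> S \<and> \<phi> z + a * s \<le> \<phi> (z + s *\<^sub>R h)"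
  proof eventually_elim
    case (elim s)
    then have "a * s < \<phi> (z + s *\<^sub>R h) - \<phi> z" by (simp add: pos_less_divide_eq)
    with elim show ?case by simp
  qed
  then show "a \<le> h \<bullet> E z" by (rule local_max_directional[OF assms(2,3)])
qed

text \<open>Backward is the only time direction that stays in the slab from every point with
  positive time, the terminal time included.\<close>

lemma eventually_past:
  fixes x :: "'a::real_vector" and t T :: real
  assumes "0 < t" "t \<le> T"
  shows "\<forall>\<^sub>F s in at_right 0. (x, t) + s *\<^sub>R (0, - 1) \<in> UNIV \<times> {0..T}"
proof -
  have "\<forall>\<^sub>F s in at_right 0. s < t" by (rule eventually_at_rightI[of 0 t]) (use assms in auto)
  then show ?thesis
    using eventually_at_right_less by eventually_elim (use assms in auto)
qed

lemma BUC_vec_bounded: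
  fixes u :: "'a::metric_space \<Rightarrow> real^'m"
  assumes "\<And>i. BUC S (\<lambda>z. u z $ i)"
  obtains K where "0 < K" "\<And>z i. z \<in> S \<Longrightarrow> \<bar>u z $ i\<bar> \<le> K"
proof -
  have "\<forall>i. \<exists>K. \<forall>z\<in>S. \<bar>u z $ i\<bar> \<le> K"
    using assms unfolding BUC_def bounded_iff by simp
  then obtain k where k: "\<And>i z. z \<in> S \<Longrightarrow> \<bar>u z $ i\<bar> \<le> k i" by metis
  show thesis
  proof (rule that[of "max 1 (Max (range k))"])
    fix z i assume "z \<in> S"
    have "k i \<le> Max (range k)" by (intro Max_ge) auto
    with k[OF \<open>z \<in> S\<close>, of i] show "\<bar>u z $ i\<bar> \<le> max 1 (Max (range k))" by linarith
  qed simp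
qed

lemma BUC_vec_uniform:
  fixes u :: "'a::metric_space \<Rightarrow> real^'m"
  assumes "\<And>i. BUC S (\<lambda>z. u z $ i)" "0 < e"
  obtains d where "0 < d" "\<And>z z' i. z \<in> S \<Longrightarrow> z' \<in> S \<Longrightarrow> dist z z' < d \<Longrightarrow> \<bar>u z $ i - u z' $ i\<bar> < e"
proof -
  have "\<forall>i. \<exists>d>0. \<forall>z\<in>S. \<forall>z'\<in>S. dist z z' < d \<longrightarrow> \<bar>u z $ i - u z' $ i\<bar> < e"
    using assms unfolding BUC_def uniformly_continuous_on_def dist_real_def by metis
  then obtain d where d: "\<And>i. 0 < d i"
      "\<And>i z z'. z \<in> S \<Longrightarrow> z' \<in> S \<Longrightarrow> dist z z' < d i \<Longrightarrow> \<bar>u z $ i - u z' $ i\<bar> < e" by metis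
  show thesis
    by (rule that[of "Min (range d)"]) (use d in auto)
qed

text \<open>Inf-convolution with a cone of slope \<open>L\<close>. Explicit lower barriers need a
  bound on the spatial gradient, which data that are merely uniformly continuous do not
  provide.\<close>

lemma lipschitz_approximation:
  fixes f :: "'a::metric_space \<Rightarrow> real"
  assumes uc: "uniformly_continuous_on UNIV f" and K: "\<And>x. \<bar>f x\<bar> \<le> K" and "0 < \<kappa>"
  obtains g L where "0 < L" "\<And>x y. \<bar>g x - g y\<bar> \<le> L * dist x y"
    "\<And>x. f x - \<kappa> \<le> g x" "\<And>x. g x \<le> f x" "\<And>x. - K \<le> g x"
proof -
  have "0 \<le> K" using K[of undefined] by simp
  obtain d where d: "d > 0" "\<And>x y. dist x y < d \<Longrightarrow> \<bar>f x - f y\<bar> < \<kappa>"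
    using uc \<open>0 < \<kappa>\<close> unfolding uniformly_continuous_on_def dist_real_def by (metis UNIV_I)
  \<comment> \<open>From distance \<open>d\<close> on, the cone is at least \<open>2 * K + 1\<close>
    high, more than the possible drop of \<open>f\<close>. Closer points cost less than
    \<open>\<kappa>\<close> by uniform continuity.\<close>
  define L where "L = (2 * K + 1) / d"
  have L: "0 < L" "L * d = 2 * K + 1" using \<open>0 \<le> K\<close> d(1) by (auto simp: L_def)
  define g where "g x = (INF y. f y + L * dist x y)" for x
  have lower: "- K \<le> f y + L * dist x y" for x y
  proof -
    have "0 \<le> L * dist x y" using L(1) by simp
    with K[of y] show ?thesis by linarith
  qed
  have bdd: "bdd_below (range (\<lambda>y. f y + L * dist x y))" for x
    by (intro bdd_belowI[of _ "- K"]) (auto intro: lower)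
  have g_le: "g x \<le> f y + L * dist x y" for x y
    unfolding g_def by (intro cINF_lower bdd) auto
  have g_diff: "g x - L * dist x y \<le> g y" for x y
  proof -
    have "g x - L * dist x y \<le> f w + L * dist y w" for w
    proof -
      have "L * dist x w \<le> L * (dist x y + dist y w)"
        using L(1) by (intro mult_left_mono dist_triangle) auto
      with g_le[of x w] show ?thesis by (simp add: distrib_left)
    qed
    then show ?thesis unfolding g_def[of y] by (intro cINF_greatest) auto
  qed
  show thesis
  proof (rule that[OF L(1)])
    show "\<bar>g x - g y\<bar> \<le> L * dist x y" for x y
      using g_diff[of x y] g_diff[of y x] by (simp add: dist_commute abs_le_iff)
    show "- K \<le> g x" for x unfolding g_def by (intro cINF_greatest lower) auto
    show "g x \<le> f x" for x using g_le[of x x] by simp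
    show "f x - \<kappa> \<le> g x" for x
      unfolding g_def
    proof (intro cINF_greatest)
      fix y
      show "f x - \<kappa> \<le> f y + L * dist x y"
      proof (cases "dist x y < d")
        case True
        have "0 \<le> L * dist x y" using L(1) by simp
        with d(2)[OF True] show ?thesis by linarith
      next
        case False
        then have "L * d \<le> L * dist x y" using L(1) by (intro mult_left_mono) auto
        with L(2) K[of x] K[of y] \<open>0 < \<kappa>\<close> show ?thesis by linarith
      qed
    qed simp
  qed
qed

lemma lipschitz_approximation_vec:
  fixes f :: "'a::metric_space \<Rightarrow> real^'m"
  assumes f: "\<And>i. BUC UNIV (\<lambda>x. f x $ i)" and K: "\<And>x i. \<bar>f x $ i\<bar> \<le> K" and "0 < \<kappa>"
  obtains g L where "0 < L" "\<And>x y i. \<bar>g x $ i - g y $ i\<bar> \<le> L * dist x y"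
    "\<And>x i. f x $ i - \<kappa> \<le> g x $ i" "\<And>x i. g x $ i \<le> f x $ i" "\<And>x i. - K \<le> (g x :: real^'m) $ i"
proof -
  have "\<forall>i. \<exists>g L. 0 < L \<and> (\<forall>x y. \<bar>g x - g y\<bar> \<le> L * dist x y) \<and>
      (\<forall>x. f x $ i - \<kappa> \<le> g x \<and> g x \<le> f x $ i \<and> - K \<le> g x)"
  proof
    fix i
    from f have "uniformly_continuous_on UNIV (\<lambda>x. f x $ i)" by (simp add: BUC_def)
    from lipschitz_approximation[OF this K \<open>0 < \<kappa>\<close>] show "\<exists>g L. 0 < L \<and> (\<forall>x y. \<bar>g x - g y\<bar> \<le> L * dist x y) \<and>
      (\<forall>x. f x $ i - \<kappa> \<le> g x \<and> g x \<le> f x $ i \<and> - K \<le> g x)" by metis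
  qed
  then obtain g l where g: "\<And>i. 0 < l i" "\<And>i x y. \<bar>g i x - g i y\<bar> \<le> l i * dist x y"
    "\<And>i x. f x $ i - \<kappa> \<le> g i x \<and> g i x \<le> f x $ i \<and> - K \<le> g i x" by metis
  show thesis
  proof (rule that[of "Max (range l)" "\<lambda>x. \<chi> i. g i x"])
    show "0 < Max (range l)" using g(1) by (subst Max_gr_iff) auto
    fix x y :: 'a and i
    have "l i * dist x y \<le> Max (range l) * dist x y"
      by (intro mult_right_mono Max_ge) auto
    then show "\<bar>(\<chi> i. g i x) $ i - (\<chi> i. g i y) $ i\<bar> \<le> Max (range l) * dist x y"
      using g(2)[of i x y] by simp
  qed (use g(3) in auto)
qed

context regular_hamiltonian
begin

lemma quasimonotone: "r $ i = s $ i \<Longrightarrow> (\<And>k. r $ k \<le> s $ k) \<Longrightarrow> G i x s p \<le> G i x r p"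
  by (rule mon) auto

lemma continuous: "continuous_on UNIV (\<lambda>(x, r, p). G i x r p)"
  unfolding continuous_on_iff
proof (intro ballI allI impI)
  fix z :: "(real^'n) \<times> (real^'m) \<times> (real^'n)" and e :: real assume "0 < e"
  obtain x r p where z: "z = (x, r, p)" by (cases z)
  define R where "R = norm r + norm p + 1"
  obtain \<rho> where \<rho>: "0 < \<rho>" "\<And>i x x' r r' p p'.
        (\<And>k. \<bar>r $ k\<bar> \<le> R \<and> \<bar>r' $ k\<bar> \<le> R \<and> \<bar>r $ k - r' $ k\<bar> < \<rho>) \<Longrightarrow> norm p \<le> R \<Longrightarrow> norm p' \<le> R \<Longrightarrow>
        norm (x - x') < \<rho> \<Longrightarrow> norm (p - p') < \<rho> \<Longrightarrow> \<bar>G i x r p - G i x' r' p'\<bar> \<le> e / 2"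
    using unif_cont[of "e / 2" R] \<open>0 < e\<close> by (metis half_gt_zero)
  show "\<exists>d>0. \<forall>z'\<in>UNIV. dist z' z < d \<longrightarrow>
      dist (case z' of (x, r, p) \<Rightarrow> G i x r p) (case z of (x, r, p) \<Rightarrow> G i x r p) < e"
  proof (intro exI[of _ "min \<rho> 1"] conjI ballI impI)
    fix z' assume d: "dist z' z < min \<rho> 1"
    obtain x' r' p' where z': "z' = (x', r', p')" by (cases z')
    have "dist x' x \<le> dist z' z" "dist (r', p') (r, p) \<le> dist z' z"
      using dist_fst_le[of z' z] dist_snd_le[of z' z] by (auto simp: z z')
    moreover have "dist r' r \<le> dist (r', p') (r, p)" "dist p' p \<le> dist (r', p') (r, p)"
      using dist_fst_le[of "(r', p')" "(r, p)"] dist_snd_le[of "(r', p')" "(r, p)"] by auto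
    ultimately have n: "norm (x' - x) < \<rho>" "norm (r' - r) < \<rho>" "norm (p' - p) < \<rho>"
        "norm (r' - r) < 1" "norm (p' - p) < 1"
      using d by (simp_all add: dist_norm)
    have comp: "\<bar>r' $ k - r $ k\<bar> \<le> norm (r' - r)" "\<bar>r $ k\<bar> \<le> norm r" "\<bar>r' $ k\<bar> \<le> norm r'" for k
      using component_le_norm_cart[of "r' - r" k] component_le_norm_cart by auto
    have nn: "norm r' \<le> norm r + norm (r' - r)" "norm p' \<le> norm p + norm (p' - p)"
      using norm_triangle_sub[of r' r] norm_triangle_sub[of p' p] by auto
    have "\<bar>G i x' r' p' - G i x r p\<bar> \<le> e / 2"
    proof (rule \<rho>(2))
      show "\<bar>r' $ k\<bar> \<le> R \<and> \<bar>r $ k\<bar> \<le> R \<and> \<bar>r' $ k - r $ k\<bar> < \<rho>" for k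
        using comp[of k] n nn norm_ge_zero[of p] unfolding R_def by (intro conjI) linarith+
    qed (use n nn norm_ge_zero[of r] norm_ge_zero[of p] in \<open>unfold R_def, linarith+\<close>)
    then show "dist (case z' of (x, r, p) \<Rightarrow> G i x r p) (case z of (x, r, p) \<Rightarrow> G i x r p) < e"
      using \<open>0 < e\<close> by (simp add: z z' dist_real_def)
  qed (use \<rho> in auto)
qed

lemma continuous_evolution: "continuous_on UNIV (\<lambda>(z, r, p). evolution G i z r p)"
proof -
  have "continuous_on UNIV (\<lambda>w. (\<lambda>(x, r, p). G i x r p) (fst (fst w), fst (snd w), fst (snd (snd w))))"
    by (rule continuous_on_compose2[OF continuous]) (intro continuous_intros subset_UNIV)+
  then have "continuous_on UNIV (\<lambda>w. snd (snd (snd w)) +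
      (\<lambda>(x, r, p). G i x r p) (fst (fst w), fst (snd w), fst (snd (snd w))))"
    by (intro continuous_intros)
  then show ?thesis by (simp add: evolution_def case_prod_unfold)
qed

text \<open>All spatial directions are admissible, so the spatial gradients agree. In time only the
  past is available, which orders the time derivatives; this is the right order because
  \<open>evolution\<close> is increasing in the time derivative.\<close>

lemma evolution_gradient_mono:
  assumes "C1_with_gradient \<phi> D" "C1_with_gradient \<psi> E" "z \<in> UNIV \<times> {0<..T}"
    "local_max_on (UNIV \<times> {0..T}) (\<lambda>x. \<phi> x - \<psi> x) z"
  shows "evolution G i z r (E z) \<le> evolution G i z r (D z)"
proof -
  obtain x t where z: "z = (x, t)" "0 < t" "t \<le> T" using assms(3) by auto
  have hor: "q \<bullet> fst (D z) \<le> q \<bullet> fst (E z)" for q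
    using local_max_gradient[OF assms(1,2,4), of "(q, 0)"] z
    by (simp add: inner_prod_def)
  have "(fst (D z) - fst (E z)) \<bullet> (fst (D z) - fst (E z)) \<le> 0"
    using hor[of "fst (D z) - fst (E z)"] by (simp add: inner_diff_right)
  then have eq: "fst (D z) = fst (E z)"
    by (metis antisym eq_iff_diff_eq_0 inner_eq_zero_iff inner_ge_zero)
  have "\<forall>\<^sub>F s in at_right 0. z + s *\<^sub>R (0, - 1) \<in> UNIV \<times> {0..T}"
    unfolding z(1) by (rule eventually_past[OF z(2,3)])
  from local_max_gradient[OF assms(1,2,4) this] have "snd (E z) \<le> snd (D z)"
    by (simp add: inner_prod_def)
  then show ?thesis by (simp add: evolution_def eq)
qed

text \<open>A test function touching from above has spatial gradient at most \<open>L\<close> in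
  norm and time derivative at most \<open>- C\<close>, so any \<open>C\<close> above the values of
  \<open>G\<close> on a fixed bounded set works.\<close>

lemma lower_barrier:
  fixes g :: "real^'n \<Rightarrow> real^'m"
  assumes g: "\<And>x y i. \<bar>g x $ i - g y $ i\<bar> \<le> L * dist x y" "\<And>x i. \<bar>g x $ i\<bar> \<le> K" and "0 < L" "0 < K"
  shows "\<exists>C\<ge>0. visc_sub (UNIV \<times> {0..T}) (UNIV \<times> {0<..T}) (evolution G) (\<lambda>z. \<chi> i. g (fst z) $ i - C * snd z) \<and>
    (\<forall>i. continuous_on UNIV (\<lambda>z :: (real^'n) \<times> real. g (fst z) $ i - C * snd z))"
proof -
  obtain C0 where C0: "\<And>i x r p. (\<forall>k. \<bar>r $ k\<bar> \<le> max K L) \<Longrightarrow> norm p \<le> max K L \<Longrightarrow> \<bar>G i x r p\<bar> \<le> C0"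
    using bounded by metis
  define C where "C = max C0 0"
  have C: "0 \<le> C" "C0 \<le> C" by (auto simp: C_def)
  define b where "b z = (\<chi> i. g (fst z) $ i - C * snd z)" for z
  have "continuous_on UNIV (\<lambda>x. g x $ i)" for i
    by (rule lipschitz_on_continuous_on[of L])
      (use g(1) \<open>0 < L\<close> in \<open>auto intro!: lipschitz_onI simp: dist_real_def\<close>)
  then have cg: "continuous_on UNIV (\<lambda>z :: (real^'n) \<times> real. g (fst z) $ i)" for i
    by (rule continuous_on_compose2) (intro continuous_intros subset_UNIV)+
  have cont: "continuous_on UNIV (\<lambda>z. b z $ i)" for i
    unfolding b_def vec_lambda_beta by (intro continuous_on_diff cg) (intro continuous_intros)
  have "visc_sub (UNIV \<times> {0..T}) (UNIV \<times> {0<..T}) (evolution G) b"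
    unfolding visc_sub_def
  proof (intro conjI allI impI)
    fix i show "usc_on (UNIV \<times> {0..T}) (\<lambda>z. b z $ i)"
      by (intro continuous_on_imp_usc_on continuous_on_subset[OF cont]) auto
  next
    fix \<phi> D i z
    assume *: "C1_with_gradient \<phi> D \<and> z \<in> UNIV \<times> {0<..T} \<and>
      local_max_on (UNIV \<times> {0..T}) (\<lambda>z. b z $ i - \<phi> z) z"
    then have C1: "C1_with_gradient \<phi> D" and max: "local_max_on (UNIV \<times> {0..T}) (\<lambda>z. b z $ i - \<phi> z) z"
      by blast+
    obtain x t where z: "z = (x, t)" "0 < t" "t \<le> T" using * by auto
    let ?p = "fst (D z)"
    \<comment> \<open>Along minus its own spatial gradient the test function falls at rate
      \<open>norm ?p * norm ?p\<close>, whereas the barrier falls at most at rate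
      \<open>L * norm ?p\<close>.\<close>
    have "- (L * norm ?p) \<le> (- ?p, 0) \<bullet> D z"
    proof (rule local_max_directional[OF C1 max])
      have le: "b z $ i + - (L * norm ?p) * s \<le> b (z + s *\<^sub>R (- ?p, 0)) $ i" if "0 < s" for s
      proof -
        have "g x $ i - g (x - s *\<^sub>R ?p) $ i \<le> L * (norm ?p * s)"
          using g(1)[of x i "x - s *\<^sub>R ?p"] that by (simp add: dist_norm mult.commute)
        then show ?thesis by (simp add: b_def z)
      qed
      show "\<forall>\<^sub>F s in at_right 0. z + s *\<^sub>R (- ?p, 0) \<in> UNIV \<times> {0..T} \<and>
          b z $ i + - (L * norm ?p) * s \<le> b (z + s *\<^sub>R (- ?p, 0)) $ i"
        by (rule eventually_mono[OF eventually_at_right_less[of 0]]) (use le z in auto)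
    qed
    then have "norm ?p * norm ?p \<le> L * norm ?p"
      by (simp add: inner_prod_def norm_eq_sqrt_inner)
    then have p: "norm ?p \<le> L" using \<open>0 < L\<close> by (cases "norm ?p = 0") auto
    have "C \<le> (0, - 1) \<bullet> D z"
    proof (rule local_max_directional[OF C1 max])
      show "\<forall>\<^sub>F s in at_right 0. z + s *\<^sub>R (0, - 1) \<in> UNIV \<times> {0..T} \<and>
          b z $ i + C * s \<le> b (z + s *\<^sub>R (0, - 1)) $ i"
        using eventually_past[OF z(2,3), of x]
        by (rule eventually_mono) (simp add: z b_def algebra_simps)
    qed
    then have Dt: "snd (D z) \<le> - C" by (simp add: inner_prod_def)
    \<comment> \<open>The range of the barrier itself depends on \<open>C\<close>, so bounding
      \<open>G\<close> there would be circular. The vector \<open>s\<close> avoids this: its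
      components are bounded by \<open>K\<close>, and \<open>s - b z\<close> is largest at
      \<open>i\<close>, so \<open>mon\<close> bounds \<open>G\<close> at the barrier by
      \<open>G\<close> at \<open>s\<close>.\<close>
    define s where "s = (\<chi> k. if k = i then K else - K)"
    have Ct: "0 \<le> C * t" using C(1) z(2) by simp
    have "G i x (b z) ?p \<le> G i x s ?p"
    proof (rule mon)
      fix k
      show "s $ k - b z $ k \<le> s $ i - b z $ i"
        using g(2)[of x k] g(2)[of x i] Ct by (auto simp: s_def b_def z)
      show "b z $ i \<le> s $ i" using g(2)[of x i] Ct by (auto simp: s_def b_def z)
    qed
    also have "\<dots> \<le> C"
    proof -
      have "\<bar>s $ k\<bar> \<le> max K L" for k using \<open>0 < K\<close> by (simp add: s_def)
      moreover have "norm ?p \<le> max K L" using p by simp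
      ultimately have "\<bar>G i x s ?p\<bar> \<le> C0" by (intro C0 allI)
      then show ?thesis using C(2) by linarith
    qed
    finally show "evolution G i z (b z) (D z) \<le> 0" using Dt by (simp add: evolution_def z)
  qed
  then show ?thesis using C(1) cont unfolding b_def vec_lambda_beta by blast
qed

text \<open>Uniform continuity of \<open>u\<close>, \<open>v\<close> and \<open>u0\<close> orders
  the two functions near the initial time even at distinct nearby points, which is what
  \<open>comparison\<close> asks for; its conclusion is then read at \<open>z' = z\<close>.\<close>

lemma solution_le:
  fixes u0 :: "real^'n \<Rightarrow> real^'m" and T :: real
  defines "S \<equiv> UNIV \<times> {0..T}"
  assumes T: "0 < T" and u0: "\<And>i. BUC UNIV (\<lambda>x. u0 x $ i)"
    and u: "\<And>i. BUC S (\<lambda>z. u z $ i)" "viscosity_subsolution G u0 T u"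
    and v: "\<And>i. BUC S (\<lambda>z. v z $ i)" "viscosity_supersolution G u0 T v"
    and z: "z \<in> S"
  shows "u z $ i \<le> v z $ i"
proof (rule field_le_epsilon)
  fix e :: real assume e: "0 < e"
  obtain K1 where K1: "0 < K1" "\<And>z i. z \<in> S \<Longrightarrow> \<bar>u z $ i\<bar> \<le> K1" using BUC_vec_bounded[OF u(1)] by blast
  obtain K2 where K2: "0 < K2" "\<And>z i. z \<in> S \<Longrightarrow> \<bar>v z $ i\<bar> \<le> K2" using BUC_vec_bounded[OF v(1)] by blast
  have "\<exists>\<rho>>0. \<forall>i. \<forall>z\<in>S. \<forall>z'\<in>S. dist z z' < \<rho> \<longrightarrow> u z $ i \<le> v z' $ i + e"
    unfolding S_def
  proof (rule comparison[OF T, of "max K1 K2"])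
    show "visc_sub (UNIV \<times> {0..T}) (UNIV \<times> {0<..T}) (evolution G) u"
      using u(2) by (simp add: viscosity_subsolution_iff)
    show "visc_super (UNIV \<times> {0..T}) (UNIV \<times> {0<..T}) (evolution G) v"
      using v(2) by (simp add: viscosity_supersolution_iff)
    show "\<bar>u z $ i\<bar> \<le> max K1 K2" "\<bar>v z $ i\<bar> \<le> max K1 K2" if "z \<in> UNIV \<times> {0..T}" for z i
      using K1(2)[of z i] K2(2)[of z i] that by (auto simp: S_def)
    fix \<kappa> :: real assume "0 < \<kappa>"
    then have \<kappa>: "0 < \<kappa> / 3" by simp
    obtain d1 where d1: "0 < d1" "\<And>z z' i. z \<in> S \<Longrightarrow> z' \<in> S \<Longrightarrow> dist z z' < d1 \<Longrightarrow> \<bar>u z $ i - u z' $ i\<bar> < \<kappa> / 3"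
      using BUC_vec_uniform[OF u(1) \<kappa>] by blast
    obtain d2 where d2: "0 < d2" "\<And>z z' i. z \<in> S \<Longrightarrow> z' \<in> S \<Longrightarrow> dist z z' < d2 \<Longrightarrow> \<bar>v z $ i - v z' $ i\<bar> < \<kappa> / 3"
      using BUC_vec_uniform[OF v(1) \<kappa>] by blast
    obtain d3 where d3: "0 < d3" "\<And>x y i. dist x y < d3 \<Longrightarrow> \<bar>u0 x $ i - u0 y $ i\<bar> < \<kappa> / 3"
      using BUC_vec_uniform[OF u0 \<kappa>] by (metis UNIV_I)
    show "\<exists>\<rho>>0. \<forall>i. \<forall>z\<in>UNIV \<times> {0..T}. \<forall>z'\<in>UNIV \<times> {0..T}. snd z < \<rho> \<and> snd z' < \<rho> \<and>
       norm (fst z - fst z') < \<rho> \<longrightarrow> u z $ i \<le> v z' $ i + \<kappa>"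
    proof (intro exI[of _ "min d1 (min d2 d3)"] conjI allI ballI impI)
      fix i and z z' :: "(real^'n) \<times> real"
      assume zz: "z \<in> UNIV \<times> {0..T}" "z' \<in> UNIV \<times> {0..T}"
        and "snd z < min d1 (min d2 d3) \<and> snd z' < min d1 (min d2 d3) \<and> norm (fst z - fst z') < min d1 (min d2 d3)"
      then have lt: "snd z < d1" "snd z' < d2" "dist (fst z) (fst z') < d3" by (auto simp: dist_norm)
      let ?w = "(fst z, 0) :: (real^'n) \<times> real" and ?w' = "(fst z', 0) :: (real^'n) \<times> real"
      have w: "?w \<in> S" "?w' \<in> S" using T by (auto simp: S_def)
      have "dist z ?w < d1" "dist z' ?w' < d2"
        using lt zz by (auto simp: dist_Pair_Pair dist_real_def)
      then have "\<bar>u z $ i - u ?w $ i\<bar> < \<kappa> / 3" "\<bar>v z' $ i - v ?w' $ i\<bar> < \<kappa> / 3"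
        using d1(2)[OF _ w(1)] d2(2)[OF _ w(2)] zz by (auto simp: S_def)
      moreover have "u ?w $ i \<le> u0 (fst z) $ i" using u(2) by (simp add: viscosity_subsolution_iff)
      moreover have "u0 (fst z') $ i \<le> v ?w' $ i" using v(2) by (simp add: viscosity_supersolution_iff)
      ultimately show "u z $ i \<le> v z' $ i + \<kappa>" using d3(2)[OF lt(3), of i] by linarith
    qed (use d1 d2 d3 in auto)
  qed (use K1 e in auto)
  then show "u z $ i \<le> v z $ i + e" using z by force
qed

theorem well_posed:
  fixes u0 :: "real^'n \<Rightarrow> real^'m"
  assumes T: "0 < T" and u0: "\<And>i. BUC UNIV (\<lambda>x. u0 x $ i)"
  shows "\<exists>u. (\<forall>i. BUC (UNIV \<times> {0..T}) (\<lambda>z. u z $ i)) \<and> viscosity_solution G u0 T u \<and>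
    (\<forall>w. (\<forall>i. BUC (UNIV \<times> {0..T}) (\<lambda>z. w z $ i)) \<and> viscosity_solution G u0 T w \<longrightarrow>
       (\<forall>z \<in> UNIV \<times> {0..T}. w z = u z))"
proof -
  let ?S = "UNIV \<times> {0..T} :: ((real^'n) \<times> real) set" and ?P = "UNIV \<times> {0<..T} :: ((real^'n) \<times> real) set"
  obtain K where K: "0 < K" "\<And>x i. \<bar>u0 x $ i\<bar> \<le> K" using BUC_vec_bounded[OF u0] by (metis UNIV_I)
  obtain Q where Q: "\<And>i x r p. Q \<le> norm p \<Longrightarrow> 0 \<le> G i x r p"
    using coercive by metis
  obtain C0 where C0: "\<And>i x r p. (\<forall>k. \<bar>r $ k\<bar> \<le> max K Q) \<Longrightarrow> norm p \<le> max K Q \<Longrightarrow> \<bar>G i x r p\<bar> \<le> C0"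
    using bounded by metis
  define A where "A = max C0 0"
  have A: "0 \<le> A" "C0 \<le> A" by (auto simp: A_def)
  \<comment> \<open>Large gradients make \<open>G\<close> nonnegative by coercivity, and the
    remaining ones lie in a bounded set. Hence the lower bound is uniform in \<open>p\<close>,
    although no upper bound is.\<close>
  have G_ge: "- A \<le> G i x r p" if "\<And>k. \<bar>r $ k\<bar> \<le> K" for i x r p
  proof (cases "Q \<le> norm p")
    case True
    then show ?thesis using Q[OF True, of i x r] A(1) by linarith
  next
    case False
    have "\<bar>r $ k\<bar> \<le> max K Q" for k using that[of k] by simp
    moreover have "norm p \<le> max K Q" using False by simp
    ultimately have "\<bar>G i x r p\<bar> \<le> C0" by (intro C0 allI)
    then show ?thesis using A(2) by linarith
  qed
  define B where "B z = (\<chi> i. u0 (fst z) $ i + A * snd z)" for z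
  have "continuous_on UNIV (\<lambda>x. u0 x $ i)" for i
    using u0[of i] by (auto simp: BUC_def intro: uniformly_continuous_imp_continuous)
  then have cu0: "continuous_on UNIV (\<lambda>z :: (real^'n) \<times> real. u0 (fst z) $ i)" for i
    by (rule continuous_on_compose2) (intro continuous_intros subset_UNIV)+
  have B_cont: "continuous_on UNIV (\<lambda>z. B z $ i)" for i
    unfolding B_def vec_lambda_beta by (intro continuous_on_add cu0) (intro continuous_intros)
  \<comment> \<open>Every \<open>\<kappa>\<close> gives a subsolution that starts within
    \<open>\<kappa>\<close> of \<open>u0\<close>. The one for \<open>\<kappa> = 1\<close> makes
    Perron's class nonempty and provides the lower bound \<open>m\<close>; small
    \<open>\<kappa>\<close> later show that the initial values are attained.\<close>
  have lower: "\<exists>b C. 0 \<le> C \<and> visc_sub ?S ?P (evolution G) b \<and> (\<forall>z\<in>?S. \<forall>i. b z $ i \<le> B z $ i) \<and>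
      (\<forall>i. continuous_on UNIV (\<lambda>z. b z $ i)) \<and> (\<forall>z\<in>?S. \<forall>i. u0 (fst z) $ i - \<kappa> - C * snd z \<le> b z $ i)"
    if \<kappa>: "0 < \<kappa>" for \<kappa>
  proof -
    obtain g L where g: "0 < L" "\<And>x y i. \<bar>g x $ i - g y $ i\<bar> \<le> L * dist x y"
      "\<And>x i. u0 x $ i - \<kappa> \<le> g x $ i" "\<And>x i. g x $ i \<le> u0 x $ i" "\<And>x i. - K \<le> (g x :: real^'m) $ i"
      using lipschitz_approximation_vec[OF u0 K(2) \<kappa>] by metis
    have "\<bar>g x $ i\<bar> \<le> K" for x i using g(4,5)[of x i] K(2)[of x i] by linarith
    from lower_barrier[OF g(2) this g(1) K(1), of T] obtain C where C: "0 \<le> C"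
      "visc_sub ?S ?P (evolution G) (\<lambda>z. \<chi> i. g (fst z) $ i - C * snd z)"
      "\<forall>i. continuous_on UNIV (\<lambda>z :: (real^'n) \<times> real. g (fst z) $ i - C * snd z)" by blast
    show ?thesis
    proof (intro exI[of _ C] exI[of _ "\<lambda>z. \<chi> i. g (fst z) $ i - C * snd z"] conjI ballI allI C(1,2))
      show "continuous_on UNIV (\<lambda>z :: (real^'n) \<times> real. (\<chi> i. g (fst z) $ i - C * snd z) $ i)" for i
        using C(3) by simp
      fix z :: "(real^'n) \<times> real" and i :: 'm assume "z \<in> ?S"
      then have "0 \<le> A * snd z" "0 \<le> C * snd z" using A(1) C(1) by auto
      then show "(\<chi> i. g (fst z) $ i - C * snd z) $ i \<le> B z $ i"
        using g(4)[of "fst z" i] by (simp add: B_def)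
      show "u0 (fst z) $ i - \<kappa> - C * snd z \<le> (\<chi> i. g (fst z) $ i - C * snd z) $ i"
        using g(3)[of "fst z" i] by simp
    qed
  qed
  obtain b C where b: "0 \<le> C" "visc_sub ?S ?P (evolution G) b" "\<And>z i. z \<in> ?S \<Longrightarrow> b z $ i \<le> B z $ i"
    "\<And>z i. z \<in> ?S \<Longrightarrow> u0 (fst z) $ i - 1 - C * snd z \<le> b z $ i"
    using lower[of 1] by (metis zero_less_one)
  define m where "m = - K - 1 - C * T"
  define M where "M = K + A * T"
  interpret perron ?S ?P "evolution G" b B m M
  proof
    show "closed ?S" by (intro closed_Times closed_UNIV closed_atLeastAtMost)
    show "?P \<subseteq> ?S" by auto
    show "\<exists>e>0. \<forall>y\<in>?S. dist y z < e \<longrightarrow> y \<in> ?P" if "z \<in> ?P" for z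
    proof (intro exI[of _ "snd z"] conjI ballI impI)
      fix y assume "y \<in> ?S" "dist y z < snd z"
      then show "y \<in> ?P" using dist_snd_le[of y z] by (auto simp: mem_Times_iff dist_real_def)
    qed (use that in auto)
    show "continuous_on UNIV (\<lambda>(z, r, p). evolution G i z r p)" for i by (rule continuous_evolution)
    show "evolution G i z s p \<le> evolution G i z r p" if "r $ i = s $ i" "\<And>k. r $ k \<le> s $ k" for i z r s p
      using quasimonotone[OF that] by (simp add: evolution_def)
    show "evolution G i z r (E z) \<le> evolution G i z r (D z)"
      if "C1_with_gradient \<phi> D" "C1_with_gradient \<psi> E" "z \<in> ?P" "local_max_on ?S (\<lambda>x. \<phi> x - \<psi> x) z" for \<phi> D \<psi> E i z r
      by (rule evolution_gradient_mono[OF that])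
    show "visc_sub ?S ?P (evolution G) b" "\<And>z i. z \<in> ?S \<Longrightarrow> b z $ i \<le> B z $ i" by fact+
    show "continuous_on ?S (\<lambda>z. B z $ i)" for i by (rule continuous_on_subset[OF B_cont]) auto
    show "m \<le> b z $ i" if "z \<in> ?S" for z i
    proof -
      have "C * snd z \<le> C * T" using that b(1) by (auto intro: mult_left_mono)
      then show ?thesis using b(4)[OF that, of i] K(2)[of "fst z" i] unfolding m_def by linarith
    qed
    show "B z $ i \<le> M" if "z \<in> ?S" for z i
    proof -
      have "A * snd z \<le> A * T" using that A(1) by (auto intro: mult_left_mono)
      then show ?thesis using K(2)[of "fst z" i] by (simp add: M_def B_def)
    qed
    show "0 \<le> evolution G i z r (D z)"
      if C1: "C1_with_gradient \<phi> D" and z: "z \<in> ?P" and min: "local_min_on ?S (\<lambda>x. B x $ i - \<phi> x) z"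
        and r: "r $ i = B z $ i" "\<And>k. m \<le> r $ k \<and> r $ k \<le> B z $ k" for \<phi> D i z r
    proof -
      obtain x t where xt: "z = (x, t)" "0 < t" "t \<le> T" using z by auto
      have max: "local_max_on ?S (\<lambda>x. - B x $ i - - \<phi> x) z"
        using min unfolding local_min_on_iff_max by simp
      have "A \<le> (0, - 1) \<bullet> (- D z)"
      proof (rule local_max_directional[OF C1_minus[OF C1] max])
        show "\<forall>\<^sub>F s in at_right 0. z + s *\<^sub>R (0, - 1) \<in> ?S \<and> - B z $ i + A * s \<le> - B (z + s *\<^sub>R (0, - 1)) $ i"
          using eventually_past[OF xt(2,3), of x]
          by (rule eventually_mono) (simp add: xt B_def algebra_simps)
      qed
      then have Dt: "A \<le> snd (D z)" by (simp add: inner_prod_def)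
      \<comment> \<open>The mirror image of the vector in \<open>lower_barrier\<close>: since
        \<open>r\<close> equals \<open>B z\<close> at \<open>i\<close> and is at most
        \<open>B z\<close> elsewhere, \<open>r - s\<close> is largest at \<open>i\<close>. So
        \<open>G\<close> at \<open>r\<close> is at least \<open>G\<close> at \<open>s\<close>, which
        \<open>G_ge\<close> controls.\<close>
      define s where "s = (\<chi> k. if k = i then - K else K)"
      have At: "0 \<le> A * t" using A(1) xt by simp
      have "- A \<le> G i x s (fst (D z))" using K(1) by (intro G_ge) (auto simp: s_def)
      also have "\<dots> \<le> G i x r (fst (D z))"
      proof (rule mon)
        fix k
        show "r $ k - s $ k \<le> r $ i - s $ i"
          using r(1) r(2)[of k] K(2)[of x k] K(2)[of x i] by (auto simp: s_def B_def xt)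
        show "s $ i \<le> r $ i" using r(1) K(2)[of x i] At by (auto simp: s_def B_def xt)
      qed
      finally show ?thesis using Dt by (simp add: evolution_def xt)
    qed
  qed
  \<comment> \<open>The approximate barriers belong to Perron's class and hence lie below
    \<open>W\<close>; being continuous, they also lie below its lower envelope.\<close>
  have V_lower: "\<exists>C\<ge>0. \<forall>z\<in>?S. \<forall>i. u0 (fst z) $ i - \<kappa> - C * snd z \<le> V z $ i" if \<kappa>: "0 < \<kappa>" for \<kappa>
  proof -
    obtain b' C' where b': "0 \<le> C'" "visc_sub ?S ?P (evolution G) b'" "\<And>z i. z \<in> ?S \<Longrightarrow> b' z $ i \<le> B z $ i"
      "\<And>i. continuous_on UNIV (\<lambda>z. b' z $ i)"
      "\<And>z i. z \<in> ?S \<Longrightarrow> u0 (fst z) $ i - \<kappa> - C' * snd z \<le> b' z $ i"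
      using lower[OF \<kappa>] by metis
    have "b' \<in> subs" using b'(2,3) by (simp add: subs_def)
    then have "b' z $ i \<le> V z $ i" if "z \<in> ?S" for z i
      by (intro V_greatest[OF _ _ that] continuous_on_imp_lsc_on continuous_on_subset[OF b'(4)] subs_le_W) auto
    then have "u0 (fst z) $ i - \<kappa> - C' * snd z \<le> V z $ i" if "z \<in> ?S" for z i
      using b'(5)[OF that, of i] that by (meson order_trans)
    then show ?thesis using b'(1) by blast
  qed
  have compare: "\<exists>\<rho>>0. \<forall>i. \<forall>z\<in>?S. \<forall>z'\<in>?S. dist z z' < \<rho> \<longrightarrow> W z $ i \<le> V z' $ i + \<kappa>" if "0 < \<kappa>" for \<kappa>
  proof (rule comparison[OF T _ W_sub _ V_super _ _ that, of "\<bar>m\<bar> + \<bar>M\<bar> + 1"])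
    fix z i assume z: "z \<in> ?S"
    have "m \<le> V z $ i" "V z $ i \<le> W z $ i" "W z $ i \<le> M"
      using V_ge[OF z] V_le_W[OF z] order_trans[OF W_le_B[OF z] B_le[OF z]] by auto
    then show "\<bar>W z $ i\<bar> \<le> \<bar>m\<bar> + \<bar>M\<bar> + 1" "\<bar>V z $ i\<bar> \<le> \<bar>m\<bar> + \<bar>M\<bar> + 1" by linarith+
  next
    fix \<kappa> :: real assume "0 < \<kappa>"
    then have \<kappa>: "0 < \<kappa> / 4" by simp
    obtain C where C: "0 \<le> C" "\<And>z i. z \<in> ?S \<Longrightarrow> u0 (fst z) $ i - \<kappa> / 4 - C * snd z \<le> V z $ i"
      using V_lower[OF \<kappa>] by blast
    obtain d where d: "0 < d" "\<And>x y i. dist x y < d \<Longrightarrow> \<bar>u0 x $ i - u0 y $ i\<bar> < \<kappa> / 4"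
      using BUC_vec_uniform[OF u0 \<kappa>] by (metis UNIV_I)
    \<comment> \<open>Before time \<open>\<tau>\<close> the rise of the upper barrier and the fall
      of the lower one together cost at most \<open>\<kappa> / 4\<close>. The approximation of
      \<open>u0\<close> and its oscillation cost another quarter each.\<close>
    define \<tau> where "\<tau> = \<kappa> / 4 / (A + C + 1)"
    have AC: "0 < A + C + 1" using A(1) C(1) by linarith
    then have \<tau>: "0 < \<tau>" using \<kappa> unfolding \<tau>_def by (rule divide_pos_pos[rotated])
    have \<tau>': "(A + C + 1) * \<tau> = \<kappa> / 4"
      unfolding \<tau>_def using AC by (intro nonzero_mult_div_cancel_left[THEN trans[OF times_divide_eq_right]]) auto
    show "\<exists>\<rho>>0. \<forall>i. \<forall>z\<in>?S. \<forall>z'\<in>?S. snd z < \<rho> \<and> snd z' < \<rho> \<and> norm (fst z - fst z') < \<rho> \<longrightarrow>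
        W z $ i \<le> V z' $ i + \<kappa>"
    proof (intro exI[of _ "min \<tau> d"] conjI allI ballI impI)
      fix i z z' assume zz: "z \<in> ?S" "z' \<in> ?S"
        and lt: "snd z < min \<tau> d \<and> snd z' < min \<tau> d \<and> norm (fst z - fst z') < min \<tau> d"
      have "A * snd z \<le> A * \<tau>" "C * snd z' \<le> C * \<tau>"
        using lt A(1) C(1) by (auto intro!: mult_left_mono)
      moreover have "A * \<tau> + C * \<tau> + \<tau> = \<kappa> / 4" using \<tau>' by (simp add: distrib_right)
      moreover have "W z $ i \<le> u0 (fst z) $ i + A * snd z"
        using W_le_B[OF zz(1), of i] by (simp add: B_def)
      moreover have "\<bar>u0 (fst z) $ i - u0 (fst z') $ i\<bar> < \<kappa> / 4" using d(2) lt by (simp add: dist_norm)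
      ultimately show "W z $ i \<le> V z' $ i + \<kappa>"
        using C(2)[OF zz(2), of i] \<tau> \<open>0 < \<kappa>\<close> by linarith
    qed (use \<tau> d in auto)
  qed simp
  have VW: "W z = V z" if z: "z \<in> ?S" for z
  proof -
    have "W z $ i \<le> V z $ i" for i
    proof (rule field_le_epsilon)
      fix e :: real assume "0 < e"
      from compare[OF this] show "W z $ i \<le> V z $ i + e" using z by force
    qed
    then show ?thesis using V_le_W[OF z] by (simp add: vec_eq_iff antisym)
  qed
  have V_sub: "visc_sub ?S ?P (evolution G) V" by (rule visc_sub_cong[OF W_sub P_subset VW])
  have V_le: "V z $ i \<le> u0 (fst z) $ i + A * snd z" if "z \<in> ?S" for z i
    using V_le_W[OF that, of i] W_le_B[OF that, of i] by (simp add: B_def)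
  have V_uniform: "\<exists>\<rho>>0. \<forall>i. \<forall>z\<in>?S. \<forall>z'\<in>?S. dist z z' < \<rho> \<longrightarrow> \<bar>V z $ i - V z' $ i\<bar> \<le> \<kappa>" if \<kappa>: "0 < \<kappa>" for \<kappa>
  proof -
    obtain \<rho> where \<rho>: "0 < \<rho>" "\<And>i z z'. z \<in> ?S \<Longrightarrow> z' \<in> ?S \<Longrightarrow> dist z z' < \<rho> \<Longrightarrow> W z $ i \<le> V z' $ i + \<kappa>"
      using compare[OF \<kappa>] by blast
    show ?thesis
    proof (intro exI[of _ \<rho>] conjI allI ballI impI \<rho>(1))
      fix i z z' assume zz: "z \<in> ?S" "z' \<in> ?S" "dist z z' < \<rho>"
      show "\<bar>V z $ i - V z' $ i\<bar> \<le> \<kappa>"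
        using \<rho>(2)[OF zz, of i] \<rho>(2)[OF zz(2,1), of i] zz(3) VW[OF zz(1)] VW[OF zz(2)]
        by (auto simp: dist_commute)
    qed
  qed
  have V_BUC: "BUC ?S (\<lambda>z. V z $ i)" for i
    unfolding BUC_def
  proof
    have "\<bar>V z $ i\<bar> \<le> \<bar>m\<bar> + \<bar>M\<bar>" if z: "z \<in> ?S" for z
      using V_ge[OF z, of i] V_le_W[OF z, of i] W_le_B[OF z, of i] B_le[OF z, of i] by linarith
    then show "bounded ((\<lambda>z. V z $ i) ` ?S)" unfolding bounded_iff by auto
    show "uniformly_continuous_on ?S (\<lambda>z. V z $ i)"
      unfolding uniformly_continuous_on_def
    proof (intro allI impI)
      fix e :: real assume "0 < e"
      then have "0 < e / 2" "e / 2 < e" by auto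
      with V_uniform[OF this(1)]
      show "\<exists>d>0. \<forall>x\<in>?S. \<forall>x'\<in>?S. dist x' x < d \<longrightarrow> dist (V x' $ i) (V x $ i) < e"
        unfolding dist_real_def by (meson le_less_trans)
    qed
  qed
  have "continuous_on ?S V"
  proof -
    have "continuous_on ?S (\<lambda>z. \<chi> i. V z $ i)"
      using V_BUC unfolding BUC_def
      by (intro continuous_on_vec_lambda uniformly_continuous_imp_continuous) auto
    then show ?thesis by simp
  qed
  moreover have "V (x, 0) $ i \<le> u0 x $ i" for x i
    using V_le[of "(x, 0)" i] T by simp
  moreover have "u0 x $ i \<le> V (x, 0) $ i" for x i
  proof (rule field_le_epsilon)
    fix e :: real assume "0 < e"
    from V_lower[OF this] obtain C where "\<And>z i. z \<in> ?S \<Longrightarrow> u0 (fst z) $ i - e - C * snd z \<le> V z $ i" by blast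
    from this[of "(x, 0)" i] show "u0 x $ i \<le> V (x, 0) $ i + e" using T by simp
  qed
  ultimately have V_sol: "viscosity_solution G u0 T V"
    using V_sub V_super unfolding viscosity_solution_def
    by (simp add: viscosity_subsolution_iff viscosity_supersolution_iff)
  show ?thesis
  proof (intro exI[of _ V] conjI allI impI ballI V_BUC V_sol)
    fix w z assume w: "(\<forall>i. BUC ?S (\<lambda>z. w z $ i)) \<and> viscosity_solution G u0 T w" and z: "z \<in> ?S"
    have "w z $ i \<le> V z $ i" "V z $ i \<le> w z $ i" for i
      using w V_sol V_BUC z unfolding viscosity_solution_def by (auto intro!: solution_le[OF T u0])
    then show "w z = V z" by (simp add: vec_eq_iff antisym)
  qed
qed

end

section \<open>The cell problem\<close>

text \<open>In the whole space every direction may be tested, in particular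
  \<open>D z - E z\<close>.\<close>

lemma interior_gradient:
  assumes "C1_with_gradient \<phi> D" "C1_with_gradient \<psi> E" "local_max_on UNIV (\<lambda>w. \<phi> w - \<psi> w) z"
  shows "D z = E z"
proof -
  have "(D z - E z) \<bullet> D z \<le> (D z - E z) \<bullet> E z"
    by (rule local_max_gradient[OF assms]) simp
  then have "(D z - E z) \<bullet> (D z - E z) \<le> 0" by (simp add: inner_diff_right)
  then show ?thesis by (metis antisym eq_iff_diff_eq_0 inner_eq_zero_iff inner_ge_zero)
qed

text \<open>The mollified norm is smooth, and its gradient exceeds \<open>L\<close> outside a ball around the base point
  that shrinks with \<open>e\<close>.\<close>

lemma usc_bounded_gradient_imp_lipschitz:
  fixes w :: "'a::euclidean_space \<Rightarrow> real"
  assumes usc: "usc_on UNIV w" and bnd: "\<And>x. \<bar>w x\<bar> \<le> M" and "0 \<le> L"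
    and grad: "\<And>\<phi> D z. C1_with_gradient \<phi> D \<Longrightarrow> local_max_on UNIV (\<lambda>x. w x - \<phi> x) z \<Longrightarrow> norm (D z) \<le> L"
  shows "w x - w y \<le> (L + 1) * norm (x - y)"
proof (rule field_le_epsilon)
  fix b :: real assume "0 < b"
  define a where "a = b / 2"
  have a: "0 < a" "b = a + a" using \<open>0 < b\<close> by (auto simp: a_def)
  obtain d where d: "d > 0" "\<And>z. dist z y < d \<Longrightarrow> w z < w y + a"
    using usc a(1) unfolding usc_on_iff by (metis UNIV_I less_add_same_cancel1)
  \<comment> \<open>The gradient bound will place the maximum point within \<open>L * e\<close> of
    \<open>y\<close>, which must be less than \<open>d\<close> for semicontinuity at
    \<open>y\<close> to act. The second bound keeps the smoothing error at \<open>x\<close> below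
    \<open>a\<close>.\<close>
  define e where "e = min (d / (2 * (L + 1))) (a / (L + 1))"
  have e: "0 < e" using d(1) a(1) \<open>0 \<le> L\<close> by (simp add: e_def)
  have "e \<le> d / (2 * (L + 1))" "e \<le> a / (L + 1)" by (simp_all add: e_def)
  then have e2: "2 * ((L + 1) * e) \<le> d" "(L + 1) * e \<le> a"
    using \<open>0 \<le> L\<close> by (simp_all add: pos_le_divide_eq mult.commute mult.left_commute)
  have "L * e < (L + 1) * e" using e by simp
  then have Le: "L * e < d" using e2(1) mult_nonneg_nonneg[OF \<open>0 \<le> L\<close>, of e] e d(1) by linarith
  define \<phi> where "\<phi> z = (L + 1) * sqrt (e\<^sup>2 + (norm (z - y))\<^sup>2)" for z
  define D where "D z = ((L + 1) / sqrt (e\<^sup>2 + (norm (z - y))\<^sup>2)) *\<^sub>R (z - y)" for z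
  have C1: "C1_with_gradient \<phi> D" unfolding \<phi>_def D_def using e by (intro C1_sqrt) simp
  have \<phi>_ge: "(L + 1) * norm (z - y) \<le> \<phi> z" for z
    unfolding \<phi>_def using \<open>0 \<le> L\<close> by (intro mult_left_mono real_le_rsqrt) auto
  have \<phi>_le: "\<phi> z \<le> (L + 1) * e + (L + 1) * norm (z - y)" for z
  proof -
    have "sqrt (e\<^sup>2 + (norm (z - y))\<^sup>2) \<le> e + norm (z - y)"
      using e by (intro sqrt_sum_squares_le_sum) auto
    then have "(L + 1) * sqrt (e\<^sup>2 + (norm (z - y))\<^sup>2) \<le> (L + 1) * (e + norm (z - y))"
      using \<open>0 \<le> L\<close> by (intro mult_left_mono) auto
    then show ?thesis by (simp add: \<phi>_def distrib_left)
  qed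
  have \<phi>0: "0 \<le> \<phi> z" for z unfolding \<phi>_def using \<open>0 \<le> L\<close> by simp
  \<comment> \<open>Beyond this radius the cone alone pushes \<open>w - \<phi>\<close> below its
    value at \<open>y\<close>, so the maximum over the ball is global.\<close>
  define \<rho> where "\<rho> = norm (x - y) + 2 * M + (L + 1) * e"
  have "0 \<le> M" using bnd[of x] by linarith
  then have \<rho>: "0 \<le> \<rho>" "norm (x - y) \<le> \<rho>" "2 * M + (L + 1) * e \<le> \<rho>"
    using e \<open>0 \<le> L\<close> unfolding \<rho>_def by simp_all
  have us: "usc_on (cball y \<rho>) (\<lambda>z. w z + - \<phi> z)"
  proof (rule usc_on_add)
    show "usc_on (cball y \<rho>) w" by (rule usc_on_subset[OF usc]) auto
    show "usc_on (cball y \<rho>) (\<lambda>z. - \<phi> z)"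
      by (intro continuous_on_imp_usc_on continuous_on_minus
          continuous_on_subset[OF C1_imp_continuous[OF C1]] subset_UNIV)
  qed
  have y_in: "y \<in> cball y \<rho>" using \<rho>(1) by simp
  then have ne: "cball y \<rho> \<noteq> {}" by blast
  obtain z where z: "z \<in> cball y \<rho>" "\<And>x. x \<in> cball y \<rho> \<Longrightarrow> w x - \<phi> x \<le> w z - \<phi> z"
    using usc_attains_max[OF compact_cball ne us] by auto
  have max: "w x' - \<phi> x' \<le> w z - \<phi> z" for x'
  proof (cases "x' \<in> cball y \<rho>")
    case False
    then have "\<rho> \<le> norm (x' - y)" by (simp add: dist_norm norm_minus_commute)
    moreover have "norm (x' - y) \<le> (L + 1) * norm (x' - y)"
      using \<open>0 \<le> L\<close> mult_right_mono[of 1 "L + 1" "norm (x' - y)"] by simp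
    ultimately have "w x' - \<phi> x' \<le> M - \<rho>" using bnd[of x'] \<phi>_ge[of x'] by linarith
    also have "\<dots> \<le> w y - \<phi> y" using bnd[of y] \<phi>_le[of y] \<rho>(3) by simp
    also have "\<dots> \<le> w z - \<phi> z" using z(2)[OF y_in] .
    finally show ?thesis .
  qed (use z in auto)
  then have "local_max_on UNIV (\<lambda>x. w x - \<phi> x) z"
    unfolding local_max_on_iff by (auto intro: exI[of _ 1])
  from grad[OF C1 this] have Dz: "norm (D z) \<le> L" .
  define n where "n = norm (z - y)"
  define s where "s = sqrt (e\<^sup>2 + n\<^sup>2)"
  have s: "0 < s" "s\<^sup>2 = e\<^sup>2 + n\<^sup>2" using e by (auto simp: s_def add_pos_nonneg)
  have "norm (D z) = (L + 1) / s * n"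
    using s(1) \<open>0 \<le> L\<close> by (simp add: D_def n_def[symmetric] s_def[symmetric])
  with Dz have "(L + 1) * n \<le> L * s" using s(1) by (simp add: field_simps)
  then have "((L + 1) * n)\<^sup>2 \<le> (L * s)\<^sup>2"
    using \<open>0 \<le> L\<close> by (intro power_mono) (auto simp: n_def)
  then have "(L + 1)\<^sup>2 * n\<^sup>2 \<le> L\<^sup>2 * (e\<^sup>2 + n\<^sup>2)" by (simp add: power_mult_distrib s(2))
  moreover have "(L + 1)\<^sup>2 * n\<^sup>2 = L\<^sup>2 * n\<^sup>2 + 2 * L * n\<^sup>2 + n\<^sup>2" by (simp add: power2_eq_square algebra_simps)
  moreover have "0 \<le> 2 * L * n\<^sup>2" using \<open>0 \<le> L\<close> by simp
  ultimately have "n\<^sup>2 \<le> (L * e)\<^sup>2" by (simp add: power_mult_distrib distrib_left)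
  then have "n \<le> L * e" by (rule power2_le_imp_le) (use \<open>0 \<le> L\<close> e in simp)
  then have "dist z y < d" using Le by (simp add: n_def dist_norm)
  from d(2)[OF this] max[of x] \<phi>0[of z] \<phi>_le[of x] e2(2)
  show "w x - w y \<le> (L + 1) * norm (x - y) + b" unfolding a(2) by linarith
qed

text \<open>Supersolutions are covered by passing to \<open>- w\<close> and \<open>\<lambda>y q. - F y (- q)\<close>.\<close>

lemma limit_subsolution:
  fixes F :: "'a::euclidean_space \<Rightarrow> 'a \<Rightarrow> real"
  assumes F: "continuous_on UNIV (\<lambda>(y, q). F y q)"
    and usc: "\<And>n. usc_on UNIV (w n)"
    and conv: "\<And>e. 0 < e \<Longrightarrow> \<exists>N. \<forall>n\<ge>N. \<forall>y. \<bar>w n y - v y\<bar> < e"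
    and c: "c \<longlonglongrightarrow> (l::real)"
    and sub: "\<And>n \<phi> D y. C1_with_gradient \<phi> D \<Longrightarrow> local_max_on UNIV (\<lambda>x. w n x - \<phi> x) y \<Longrightarrow> F y (D y) \<le> c n"
    and C1: "C1_with_gradient \<phi> D" and max: "local_max_on UNIV (\<lambda>x. v x - \<phi> x) z"
  shows "F z (D z) \<le> l"
proof (rule ccontr)
  assume "\<not> ?thesis"
  then obtain a where a: "l < a" "a < F z (D z)" using dense not_le by blast
  have "open {x. a < (\<lambda>(y, q). F y q) x}"
    by (intro open_Collect_less F continuous_on_const)
  moreover have "(z, D z) \<in> {x. a < (\<lambda>(y, q). F y q) x}" using a by simp
  ultimately obtain e where e: "e > 0" "ball (z, D z) e \<subseteq> {x. a < (\<lambda>(y, q). F y q) x}"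
    by (metis openE)
  obtain \<mu> where \<mu>: "0 < \<mu>"
    "\<And>w z'. usc_on UNIV w \<Longrightarrow> (\<And>y. y \<in> UNIV \<Longrightarrow> dist y z < e / 2 \<Longrightarrow> w y \<le> v y + \<mu>) \<Longrightarrow>
       z' \<in> UNIV \<Longrightarrow> dist z' z < \<mu> \<Longrightarrow> v z - \<mu> < w z' \<Longrightarrow>
       \<exists>\<psi> E y. C1_with_gradient \<psi> E \<and> y \<in> UNIV \<and> dist y z < e / 2 \<and> local_max_on UNIV (\<lambda>x. w x - \<psi> x) y \<and>
         \<bar>w y - v z\<bar> < e / 2 \<and> norm (E y - D z) < e / 2"
    using touching_stability[OF closed_UNIV C1 max half_gt_zero[OF e(1)]] by blast
  obtain N where N: "\<And>n y. n \<ge> N \<Longrightarrow> \<bar>w n y - v y\<bar> < \<mu>" using conv[OF \<mu>(1)] by blast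
  have "\<forall>\<^sub>F n in sequentially. c n < a" using c a(1) by (rule order_tendstoD)
  then obtain N' where N': "\<And>n. n \<ge> N' \<Longrightarrow> c n < a" unfolding eventually_sequentially by blast
  define n where "n = max N N'"
  have n: "N \<le> n" "N' \<le> n" by (auto simp: n_def)
  have "\<exists>\<psi> E y. C1_with_gradient \<psi> E \<and> y \<in> UNIV \<and> dist y z < e / 2 \<and> local_max_on UNIV (\<lambda>x. w n x - \<psi> x) y \<and>
         \<bar>w n y - v z\<bar> < e / 2 \<and> norm (E y - D z) < e / 2"
  proof (rule \<mu>(2)[OF usc, of n z])
    show "w n y \<le> v y + \<mu>" for y using N[OF n(1), of y] by linarith
    show "v z - \<mu> < w n z" using N[OF n(1), of z] by linarith
  qed (use \<mu>(1) in auto)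
  then obtain \<psi> E y where y: "C1_with_gradient \<psi> E" "dist y z < e / 2" "local_max_on UNIV (\<lambda>x. w n x - \<psi> x) y"
    "norm (E y - D z) < e / 2" by blast
  have "dist (y, E y) (z, D z) \<le> dist y z + dist (E y) (D z)"
    unfolding dist_Pair_Pair by (rule sqrt_sum_squares_le_sum) auto
  also have "\<dots> < e" using y(2,4) by (simp add: dist_norm)
  finally have "(y, E y) \<in> {x. a < (\<lambda>(y, q). F y q) x}" using e(2) by (auto simp: dist_commute)
  then have "a < F y (E y)" by simp
  with sub[OF y(1,3)] N'[OF n(2)] show False by linarith
qed

section \<open>Periodic functions and their reduction to the unit cube\<close>

definition frac_vec :: "real^'n \<Rightarrow> real^'n" where
  "frac_vec y = (\<chi> i. frac (y $ i))"

lemma frac_vec_in_cbox: "frac_vec y \<in> cbox 0 1"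
  by (auto simp: frac_vec_def mem_box_cart frac_lt_1 less_imp_le)

lemma integer_periodic_frac_vec:
  assumes "integer_periodic f"
  shows "f (frac_vec y) = f y"
proof -
  have "\<forall>i. (y - frac_vec y) $ i \<in> \<int>" by (simp add: frac_vec_def frac_def)
  then have "f (frac_vec y + (y - frac_vec y)) = f (frac_vec y)"
    using assms unfolding integer_periodic_def by blast
  then show ?thesis by simp
qed

lemma frac_vec_add_int:
  assumes "\<forall>i. k $ i \<in> \<int>"
  shows "frac_vec (y + k) = frac_vec y"
  using assms by (auto simp: frac_vec_def vec_eq_iff frac_def elim!: Ints_cases)

lemma integer_periodic_bounded:
  fixes v :: "real^'n \<Rightarrow> real"
  assumes "continuous_on UNIV v" "integer_periodic v"
  obtains K where "0 < K" "\<And>y. \<bar>v y\<bar> \<le> K"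
proof -
  have "compact (v ` cbox 0 1)"
    by (intro compact_continuous_image continuous_on_subset[OF assms(1)]) auto
  then obtain K where K: "0 < K" "\<And>y. y \<in> cbox 0 1 \<Longrightarrow> \<bar>v y\<bar> \<le> K"
    using compact_imp_bounded bounded_pos by (metis image_eqI real_norm_def)
  show thesis
    by (rule that[OF K(1)]) (metis K(2) frac_vec_in_cbox integer_periodic_frac_vec[OF assms(2)])
qed

lemma integer_periodic_attains_sup:
  fixes v :: "real^'n \<Rightarrow> real"
  assumes "continuous_on UNIV v" "integer_periodic v"
  obtains z where "\<And>y. v y \<le> v z"
proof -
  have "\<exists>z\<in>cbox 0 1. \<forall>y\<in>cbox 0 1. v y \<le> v z"
    by (intro continuous_attains_sup continuous_on_subset[OF assms(1)])
      (use frac_vec_in_cbox in auto)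
  then show thesis
    using that frac_vec_in_cbox integer_periodic_frac_vec[OF assms(2)] by metis
qed

text \<open>The index \<open>i\<close> and the vector \<open>r\<close> are dummies over one-element
  types. They turn the scalar Hamiltonian into a one-component system to which
  \<open>comparison\<close> applies.\<close>

locale cell_hamiltonian = regular_hamiltonian "\<lambda>(i::1) y (r::real^1) q. F y q"
  for F :: "real^'n \<Rightarrow> real^'n \<Rightarrow> real" +
  assumes periodic: "integer_periodic (\<lambda>y. F y q)"
begin

lemma continuous_F: "continuous_on UNIV (\<lambda>(y, q). F y q)"
proof -
  have "continuous_on UNIV (\<lambda>w. (\<lambda>(x, r, p). F x p) (fst w, 0 :: real^1, snd w))"
    by (rule continuous_on_compose2[OF continuous]) (intro continuous_intros subset_UNIV)+
  then show ?thesis by (simp add: case_prod_unfold)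
qed

text \<open>\<open>v1 - c1 t\<close> and \<open>v2 - c2 t\<close> solve the evolution equation on arbitrarily long time intervals.\<close>

lemma sub_super_constant_le:
  assumes v1: "continuous_on UNIV v1" "\<And>y. \<bar>v1 y\<bar> \<le> K"
      "\<And>\<phi> D y. C1_with_gradient \<phi> D \<Longrightarrow> local_max_on UNIV (\<lambda>w. v1 w - \<phi> w) y \<Longrightarrow> F y (D y) \<le> c1"
    and v2: "continuous_on UNIV v2" "\<And>y. \<bar>v2 y\<bar> \<le> K"
      "\<And>\<phi> D y. C1_with_gradient \<phi> D \<Longrightarrow> local_min_on UNIV (\<lambda>w. v2 w - \<phi> w) y \<Longrightarrow> c2 \<le> F y (D y)"
  shows "c2 \<le> c1"
proof (rule ccontr)
  assume "\<not> ?thesis"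
  then have less: "0 < c2 - c1" by simp
  have "0 \<le> K" using v1(2)[of undefined] by linarith
  \<comment> \<open>At time \<open>T\<close> the linear drift has opened a gap of
    \<open>4 * K + 3\<close>. Subtracting the shift \<open>2 * K + 1\<close> and the oscillation
    \<open>2 * K\<close> leaves \<open>u1\<close> at least 2 above \<open>u2\<close>, while
    comparison with \<open>\<kappa> = 1\<close> allows only 1.\<close>
  define T where "T = (4 * K + 3) / (c2 - c1)"
  have T: "0 < T" "c2 * T - c1 * T = 4 * K + 3"
  proof -
    show "0 < T" using less \<open>0 \<le> K\<close> by (simp add: T_def)
    have "(c2 - c1) * T = 4 * K + 3" using less by (simp add: T_def)
    then show "c2 * T - c1 * T = 4 * K + 3" by (simp add: left_diff_distrib)
  qed
  let ?S = "UNIV \<times> {0..T} :: ((real^'n) \<times> real) set" and ?P = "UNIV \<times> {0<..T} :: ((real^'n) \<times> real) set"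
  let ?G = "evolution (\<lambda>(i::1) y (r::real^1) q. F y q)"
  define u1 where "u1 z = (v1 (fst z) - (2 * K + 1)) - c1 * snd z" for z
  define u2 where "u2 z = v2 (fst z) - c2 * snd z" for z
  have cv: "continuous_on UNIV (\<lambda>z :: (real^'n) \<times> real. v1 (fst z))" "continuous_on UNIV (\<lambda>z :: (real^'n) \<times> real. v2 (fst z))"
    by (rule continuous_on_compose2[OF v1(1)] continuous_on_compose2[OF v2(1)], intro continuous_intros, rule subset_UNIV)+
  have cu: "continuous_on UNIV u1" "continuous_on UNIV u2"
    unfolding u1_def u2_def by (intro continuous_on_diff cv; intro continuous_intros)+
  have sub: "visc_sub ?S ?P ?G (\<lambda>z. vec (u1 z))"
    unfolding visc_sub_def
  proof (intro conjI allI impI)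
    show "usc_on ?S (\<lambda>z. vec (u1 z) $ (i::1))" for i
      using continuous_on_imp_usc_on[OF continuous_on_subset[OF cu(1)], of ?S] by simp
    fix \<phi> D and i :: 1 and z
    assume *: "C1_with_gradient \<phi> D \<and> z \<in> ?P \<and> local_max_on ?S (\<lambda>z. vec (u1 z) $ i - \<phi> z) z"
    then have C1: "C1_with_gradient \<phi> D" and max: "local_max_on ?S (\<lambda>z. u1 z - \<phi> z) z" by simp_all
    obtain x t where z: "z = (x, t)" "0 < t" "t \<le> T" using * by auto
    have "c1 \<le> (0, - 1) \<bullet> D z"
    proof (rule local_max_directional[OF C1 max])
      show "\<forall>\<^sub>F s in at_right 0. z + s *\<^sub>R (0, - 1) \<in> ?S \<and> u1 z + c1 * s \<le> u1 (z + s *\<^sub>R (0, - 1))"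
        unfolding z(1) using eventually_past[OF z(2,3), of x]
        by (rule eventually_mono) (simp add: u1_def algebra_simps)
    qed
    moreover have "F x (fst (D (x, t))) \<le> c1"
    proof (rule v1(3)[OF C1_slice[OF C1]])
      obtain d where d: "d > 0" "\<And>w. w \<in> ?S \<Longrightarrow> dist w z < d \<Longrightarrow> u1 w - \<phi> w \<le> u1 z - \<phi> z"
        using max unfolding local_max_on_iff by blast
      show "local_max_on UNIV (\<lambda>w. v1 w - \<phi> (w, t)) x"
        unfolding local_max_on_iff
      proof (intro conjI exI[of _ d] ballI impI d(1))
        fix w assume "dist w x < d"
        then show "v1 w - \<phi> (w, t) \<le> v1 x - \<phi> (x, t)"
          using d(2)[of "(w, t)"] z by (simp add: dist_Pair_Pair u1_def)
      qed simp
    qed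
    ultimately show "?G i z (vec (u1 z)) (D z) \<le> 0" by (simp add: evolution_def z inner_prod_def)
  qed
  have super: "visc_super ?S ?P ?G (\<lambda>z. vec (u2 z))"
    unfolding visc_super_def
  proof (intro conjI allI impI)
    show "lsc_on ?S (\<lambda>z. vec (u2 z) $ (i::1))" for i
      using continuous_on_imp_lsc_on[OF continuous_on_subset[OF cu(2)], of ?S] by simp
    fix \<phi> D and i :: 1 and z
    assume *: "C1_with_gradient \<phi> D \<and> z \<in> ?P \<and> local_min_on ?S (\<lambda>z. vec (u2 z) $ i - \<phi> z) z"
    then have C1: "C1_with_gradient \<phi> D" and min: "local_min_on ?S (\<lambda>z. u2 z - \<phi> z) z" by simp_all
    then have max: "local_max_on ?S (\<lambda>z. - u2 z - - \<phi> z) z"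
      unfolding local_min_on_iff_max by simp
    obtain x t where z: "z = (x, t)" "0 < t" "t \<le> T" using * by auto
    have "- c2 \<le> (0, - 1) \<bullet> (- D z)"
    proof (rule local_max_directional[OF C1_minus[OF C1] max])
      show "\<forall>\<^sub>F s in at_right 0. z + s *\<^sub>R (0, - 1) \<in> ?S \<and> - u2 z + - c2 * s \<le> - u2 (z + s *\<^sub>R (0, - 1))"
        unfolding z(1) using eventually_past[OF z(2,3), of x]
        by (rule eventually_mono) (simp add: u2_def algebra_simps)
    qed
    moreover have "c2 \<le> F x (fst (D (x, t)))"
    proof (rule v2(3)[OF C1_slice[OF C1]])
      obtain d where d: "d > 0" "\<And>w. w \<in> ?S \<Longrightarrow> dist w z < d \<Longrightarrow> u2 z - \<phi> z \<le> u2 w - \<phi> w"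
        using min unfolding local_min_on_iff by blast
      show "local_min_on UNIV (\<lambda>w. v2 w - \<phi> (w, t)) x"
        unfolding local_min_on_iff
      proof (intro conjI exI[of _ d] ballI impI d(1))
        fix w assume "dist w x < d"
        then show "v2 x - \<phi> (x, t) \<le> v2 w - \<phi> (w, t)"
          using d(2)[of "(w, t)"] z by (simp add: dist_Pair_Pair u2_def)
      qed simp
    qed
    ultimately show "0 \<le> ?G i z (vec (u2 z)) (D z)" by (simp add: evolution_def z inner_prod_def)
  qed
  define M where "M = 3 * K + 2 + \<bar>c1\<bar> * T + \<bar>c2\<bar> * T"
  have ct: "\<bar>c * t\<bar> \<le> \<bar>c\<bar> * T" if "0 \<le> t" "t \<le> T" for c t
    using that by (simp add: abs_mult mult_left_mono)
  have nn: "0 \<le> \<bar>c1\<bar> * T" "0 \<le> \<bar>c2\<bar> * T" using T(1) by simp_all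
  have "\<exists>\<rho>>0. \<forall>i::1. \<forall>z\<in>?S. \<forall>z'\<in>?S. dist z z' < \<rho> \<longrightarrow> vec (u1 z) $ i \<le> vec (u2 z') $ i + 1"
  proof (rule comparison[OF T(1) _ sub _ super, of M])
    show "0 < M" using nn \<open>0 \<le> K\<close> unfolding M_def by linarith
    fix z and i :: 1 assume "z \<in> ?S"
    then have "\<bar>c1 * snd z\<bar> \<le> \<bar>c1\<bar> * T" "\<bar>c2 * snd z\<bar> \<le> \<bar>c2\<bar> * T" using ct by auto
    then show "\<bar>vec (u1 z) $ i\<bar> \<le> M" "\<bar>vec (u2 z) $ i\<bar> \<le> M"
      using v1(2)[of "fst z"] v2(2)[of "fst z"] nn \<open>0 \<le> K\<close> unfolding M_def u1_def u2_def vec_component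
      by linarith+
  next
    fix \<kappa> :: real assume "0 < \<kappa>"
    \<comment> \<open>The shift by \<open>2 * K + 1\<close> puts \<open>u1\<close> at least 1 below
      \<open>u2\<close> at time zero, for any pair of space points. This margin absorbs both drifts
      up to time \<open>\<rho>\<close>, independently of \<open>\<kappa>\<close>.\<close>
    define \<rho> where "\<rho> = 1 / (\<bar>c1\<bar> + \<bar>c2\<bar> + 1)"
    have \<rho>: "0 < \<rho>" "\<bar>c1\<bar> * \<rho> + \<bar>c2\<bar> * \<rho> \<le> 1"
    proof -
      show "0 < \<rho>" by (simp add: \<rho>_def add_nonneg_pos)
      have "(\<bar>c1\<bar> + \<bar>c2\<bar> + 1) * \<rho> = 1" by (simp add: \<rho>_def add_nonneg_pos less_imp_neq[THEN not_sym])
      with \<open>0 < \<rho>\<close> show "\<bar>c1\<bar> * \<rho> + \<bar>c2\<bar> * \<rho> \<le> 1" by (simp add: distrib_right)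
    qed
    show "\<exists>\<rho>>0. \<forall>i::1. \<forall>z\<in>?S. \<forall>z'\<in>?S. snd z < \<rho> \<and> snd z' < \<rho> \<and> norm (fst z - fst z') < \<rho> \<longrightarrow>
       vec (u1 z) $ i \<le> vec (u2 z') $ i + \<kappa>"
    proof (intro exI[of _ \<rho>] conjI allI ballI impI \<rho>(1))
      fix i :: 1 and z z' assume "z \<in> ?S" "z' \<in> ?S" "snd z < \<rho> \<and> snd z' < \<rho> \<and> norm (fst z - fst z') < \<rho>"
      then have "\<bar>c1 * snd z\<bar> \<le> \<bar>c1\<bar> * \<rho>" "\<bar>c2 * snd z'\<bar> \<le> \<bar>c2\<bar> * \<rho>"
        by (auto simp: abs_mult intro!: mult_left_mono)
      then show "vec (u1 z) $ i \<le> vec (u2 z') $ i + \<kappa>"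
        using v1(2)[of "fst z"] v2(2)[of "fst z'"] \<rho>(2) \<open>0 < \<kappa>\<close> unfolding u1_def u2_def vec_component by linarith
    qed
  qed simp
  then obtain \<rho> where "0 < \<rho>" "\<And>i z z'. z \<in> ?S \<Longrightarrow> z' \<in> ?S \<Longrightarrow> dist z z' < \<rho> \<Longrightarrow>
      vec (u1 z) $ (i::1) \<le> vec (u2 z') $ i + 1" by blast
  from this(2)[of "(0, T)" "(0, T)" 1] this(1) have "vec (u1 (0, T)) $ (1::1) \<le> vec (u2 (0, T)) $ (1::1) + 1"
    using T(1) by simp
  then show False
    using T(2) v1(2)[of 0] v2(2)[of 0] unfolding u1_def u2_def vec_component fst_conv snd_conv by linarith
qed

text \<open>The constants \<open>- K / \<delta>\<close> and \<open>K / \<delta>\<close> enclose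
  Perron's class. For a function in that range the subsolution inequality gives
  \<open>F \<le> K\<close>, so coercivity bounds the gradient by \<open>L\<close>, whatever
  \<open>\<delta>\<close> is.\<close>

lemma discounted_solution:
  assumes K: "\<And>y. \<bar>F y 0\<bar> \<le> K" and L: "\<And>y q. L \<le> norm q \<Longrightarrow> K + 1 \<le> F y q" and "0 \<le> L" and \<delta>: "0 < \<delta>"
  shows "\<exists>v. (\<forall>x y. v x - v y \<le> (L + 1) * norm (x - y)) \<and> integer_periodic v \<and> (\<forall>y. \<bar>\<delta> * v y\<bar> \<le> K) \<and>
    (\<forall>\<phi> D y. C1_with_gradient \<phi> D \<and> local_max_on UNIV (\<lambda>x. v x - \<phi> x) y \<longrightarrow> \<delta> * v y + F y (D y) \<le> 0) \<and>
    (\<forall>\<phi> D y. C1_with_gradient \<phi> D \<and> local_min_on UNIV (\<lambda>x. v x - \<phi> x) y \<longrightarrow> 0 \<le> \<delta> * v y + F y (D y))"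
proof -
  let ?F = "\<lambda>(i::1) y (r::real^1) q. \<delta> * r $ 1 + F y q"
  have one: "i = 1" for i :: 1 by simp
  have "0 \<le> K" using K[of undefined] by linarith
  interpret P: perron UNIV UNIV ?F "\<lambda>_. vec (- K / \<delta>)" "\<lambda>_. vec (K / \<delta>)" "- K / \<delta>" "K / \<delta>"
  proof
    show "continuous_on UNIV (\<lambda>(z, r, p). ?F i z r p)" for i :: 1
    proof -
      have "continuous_on UNIV (\<lambda>w :: (real^'n) \<times> (real^1) \<times> (real^'n). (\<lambda>(y, q). F y q) (fst w, snd (snd w)))"
        by (rule continuous_on_compose2[OF continuous_F]) (intro continuous_intros subset_UNIV)+
      then have "continuous_on UNIV (\<lambda>w :: (real^'n) \<times> (real^1) \<times> (real^'n).
          \<delta> * fst (snd w) $ 1 + (\<lambda>(y, q). F y q) (fst w, snd (snd w)))"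
        by (intro continuous_intros)
      then show ?thesis by (simp add: case_prod_unfold)
    qed
    show "?F i z s p \<le> ?F i z r p" if "r $ i = s $ i" for i :: 1 and z s p and r :: "real^1"
      using that one[of i] by simp
    show "?F i z r (E z) \<le> ?F i z r (D z)"
      if "C1_with_gradient \<phi> D" "C1_with_gradient \<psi> E" "local_max_on UNIV (\<lambda>x. \<phi> x - \<psi> x) z" for \<phi> D \<psi> E and i :: 1 and z r
      using interior_gradient[OF that] by simp
    show "visc_sub UNIV UNIV ?F (\<lambda>_. vec (- K / \<delta>))"
      unfolding visc_sub_def
    proof (intro conjI allI impI)
      show "usc_on UNIV (\<lambda>z :: real^'n. vec (- K / \<delta>) $ i)" for i :: 1
        by (intro continuous_on_imp_usc_on continuous_on_const)
      fix \<phi> D and i :: 1 and z :: "real^'n"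
      assume "C1_with_gradient \<phi> D \<and> z \<in> UNIV \<and> local_max_on UNIV (\<lambda>z. vec (- K / \<delta>) $ i - \<phi> z) z"
      then have "D z = 0" using interior_gradient[OF C1_const] by metis
      then show "?F i z (vec (- K / \<delta>)) (D z) \<le> 0" using K[of z] \<delta> by simp
    qed
    show "0 \<le> ?F i z r (D z)"
      if "C1_with_gradient \<phi> D" "local_min_on UNIV (\<lambda>x. vec (K / \<delta>) $ i - \<phi> x) z"
        "r $ i = vec (K / \<delta>) $ i" for \<phi> D and i :: 1 and z r
    proof -
      have "local_max_on UNIV (\<lambda>x. - (K / \<delta>) - - \<phi> x) z"
        using that(2) unfolding local_min_on_iff_max by simp
      then have "- D z = 0" using interior_gradient[OF C1_const C1_minus[OF that(1)]] by metis
      then show ?thesis using K[of z] \<delta> that(3) one[of i] by simp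
    qed
    show "vec (- K / \<delta>) $ i \<le> vec (K / \<delta>) $ i" for i :: 1
      using \<open>0 \<le> K\<close> \<delta> by (simp add: divide_right_mono)
  qed (auto intro: exI[of _ 1] continuous_on_const)
  define w where "w y = P.W y $ 1" for y
  have w_bounds: "- K \<le> \<delta> * w y" "\<delta> * w y \<le> K" for y
    using P.W_ge[of y 1] P.W_le_B[of y 1] \<delta> by (simp_all add: w_def field_simps)
  have sub: "\<delta> * w z + F z (D z) \<le> 0" if "C1_with_gradient \<phi> D" "local_max_on UNIV (\<lambda>x. w x - \<phi> x) z" for \<phi> D z
    using visc_subD[OF P.W_sub that(1), of z 1] that(2) by (simp add: w_def)
  have lip: "w x - w y \<le> (L + 1) * norm (x - y)" for x y
  proof (rule usc_bounded_gradient_imp_lipschitz[OF _ _ \<open>0 \<le> L\<close>])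
    show "usc_on UNIV w" unfolding w_def by (rule P.W_usc)
    show "\<bar>w x\<bar> \<le> K / \<delta>" for x using w_bounds[of x] \<delta> by (auto simp: abs_le_iff field_simps)
    fix \<phi> D z assume "C1_with_gradient \<phi> D" "local_max_on UNIV (\<lambda>x. w x - \<phi> x) z"
    from sub[OF this] L[of "D z" z] w_bounds[of z] show "norm (D z) \<le> L" by force
  qed
  have "continuous_on UNIV w"
  proof (rule lipschitz_on_continuous_on[OF lipschitz_onI])
    show "dist (w x) (w y) \<le> (L + 1) * dist x y" for x y
      using lip[of x y] lip[of y x] by (simp add: dist_norm norm_minus_commute abs_le_iff)
  qed (use \<open>0 \<le> L\<close> in simp)
  \<comment> \<open>A continuous function is its own lower envelope, so the maximal subsolution is
    at once a supersolution.\<close>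
  then have "w y \<le> P.V y $ 1" for y
    by (intro P.V_greatest[of w] continuous_on_imp_lsc_on) (auto simp: w_def)
  then have Vw: "P.V y $ 1 = w y" for y using P.V_le_W[of y 1] by (simp add: w_def antisym)
  have super: "0 \<le> \<delta> * w z + F z (D z)" if "C1_with_gradient \<phi> D" "local_min_on UNIV (\<lambda>x. w x - \<phi> x) z" for \<phi> D z
    using visc_superD[OF P.V_super that(1), of z 1] that(2) by (simp add: Vw)
  \<comment> \<open>Integer translates of \<open>W\<close> are again subsolutions below the same
    constant, so they lie below \<open>W\<close>. Translating back by \<open>- k\<close> gives
    equality.\<close>
  have shift: "w (y + k) \<le> w y" if k: "\<forall>i. k $ i \<in> \<int>" for y k
  proof -
    have "(\<lambda>z. P.W (z + k)) \<in> P.subs"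
      unfolding P.subs_def visc_sub_def
    proof (intro CollectI conjI allI impI ballI)
      show "usc_on UNIV (\<lambda>z. P.W (z + k) $ i)" for i
        by (rule usc_on_compose[OF P.W_usc]) (auto intro!: continuous_intros)
      show "P.W (z + k) $ i \<le> vec (K / \<delta>) $ i" for z i by (rule P.W_le_B) simp
      fix \<phi> D and i :: 1 and z
      assume *: "C1_with_gradient \<phi> D \<and> z \<in> UNIV \<and> local_max_on UNIV (\<lambda>z. P.W (z + k) $ i - \<phi> z) z"
      then obtain d where d: "d > 0" "\<And>x. dist x z < d \<Longrightarrow> w (x + k) - \<phi> x \<le> w (z + k) - \<phi> z"
        unfolding local_max_on_iff w_def one[of i] by blast
      have "local_max_on UNIV (\<lambda>x. w x - \<phi> (x + - k)) (z + k)"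
        unfolding local_max_on_iff
      proof (intro conjI exI[of _ d] ballI impI d(1))
        fix x assume "dist x (z + k) < d"
        then have "dist (x + - k) z < d" by (simp add: dist_norm algebra_simps)
        from d(2)[OF this] show "w x - \<phi> (x + - k) \<le> w (z + k) - \<phi> (z + k + - k)" by simp
      qed simp
      from sub[OF C1_shift this] * have "\<delta> * w (z + k) + F (z + k) (D z) \<le> 0" by simp
      moreover have "F (z + k) (D z) = F z (D z)" using periodic k unfolding integer_periodic_def by blast
      ultimately show "?F i z (P.W (z + k)) (D z) \<le> 0" by (simp add: w_def)
    qed
    from P.subs_le_W[OF this, of y 1] show ?thesis by (simp add: w_def)
  qed
  have "w (y + k) = w y" if k: "\<forall>i. k $ i \<in> \<int>" for y k
  proof -
    have "\<forall>i. (- k) $ i \<in> \<int>" using k by simp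
    from shift[OF this, of "y + k"] shift[OF k, of y] show ?thesis by simp
  qed
  then have per: "integer_periodic w" unfolding integer_periodic_def by blast
  have bnd: "\<bar>\<delta> * w y\<bar> \<le> K" for y using w_bounds[of y] by linarith
  show ?thesis
    by (intro exI[of _ w] conjI allI impI lip per bnd) (auto intro: sub super)
qed

lemma cell_solution:
  obtains c v L where "L-lipschitz_on UNIV v" "integer_periodic v" "stationary_viscosity_solution F c v"
proof -
  obtain K where "\<And>y q. (\<forall>k. \<bar>(0 :: real^1) $ k\<bar> \<le> 0) \<and> norm q \<le> 0 \<Longrightarrow> \<bar>F y q\<bar> \<le> K"
    using bounded[of 0] by metis
  then have K: "\<bar>F y 0\<bar> \<le> K" for y by simp
  obtain P where P: "\<And>y q. P \<le> norm q \<Longrightarrow> K + 1 \<le> F y q" using coercive by metis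
  define L where "L = max P 0"
  have L: "0 \<le> L" "\<And>y q. L \<le> norm q \<Longrightarrow> K + 1 \<le> F y q" using P by (auto simp: L_def)
  define \<delta> where "\<delta> n = inverse (real (Suc n))" for n
  have \<delta>: "0 < \<delta> n" for n by (simp add: \<delta>_def)
  have "\<forall>n. \<exists>v. (\<forall>x y. v x - v y \<le> (L + 1) * norm (x - y)) \<and> integer_periodic v \<and> (\<forall>y. \<bar>\<delta> n * v y\<bar> \<le> K) \<and>
    (\<forall>\<phi> D y. C1_with_gradient \<phi> D \<and> local_max_on UNIV (\<lambda>x. v x - \<phi> x) y \<longrightarrow> \<delta> n * v y + F y (D y) \<le> 0) \<and>
    (\<forall>\<phi> D y. C1_with_gradient \<phi> D \<and> local_min_on UNIV (\<lambda>x. v x - \<phi> x) y \<longrightarrow> 0 \<le> \<delta> n * v y + F y (D y))"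
    by (intro allI discounted_solution K L \<delta>)
  then obtain v where v: "\<forall>n. (\<forall>x y. v n x - v n y \<le> (L + 1) * norm (x - y)) \<and> integer_periodic (v n) \<and>
      (\<forall>y. \<bar>\<delta> n * v n y\<bar> \<le> K) \<and>
    (\<forall>\<phi> D y. C1_with_gradient \<phi> D \<and> local_max_on UNIV (\<lambda>x. v n x - \<phi> x) y \<longrightarrow> \<delta> n * v n y + F y (D y) \<le> 0) \<and>
    (\<forall>\<phi> D y. C1_with_gradient \<phi> D \<and> local_min_on UNIV (\<lambda>x. v n x - \<phi> x) y \<longrightarrow> 0 \<le> \<delta> n * v n y + F y (D y))"
    using choice[where Q = "\<lambda>n v. (\<forall>x y. v x - v y \<le> (L + 1) * norm (x - y)) \<and> integer_periodic v \<and> (\<forall>y. \<bar>\<delta> n * v y\<bar> \<le> K) \<and>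
    (\<forall>\<phi> D y. C1_with_gradient \<phi> D \<and> local_max_on UNIV (\<lambda>x. v x - \<phi> x) y \<longrightarrow> \<delta> n * v y + F y (D y) \<le> 0) \<and>
    (\<forall>\<phi> D y. C1_with_gradient \<phi> D \<and> local_min_on UNIV (\<lambda>x. v x - \<phi> x) y \<longrightarrow> 0 \<le> \<delta> n * v y + F y (D y))"]
    by blast
  have lip: "v n x - v n y \<le> (L + 1) * norm (x - y)" for n x y using v by blast
  have sub: "\<delta> n * v n y + F y (D y) \<le> 0" if "C1_with_gradient \<phi> D" "local_max_on UNIV (\<lambda>x. v n x - \<phi> x) y" for n \<phi> D y
    using v that by blast
  have super: "0 \<le> \<delta> n * v n y + F y (D y)" if "C1_with_gradient \<phi> D" "local_min_on UNIV (\<lambda>x. v n x - \<phi> x) y" for n \<phi> D y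
    using v that by blast
  \<comment> \<open>\<open>v n\<close> may grow like \<open>1 / \<delta> n\<close>, but its
    oscillation does not: normalizing at the origin leaves a bounded equi-Lipschitz family, and the
    lost constant survives as the bounded number \<open>l n\<close>.\<close>
  define w where "w n y = v n y - v n 0" for n y
  define l where "l n = - (\<delta> n * v n 0)" for n
  have l_bound: "\<bar>l n\<bar> \<le> K" for n using v by (simp add: l_def)
  have w_per: "integer_periodic (w n)" for n using v by (simp add: w_def integer_periodic_def)
  have w_lip: "\<bar>w n x - w n y\<bar> \<le> (L + 1) * norm (x - y)" for n x y
    using lip[of n x y] lip[of n y x] by (simp add: w_def norm_minus_commute abs_le_iff)
  obtain b where b: "0 < b" "\<And>y. y \<in> cbox 0 (1 :: real^'n) \<Longrightarrow> norm y \<le> b"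
    using bounded_cbox bounded_pos by metis
  define M where "M = (L + 1) * b"
  have w_cbox: "\<bar>w n y\<bar> \<le> M" if "y \<in> cbox 0 1" for n y
  proof -
    have "\<bar>w n y\<bar> \<le> (L + 1) * norm y" using w_lip[of n y 0] by (simp add: w_def)
    also have "\<dots> \<le> M" unfolding M_def using b(2)[OF that] L(1) by (intro mult_left_mono) auto
    finally show ?thesis .
  qed
  have w_bound: "\<bar>w n y\<bar> \<le> M" for n y
    using w_cbox[OF frac_vec_in_cbox, of n y] integer_periodic_frac_vec[OF w_per] by simp
  \<comment> \<open>Pairing \<open>w n\<close> with the constant function \<open>l n\<close> makes
    one subsequence serve both limits.\<close>
  obtain g k where g: "strict_mono (k :: nat \<Rightarrow> nat)"
    "\<And>e. 0 < e \<Longrightarrow> \<exists>N. \<forall>n x. n \<ge> N \<and> x \<in> cbox 0 1 \<longrightarrow> norm ((w (k n) x, l (k n)) - g x) < e"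
  proof (rule Arzela_Ascoli[of "cbox 0 (1 :: real^'n)" "\<lambda>n x. (w n x, l n)" "M + K"])
    show "norm (w n x, l n) \<le> M + K" if "x \<in> cbox 0 1" for n x
      using norm_Pair_le[of "w n x" "l n"] w_bound[of n x] l_bound[of n] by simp
    fix x :: "real^'n" and e :: real assume "0 < e"
    show "\<exists>d. 0 < d \<and> (\<forall>n y. y \<in> cbox 0 1 \<and> norm (x - y) < d \<longrightarrow> norm ((w n x, l n) - (w n y, l n)) < e)"
    proof (intro exI[of _ "e / (L + 1)"] conjI allI impI)
      fix n y assume "y \<in> cbox 0 1 \<and> norm (x - y) < e / (L + 1)"
      then have "(L + 1) * norm (x - y) < e" using L(1) by (simp add: pos_less_divide_eq mult.commute)
      then show "norm ((w n x, l n) - (w n y, l n)) < e" using w_lip[of n x y] by (simp add: norm_Pair)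
    qed (use \<open>0 < e\<close> L(1) in simp)
  qed auto
  define u where "u y = fst (g (frac_vec y))" for y
  define c where "c = snd (g 0)"
  \<comment> \<open>Periodicity transports the uniform convergence on the cube to the whole space,
    the form that \<open>limit_subsolution\<close> requires.\<close>
  have conv: "\<exists>N. \<forall>n\<ge>N. \<forall>y. \<bar>w (k n) y - u y\<bar> < e" if e: "0 < e" for e
  proof -
    obtain N where N: "\<And>n x. n \<ge> N \<Longrightarrow> x \<in> cbox 0 1 \<Longrightarrow> norm ((w (k n) x, l (k n)) - g x) < e"
      using g(2)[OF e] by blast
    have "\<bar>w (k n) y - u y\<bar> < e" if "n \<ge> N" for n y
    proof -
      have "\<bar>w (k n) (frac_vec y) - u y\<bar> \<le> norm ((w (k n) (frac_vec y), l (k n)) - g (frac_vec y))"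
        using dist_fst_le[of "(w (k n) (frac_vec y), l (k n))" "g (frac_vec y)"] by (simp add: u_def dist_norm)
      then show ?thesis
        using N[OF that frac_vec_in_cbox[of y]] integer_periodic_frac_vec[OF w_per, of "k n" y] by simp
    qed
    then show ?thesis by blast
  qed
  have lim_l: "(\<lambda>n. l (k n)) \<longlonglongrightarrow> c"
  proof (rule LIMSEQ_I)
    fix e :: real assume "0 < e"
    have "(0 :: real^'n) \<in> cbox 0 1" by (simp add: mem_box_cart)
    with g(2)[OF \<open>0 < e\<close>] obtain N where N: "\<And>n. n \<ge> N \<Longrightarrow> norm ((w (k n) 0, l (k n)) - g 0) < e" by blast
    have "norm (l (k n) - c) < e" if "n \<ge> N" for n
      using N[OF that] dist_snd_le[of "(w (k n) 0, l (k n))" "g 0"] by (simp add: c_def dist_norm)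
    then show "\<exists>N. \<forall>n\<ge>N. norm (l (k n) - c) < e" by blast
  qed
  have lim_\<delta>: "(\<lambda>n. \<delta> (k n)) \<longlonglongrightarrow> 0"
    using LIMSEQ_subseq_LIMSEQ[OF LIMSEQ_inverse_real_of_nat g(1)] by (simp add: \<delta>_def o_def)
  \<comment> \<open>The zeroth-order term \<open>\<delta> (k n) * w (k n) y\<close> is moved to the
    right-hand side, where it is at most \<open>\<delta> (k n) * M\<close> and vanishes in the
    limit.\<close>
  have lim1: "(\<lambda>n. l (k n) + \<delta> (k n) * M) \<longlonglongrightarrow> c"
    using tendsto_add[OF lim_l tendsto_mult_right[OF lim_\<delta>, of M]] by simp
  have lim2: "(\<lambda>n. - l (k n) + \<delta> (k n) * M) \<longlonglongrightarrow> - c"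
    using tendsto_add[OF tendsto_minus[OF lim_l] tendsto_mult_right[OF lim_\<delta>, of M]] by simp
  have w_cont: "continuous_on UNIV (w n)" for n
    by (rule lipschitz_on_continuous_on[OF lipschitz_onI[where L = "L + 1"]]) (use w_lip L(1) in \<open>auto simp: dist_norm\<close>)
  have disc: "\<delta> n * v n y = \<delta> n * w n y - l n" "\<bar>\<delta> n * w n y\<bar> \<le> \<delta> n * M" for n y
  proof -
    show "\<delta> n * v n y = \<delta> n * w n y - l n" by (simp add: w_def l_def right_diff_distrib)
    show "\<bar>\<delta> n * w n y\<bar> \<le> \<delta> n * M"
      using mult_left_mono[OF w_bound[of n y], of "\<delta> n"] \<delta>[of n] by (simp add: abs_mult)
  qed
  have u_sub: "F z (D z) \<le> c" if "C1_with_gradient \<phi> D" "local_max_on UNIV (\<lambda>x. u x - \<phi> x) z" for \<phi> D z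
  proof (rule limit_subsolution[where w = "\<lambda>n. w (k n)", OF continuous_F _ conv lim1 _ that])
    show "usc_on UNIV (w (k n))" for n by (rule continuous_on_imp_usc_on[OF w_cont])
    fix n \<phi> D y assume "C1_with_gradient \<phi> D" "local_max_on UNIV (\<lambda>x. w (k n) x - \<phi> x) y"
    then have "\<delta> (k n) * v (k n) y + F y (D y) \<le> 0"
      by (intro sub[of \<phi>]) (auto simp: w_def local_max_on_iff)
    then show "F y (D y) \<le> l (k n) + \<delta> (k n) * M" using disc[of "k n" y] by linarith
  qed
  have u_super: "c \<le> F z (D z)" if "C1_with_gradient \<phi> D" "local_min_on UNIV (\<lambda>x. u x - \<phi> x) z" for \<phi> D z
  proof -
    have "(\<lambda>y q. - F y (- q)) z (- D z) \<le> - c"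
    proof (rule limit_subsolution[where w = "\<lambda>n y. - w (k n) y" and v = "\<lambda>y. - u y" and F = "\<lambda>y q. - F y (- q)",
          OF _ _ _ lim2 _ C1_minus[OF that(1)]])
      have "continuous_on UNIV (\<lambda>w. (\<lambda>(y, q). F y q) (fst w, - snd w))"
        by (rule continuous_on_compose2[OF continuous_F]) (intro continuous_intros subset_UNIV)+
      then show "continuous_on UNIV (\<lambda>(y, q). - F y (- q))"
        using continuous_on_minus by (force simp: case_prod_unfold)
      show "usc_on UNIV (\<lambda>y. - w (k n) y)" for n
        by (rule continuous_on_imp_usc_on[OF continuous_on_minus[OF w_cont]])
      show "\<exists>N. \<forall>n\<ge>N. \<forall>y. \<bar>- w (k n) y - - u y\<bar> < e" if "0 < e" for e
        using conv[OF that] by (simp add: abs_minus_commute)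
      show "local_max_on UNIV (\<lambda>x. - u x - - \<phi> x) z"
        using that(2) unfolding local_min_on_iff_max by simp
      fix n \<phi> D y assume *: "C1_with_gradient \<phi> D" "local_max_on UNIV (\<lambda>x. - w (k n) x - \<phi> x) y"
      then obtain d where d: "0 < d" "\<And>x. dist x y < d \<Longrightarrow> - w (k n) x - \<phi> x \<le> - w (k n) y - \<phi> y"
        unfolding local_max_on_iff by blast
      have "local_min_on UNIV (\<lambda>x. v (k n) x - - \<phi> x) y"
        unfolding local_min_on_iff
      proof (intro conjI exI[of _ d] ballI impI d(1))
        show "v (k n) y - - \<phi> y \<le> v (k n) x - - \<phi> x" if "dist x y < d" for x
          using d(2)[OF that] unfolding w_def by linarith
      qed simp
      from super[OF C1_minus[OF *(1)] this]
      show "- F y (- D y) \<le> - l (k n) + \<delta> (k n) * M" using disc[of "k n" y] by linarith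
    qed
    then show ?thesis by simp
  qed
  have u_lim: "(\<lambda>n. w (k n) y) \<longlonglongrightarrow> u y" for y
    by (rule LIMSEQ_I) (use conv in \<open>metis real_norm_def\<close>)
  have u_lip: "(L + 1)-lipschitz_on UNIV u"
  proof (rule lipschitz_onI)
    fix x y
    have "(\<lambda>n. \<bar>w (k n) x - w (k n) y\<bar>) \<longlonglongrightarrow> \<bar>u x - u y\<bar>"
      by (intro tendsto_rabs tendsto_diff u_lim)
    then have "\<bar>u x - u y\<bar> \<le> (L + 1) * norm (x - y)"
      by (rule LIMSEQ_le_const2) (use w_lip in blast)
    then show "dist (u x) (u y) \<le> (L + 1) * dist x y" by (simp add: dist_norm)
  qed (use L(1) in simp)
  have "integer_periodic u"
    unfolding integer_periodic_def u_def by (simp add: frac_vec_add_int)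
  moreover have "stationary_viscosity_solution F c u"
    unfolding stationary_viscosity_solution_def
    using lipschitz_on_continuous_on[OF u_lip] u_sub u_super by blast
  ultimately show thesis using that u_lip by blast
qed

end

section \<open>The effective Hamiltonian\<close>

text \<open>The predicate under the \<open>THE\<close> in \<open>effective_Hamiltonian\<close>,
  named so that existence and uniqueness of the constant transfer to it directly.\<close>

definition cell_pair :: "(real^'n \<Rightarrow> real^'n \<Rightarrow> real) \<Rightarrow> real \<Rightarrow> (real^'n \<Rightarrow> real) \<Rightarrow> bool" where
  "cell_pair F c v \<longleftrightarrow> (\<exists>L. L-lipschitz_on UNIV v) \<and> integer_periodic v \<and> stationary_viscosity_solution F c v"

lemma cell_pair_continuous: "cell_pair F c v \<Longrightarrow> continuous_on UNIV v"
  by (simp add: cell_pair_def stationary_viscosity_solution_def)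

lemma cell_pair_subD:
  "cell_pair F c v \<Longrightarrow> C1_with_gradient \<phi> D \<Longrightarrow> local_max_on UNIV (\<lambda>w. v w - \<phi> w) y \<Longrightarrow> F y (D y) \<le> c"
  by (simp add: cell_pair_def stationary_viscosity_solution_def)

lemma cell_pair_superD:
  "cell_pair F c v \<Longrightarrow> C1_with_gradient \<phi> D \<Longrightarrow> local_min_on UNIV (\<lambda>w. v w - \<phi> w) y \<Longrightarrow> c \<le> F y (D y)"
  by (simp add: cell_pair_def stationary_viscosity_solution_def)

text \<open>Constants are test functions at the maximum and minimum points of \<open>v\<close>.
  These bounds yield coercivity and boundedness of the effective Hamiltonian.\<close>

lemma cell_pair_bounds:
  assumes "cell_pair F c v"
  shows "\<exists>y. F y 0 \<le> c" "\<exists>y. c \<le> F y 0"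
proof -
  have per: "integer_periodic v" using assms by (simp add: cell_pair_def)
  obtain z where z: "\<And>y. v y \<le> v z"
    using integer_periodic_attains_sup[OF cell_pair_continuous[OF assms] per] by blast
  have "local_max_on UNIV (\<lambda>w. v w - 0) z"
    unfolding local_max_on_def using z by simp
  from cell_pair_subD[OF assms C1_const this] show "\<exists>y. F y 0 \<le> c" by blast
  have "integer_periodic (\<lambda>y. - v y)" using per by (simp add: integer_periodic_def)
  then obtain z' where z': "\<And>y. - v y \<le> - v z'"
    using integer_periodic_attains_sup[OF continuous_on_minus[OF cell_pair_continuous[OF assms]]] by blast
  have "local_min_on UNIV (\<lambda>w. v w - 0) z'"
    unfolding local_min_on_def using z' by simp
  from cell_pair_superD[OF assms C1_const this] show "\<exists>y. c \<le> F y 0" by blast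
qed

context cell_hamiltonian
begin

text \<open>Only sublevels are compared: by \<open>le\<close>, the function \<open>v1\<close> is a
  subsolution of \<open>F\<close> at level \<open>c'\<close>, while \<open>v\<close> is a
  supersolution at level \<open>c\<close>. The restriction to a sublevel matters because coercivity
  confines the gradients there.\<close>

lemma cell_constant_le:
  assumes c1: "cell_pair F1 c1 v1" and c: "cell_pair F c v" and le: "\<And>y q. F1 y q \<le> c1 \<Longrightarrow> F y q \<le> c'"
  shows "c \<le> c'"
proof -
  obtain K1 where K1: "0 < K1" "\<And>y. \<bar>v1 y\<bar> \<le> K1"
    using integer_periodic_bounded[OF cell_pair_continuous[OF c1]] c1 unfolding cell_pair_def by blast
  obtain K2 where K2: "0 < K2" "\<And>y. \<bar>v y\<bar> \<le> K2"
    using integer_periodic_bounded[OF cell_pair_continuous[OF c]] c unfolding cell_pair_def by blast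
  show ?thesis
  proof (rule sub_super_constant_le[of v1 "max K1 K2" c' v])
    show "\<bar>v1 y\<bar> \<le> max K1 K2" "\<bar>v y\<bar> \<le> max K1 K2" for y
      using K1(2)[of y] K2(2)[of y] by auto
  qed (use cell_pair_continuous[OF c1] cell_pair_continuous[OF c] le cell_pair_subD[OF c1] cell_pair_superD[OF c] in auto)
qed

lemma ex1_cell_constant: "\<exists>!c. \<exists>v. cell_pair F c v"
proof (rule ex_ex1I)
  show "\<exists>c v. cell_pair F c v" using cell_solution unfolding cell_pair_def by metis
  fix c c' assume "\<exists>v. cell_pair F c v" "\<exists>v. cell_pair F c' v"
  then obtain v v' where "cell_pair F c v" "cell_pair F c' v'" by blast
  moreover have "b \<le> a" if "cell_pair F a w" "cell_pair F b w'" for a b w w'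
    by (rule cell_constant_le[OF that])
  ultimately show "c = c'" by (intro antisym)
qed

end

section \<open>From the structural assumptions to the properties of the effective
  Hamiltonian\<close>

locale structural_hamiltonian =
  fixes H :: "'m::finite \<Rightarrow> real^'n \<Rightarrow> real^'n \<Rightarrow> real^'m \<Rightarrow> real^'n \<Rightarrow> real"
  assumes S: "assumptions_S H" and Mon: "condition_Mon H"
begin

lemma H_coercive: "\<exists>P. \<forall>j x y r p. P \<le> norm p \<longrightarrow> C \<le> H j x y r p"
proof -
  have "\<forall>j. \<exists>P. \<forall>p. P \<le> norm p \<longrightarrow> (\<forall>x y r. C \<le> H j x y r p)"
    using S unfolding assumptions_S_def eventually_at_infinity by blast
  then obtain P where P: "\<And>j x y r p. P j \<le> norm p \<Longrightarrow> C \<le> H j x y r p" by metis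
  have "P j \<le> Max (range P)" for j by (intro Max_ge) auto
  then show ?thesis using P by (intro exI[of _ "Max (range P)"]) (meson order_trans)
qed

text \<open>The radius \<open>\<bar>R\<bar> + 1\<close> is positive for every real \<open>R\<close>,
  and the open ball of this radius contains all \<open>p\<close> with
  \<open>norm p \<le> R\<close>.\<close>

lemma H_BUC:
  "BUC (UNIV \<times> UNIV \<times> {r. \<forall>k. r $ k \<in> {- (\<bar>R\<bar> + 1)..\<bar>R\<bar> + 1}} \<times> ball 0 (\<bar>R\<bar> + 1)) (\<lambda>(x, y, r, p). H j x y r p)"
proof -
  have "0 < \<bar>R\<bar> + 1" by simp
  with S show ?thesis unfolding assumptions_S_def by blast
qed

lemma H_bounded: "\<exists>C. \<forall>j x y r p. (\<forall>k. \<bar>r $ k\<bar> \<le> R) \<and> norm p \<le> R \<longrightarrow> \<bar>H j x y r p\<bar> \<le> C"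
proof -
  have "\<forall>j. \<exists>C. \<forall>x y r p. (\<forall>k. \<bar>r $ k\<bar> \<le> R) \<and> norm p \<le> R \<longrightarrow> \<bar>H j x y r p\<bar> \<le> C"
  proof
    fix j
    obtain C where C: "\<forall>w\<in>UNIV \<times> UNIV \<times> {r. \<forall>k. r $ k \<in> {- (\<bar>R\<bar> + 1)..\<bar>R\<bar> + 1}} \<times> ball 0 (\<bar>R\<bar> + 1).
        \<bar>(\<lambda>(x, y, r, p). H j x y r p) w\<bar> \<le> C"
      using H_BUC[of R j] unfolding BUC_def bounded_iff ball_simps real_norm_def by blast
    have "\<bar>H j x y r p\<bar> \<le> C" if *: "\<forall>k. \<bar>r $ k\<bar> \<le> R" "norm p \<le> R" for x y r p
    proof -
      have "r $ k \<in> {- (\<bar>R\<bar> + 1)..\<bar>R\<bar> + 1}" for k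
        using *(1)[rule_format, of k] unfolding atLeastAtMost_iff by linarith
      moreover have "norm p < \<bar>R\<bar> + 1" using *(2) by linarith
      ultimately have "(x, y, r, p) \<in> UNIV \<times> UNIV \<times> {r. \<forall>k. r $ k \<in> {- (\<bar>R\<bar> + 1)..\<bar>R\<bar> + 1}} \<times> ball 0 (\<bar>R\<bar> + 1)"
        by (simp del: atLeastAtMost_iff)
      from bspec[OF C this] show ?thesis by simp
    qed
    then show "\<exists>C. \<forall>x y r p. (\<forall>k. \<bar>r $ k\<bar> \<le> R) \<and> norm p \<le> R \<longrightarrow> \<bar>H j x y r p\<bar> \<le> C" by blast
  qed
  then obtain C where C: "\<And>j x y r p. (\<forall>k. \<bar>r $ k\<bar> \<le> R) \<and> norm p \<le> R \<Longrightarrow> \<bar>H j x y r p\<bar> \<le> C j" by metis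
  have "C j \<le> Max (range C)" for j by (intro Max_ge) auto
  then show ?thesis using C by (intro exI[of _ "Max (range C)"]) (meson order_trans)
qed

lemma H_unif_cont:
  assumes \<kappa>: "0 < \<kappa>"
  shows "\<exists>\<rho>>0. \<forall>j x x' y y' r r' p p'.
        (\<forall>k. \<bar>r $ k\<bar> \<le> R \<and> \<bar>r' $ k\<bar> \<le> R \<and> \<bar>r $ k - r' $ k\<bar> < \<rho>) \<and> norm p \<le> R \<and> norm p' \<le> R \<and>
        norm (x - x') < \<rho> \<and> norm (y - y') < \<rho> \<and> norm (p - p') < \<rho> \<longrightarrow> \<bar>H j x y r p - H j x' y' r' p'\<bar> \<le> \<kappa>"
proof -
  let ?D = "UNIV \<times> UNIV \<times> {r. \<forall>k. r $ k \<in> {- (\<bar>R\<bar> + 1)..\<bar>R\<bar> + 1}} \<times> ball 0 (\<bar>R\<bar> + 1)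
    :: ((real^'n) \<times> (real^'n) \<times> (real^'m) \<times> (real^'n)) set"
  have "\<forall>j. \<exists>d>0. \<forall>w\<in>?D. \<forall>w'\<in>?D. dist w' w < d \<longrightarrow>
      dist ((\<lambda>(x, y, r, p). H j x y r p) w') ((\<lambda>(x, y, r, p). H j x y r p) w) < \<kappa>"
    using H_BUC[of R] \<kappa> unfolding BUC_def uniformly_continuous_on_def by blast
  from choice[OF this] obtain d where "\<forall>j. 0 < d j \<and> (\<forall>w\<in>?D. \<forall>w'\<in>?D. dist w' w < d j \<longrightarrow>
      dist ((\<lambda>(x, y, r, p). H j x y r p) w') ((\<lambda>(x, y, r, p). H j x y r p) w) < \<kappa>)" by blast
  then have d: "\<And>j. 0 < d j" "\<And>j w w'. w \<in> ?D \<Longrightarrow> w' \<in> ?D \<Longrightarrow> dist w' w < d j \<Longrightarrow>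
      dist ((\<lambda>(x, y, r, p). H j x y r p) w') ((\<lambda>(x, y, r, p). H j x y r p) w) < \<kappa>" by blast+
  define e where "e = Min (range d)"
  have e: "0 < e" "\<And>j. e \<le> d j" using d(1) by (auto simp: e_def)
  \<comment> \<open>The l1 bound charges \<open>\<rho>\<close> for each component of
    \<open>r\<close>, and \<open>x\<close>, \<open>y\<close>, \<open>p\<close> account for the three
    more.\<close>
  define \<rho> where "\<rho> = e / (real CARD('m) + 3)"
  have \<rho>: "0 < \<rho>" "(real CARD('m) + 3) * \<rho> = e" using e(1) by (simp_all add: \<rho>_def add_nonneg_pos)
  show ?thesis
  proof (intro exI[of _ \<rho>] conjI allI impI \<rho>(1), elim conjE)
    fix j and x x' y y' p p' :: "real^'n" and r r' :: "real^'m"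
    assume r: "\<forall>k. \<bar>r $ k\<bar> \<le> R \<and> \<bar>r' $ k\<bar> \<le> R \<and> \<bar>r $ k - r' $ k\<bar> < \<rho>" and p: "norm p \<le> R" "norm p' \<le> R"
      and n: "norm (x - x') < \<rho>" "norm (y - y') < \<rho>" "norm (p - p') < \<rho>"
    have "r $ k \<in> {- (\<bar>R\<bar> + 1)..\<bar>R\<bar> + 1}" "r' $ k \<in> {- (\<bar>R\<bar> + 1)..\<bar>R\<bar> + 1}" for k
      using r[rule_format, of k] unfolding atLeastAtMost_iff by linarith+
    moreover have "norm p < \<bar>R\<bar> + 1" "norm p' < \<bar>R\<bar> + 1" using p by linarith+
    ultimately have D: "(x, y, r, p) \<in> ?D" "(x', y', r', p') \<in> ?D"
      by (simp_all del: atLeastAtMost_iff)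
    have "norm (r - r') \<le> (\<Sum>k\<in>UNIV. \<bar>(r - r') $ k\<bar>)" by (rule norm_le_l1_cart)
    also have "\<dots> \<le> (\<Sum>k\<in>(UNIV::'m set). \<rho>)" using r by (intro sum_mono) (auto intro: less_imp_le)
    finally have "norm (r - r') \<le> CARD('m) * \<rho>" by simp
    moreover have "dist (x, y, r, p) (x', y', r', p') \<le> dist x x' + dist (y, r, p) (y', r', p')"
      "dist (y, r, p) (y', r', p') \<le> dist y y' + dist (r, p) (r', p')"
      "dist (r, p) (r', p') \<le> dist r r' + dist p p'"
      using sqrt_sum_squares_le_sum[OF zero_le_dist zero_le_dist] by (metis dist_Pair_Pair)+
    ultimately have "dist (x, y, r, p) (x', y', r', p') < (real CARD('m) + 3) * \<rho>"
      using n unfolding dist_norm[of x x'] dist_norm[of y y'] dist_norm[of r r'] dist_norm[of p p'] distrib_right by linarith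
    then have "dist (x, y, r, p) (x', y', r', p') < d j" using \<rho>(2) e(2)[of j] by linarith
    from d(2)[OF D(2,1) this] show "\<bar>H j x y r p - H j x' y' r' p'\<bar> \<le> \<kappa>" by (simp add: dist_real_def)
  qed
qed

lemma cell_hamiltonian_H: "cell_hamiltonian (\<lambda>y q. H j x y r (p + q))"
proof
  show "\<exists>P. \<forall>(i::1) y (s::real^1) q. P \<le> norm q \<longrightarrow> C \<le> H j x y r (p + q)" for C
  proof -
    obtain P where P: "\<And>j x y r p. P \<le> norm p \<Longrightarrow> C \<le> H j x y r p" using H_coercive by metis
    have "C \<le> H j x y r (p + q)" if "P + norm p \<le> norm q" for y q
    proof (rule P)
      have "norm q \<le> norm (p + q) + norm p" by (metis add_diff_cancel_left' norm_triangle_ineq4)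
      with that show "P \<le> norm (p + q)" by linarith
    qed
    then show ?thesis by blast
  qed
  show "\<exists>\<rho>>0. \<forall>(i::1) y y' (s::real^1) s' q q'. (\<forall>k. \<bar>s $ k\<bar> \<le> R \<and> \<bar>s' $ k\<bar> \<le> R \<and> \<bar>s $ k - s' $ k\<bar> < \<rho>) \<and>
      norm q \<le> R \<and> norm q' \<le> R \<and> norm (y - y') < \<rho> \<and> norm (q - q') < \<rho> \<longrightarrow>
      \<bar>H j x y r (p + q) - H j x y' r (p + q')\<bar> \<le> \<kappa>" if \<kappa>: "0 < \<kappa>" for \<kappa> R
  proof -
    define R' where "R' = \<bar>R\<bar> + norm p + norm r"
    obtain \<rho> where \<rho>: "0 < \<rho>" "\<forall>j x x' y y' r r' p p'.
        (\<forall>k. \<bar>r $ k\<bar> \<le> R' \<and> \<bar>r' $ k\<bar> \<le> R' \<and> \<bar>r $ k - r' $ k\<bar> < \<rho>) \<and> norm p \<le> R' \<and> norm p' \<le> R' \<and>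
        norm (x - x') < \<rho> \<and> norm (y - y') < \<rho> \<and> norm (p - p') < \<rho> \<longrightarrow> \<bar>H j x y r p - H j x' y' r' p'\<bar> \<le> \<kappa>"
      using H_unif_cont[OF \<kappa>, of R'] by blast
    have r: "\<bar>r $ k\<bar> \<le> R'" for k
      using component_le_norm_cart[of r k] norm_ge_zero[of p] unfolding R'_def by linarith
    have q: "norm (p + q) \<le> R'" if "norm q \<le> R" for q
      using norm_triangle_ineq[of p q] that norm_ge_zero[of r] unfolding R'_def by linarith
    have "\<bar>H j x y r (p + q) - H j x y' r (p + q')\<bar> \<le> \<kappa>"
      if "norm q \<le> R" "norm q' \<le> R" "norm (y - y') < \<rho>" "norm (q - q') < \<rho>" for y y' q q'
      using \<rho>(2)[rule_format, of r r "p + q" "p + q'" x x y y' j] r q \<rho>(1) that by simp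
    then show ?thesis using \<rho>(1) by blast
  qed
  show "\<exists>C. \<forall>(i::1) y (s::real^1) q. (\<forall>k. \<bar>s $ k\<bar> \<le> R) \<and> norm q \<le> R \<longrightarrow> \<bar>H j x y r (p + q)\<bar> \<le> C" for R
  proof -
    define R' where "R' = \<bar>R\<bar> + norm p + norm r"
    obtain C where C: "\<And>j x y r p. (\<forall>k. \<bar>r $ k\<bar> \<le> R') \<and> norm p \<le> R' \<Longrightarrow> \<bar>H j x y r p\<bar> \<le> C"
      using H_bounded[of R'] by blast
    have r: "\<bar>r $ k\<bar> \<le> R'" for k
      using component_le_norm_cart[of r k] norm_ge_zero[of p] unfolding R'_def by linarith
    have "norm (p + q) \<le> R'" if "norm q \<le> R" for q
      using norm_triangle_ineq[of p q] that norm_ge_zero[of r] unfolding R'_def by linarith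
    then show ?thesis using C r by blast
  qed
  show "integer_periodic (\<lambda>y. H j x y r (p + q))" for q
    using S unfolding assumptions_S_def by blast
qed simp

abbreviation Hbar :: "'m \<Rightarrow> real^'n \<Rightarrow> real^'m \<Rightarrow> real^'n \<Rightarrow> real" where
  "Hbar \<equiv> effective_Hamiltonian H"

lemma Hbar_cell_pair: "\<exists>v. cell_pair (\<lambda>y q. H j x y r (p + q)) (Hbar j x r p) v"
  using theI'[OF cell_hamiltonian.ex1_cell_constant[OF cell_hamiltonian_H]]
  unfolding effective_Hamiltonian_def cell_pair_def .

lemma Hbar_bounds: "\<exists>y. H j x y r p \<le> Hbar j x r p" "\<exists>y. Hbar j x r p \<le> H j x y r p"
  using Hbar_cell_pair[of j x r p] cell_pair_bounds[where F = "\<lambda>y q. H j x y r (p + q)"] by force+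

text \<open>The common \<open>q\<close> is the gradient of the corrector: the corrector for
  \<open>(x, r, p)\<close> is tried as a subsolution of the cell problem for
  \<open>(x', r', p')\<close>. Monotonicity and uniform continuity of \<open>Hbar\<close> reduce to
  this.\<close>

lemma Hbar_le:
  assumes "\<And>y q. H j x y r (p + q) \<le> Hbar j x r p \<Longrightarrow> H j x' y r' (p' + q) \<le> c"
  shows "Hbar j x' r' p' \<le> c"
  using Hbar_cell_pair[of j x r p] Hbar_cell_pair[of j x' r' p'] assms
    cell_hamiltonian.cell_constant_le[OF cell_hamiltonian_H[of j x' r' p']] by blast

sublocale Hbar: regular_hamiltonian Hbar
proof
  show "\<exists>P. \<forall>i x r p. P \<le> norm p \<longrightarrow> C \<le> Hbar i x r p" for C
  proof -
    obtain P where P: "\<And>j x y r p. P \<le> norm p \<Longrightarrow> C \<le> H j x y r p" using H_coercive by metis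
    then show ?thesis using Hbar_bounds(1) by (meson order_trans)
  qed
  have bounded: "\<exists>C. \<forall>i x r p. (\<forall>k. \<bar>r $ k\<bar> \<le> R) \<and> norm p \<le> R \<longrightarrow> \<bar>Hbar i x r p\<bar> \<le> C" for R
  proof -
    obtain C where C: "\<And>j x y r p. (\<forall>k. \<bar>r $ k\<bar> \<le> R) \<and> norm p \<le> R \<Longrightarrow> \<bar>H j x y r p\<bar> \<le> C"
      using H_bounded[of R] by blast
    have "\<bar>Hbar i x r p\<bar> \<le> C" if "(\<forall>k. \<bar>r $ k\<bar> \<le> R) \<and> norm p \<le> R" for i x r p
    proof -
      obtain y y' where "H i x y r p \<le> Hbar i x r p" "Hbar i x r p \<le> H i x y' r p"
        using Hbar_bounds by blast
      with C[OF that, of i x y] C[OF that, of i x y'] show ?thesis by linarith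
    qed
    then show ?thesis by blast
  qed
  then show "\<exists>C. \<forall>i x r p. (\<forall>k. \<bar>r $ k\<bar> \<le> R) \<and> norm p \<le> R \<longrightarrow> \<bar>Hbar i x r p\<bar> \<le> C" for R .
  show "\<exists>\<rho>>0. \<forall>i x x' r r' p p'.
        (\<forall>k. \<bar>r $ k\<bar> \<le> R \<and> \<bar>r' $ k\<bar> \<le> R \<and> \<bar>r $ k - r' $ k\<bar> < \<rho>) \<and> norm p \<le> R \<and> norm p' \<le> R \<and>
        norm (x - x') < \<rho> \<and> norm (p - p') < \<rho> \<longrightarrow> \<bar>Hbar i x r p - Hbar i x' r' p'\<bar> \<le> \<kappa>" if \<kappa>: "0 < \<kappa>" for \<kappa> R
  proof -
    obtain C where C: "\<And>i x r p. (\<forall>k. \<bar>r $ k\<bar> \<le> R) \<and> norm p \<le> R \<Longrightarrow> \<bar>Hbar i x r p\<bar> \<le> C"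
      using bounded by blast
    \<comment> \<open>The gradient \<open>q\<close> of the corrector is arbitrary a priori, but
      \<open>Hbar\<close> is at most \<open>C\<close>, so the sublevel condition forces
      \<open>norm (p + q) < P\<close>. A change of \<open>p\<close> by less than 1 then stays within
      \<open>P + 1\<close>, and the modulus of \<open>H\<close> on a bounded set is enough.\<close>
    obtain P where P: "\<And>j x y r p. P \<le> norm p \<Longrightarrow> C + 1 \<le> H j x y r p" using H_coercive by metis
    define R' where "R' = max R (P + 1)"
    obtain \<rho> where \<rho>: "0 < \<rho>" "\<forall>j x x' y y' r r' p p'.
        (\<forall>k. \<bar>r $ k\<bar> \<le> R' \<and> \<bar>r' $ k\<bar> \<le> R' \<and> \<bar>r $ k - r' $ k\<bar> < \<rho>) \<and> norm p \<le> R' \<and> norm p' \<le> R' \<and>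
        norm (x - x') < \<rho> \<and> norm (y - y') < \<rho> \<and> norm (p - p') < \<rho> \<longrightarrow> \<bar>H j x y r p - H j x' y' r' p'\<bar> \<le> \<kappa>"
      using H_unif_cont[OF \<kappa>, of R'] by blast
    have le: "Hbar i x' r' p' \<le> Hbar i x r p + \<kappa>"
      if r: "\<forall>k. \<bar>r $ k\<bar> \<le> R \<and> \<bar>r' $ k\<bar> \<le> R \<and> \<bar>r $ k - r' $ k\<bar> < min \<rho> 1" and p: "norm p \<le> R"
        and n: "norm (x - x') < min \<rho> 1" "norm (p - p') < min \<rho> 1" for i x x' r r' p p'
    proof (rule Hbar_le)
      fix y q assume *: "H i x y r (p + q) \<le> Hbar i x r p"
      have "\<bar>Hbar i x r p\<bar> \<le> C" using r p by (intro C) auto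
      with * have "norm (p + q) < P" using P[of "p + q" i x y r] by (cases "P \<le> norm (p + q)") auto
      moreover have "norm (p' + q) \<le> norm (p + q) + norm (p - p')"
        using norm_triangle_ineq4[of "p + q" "p - p'"] by (simp add: algebra_simps)
      ultimately have "norm (p + q) \<le> R'" "norm (p' + q) \<le> R'" using n(2) by (auto simp: R'_def)
      moreover have "\<bar>r $ k\<bar> \<le> R' \<and> \<bar>r' $ k\<bar> \<le> R' \<and> \<bar>r $ k - r' $ k\<bar> < \<rho>" for k
        using r[rule_format, of k] by (auto simp: R'_def)
      ultimately have "\<bar>H i x y r (p + q) - H i x' y r' (p' + q)\<bar> \<le> \<kappa>"
        using \<rho>(2)[rule_format, of r r' "p + q" "p' + q" x x' y y i] n \<rho>(1) by simp
      with * show "H i x' y r' (p' + q) \<le> Hbar i x r p + \<kappa>" by linarith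
    qed
    show ?thesis
    proof (intro exI[of _ "min \<rho> 1"] conjI allI impI, goal_cases)
      case (2 i x x' r r' p p')
      have "Hbar i x' r' p' \<le> Hbar i x r p + \<kappa>" using 2 by (intro le) auto
      moreover have "Hbar i x r p \<le> Hbar i x' r' p' + \<kappa>"
        using 2 by (intro le) (auto simp: norm_minus_commute abs_minus_commute)
      ultimately show ?case by linarith
    qed (use \<rho>(1) in simp)
  qed
  show "Hbar i x s p \<le> Hbar i x r p" if "\<And>k. r $ k - s $ k \<le> r $ i - s $ i" "s $ i \<le> r $ i" for r s i x p
  proof (rule Hbar_le)
    have "Max (range (\<lambda>k. r $ k - s $ k)) = r $ i - s $ i"
      by (rule Max_eqI) (use that(1) in auto)
    then have "H i x y s q \<le> H i x y r q" for y q
      using Mon that(2) unfolding condition_Mon_def by (metis diff_ge_0_iff_ge)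
    then show "H i x y s (p + q) \<le> Hbar i x r p" if "H i x y r (p + q) \<le> Hbar i x r p" for y q
      using that by (meson order_trans)
  qed
qed

end

theorem proposition5p1:
  fixes H :: "'m::finite \<Rightarrow> real^'n \<Rightarrow> real^'n \<Rightarrow> real^'m \<Rightarrow> real^'n \<Rightarrow> real"
    and u0 :: "real^'n \<Rightarrow> real^'m"
    and T :: real
  assumes "T > 0"
    and "\<And>j. continuous_on UNIV (\<lambda>(x, y, r, p). H j x y r p)"
    and "assumptions_S H"
    and "condition_Mon H"
    and "\<And>i. BUC UNIV (\<lambda>x. u0 x $ i)"
  shows "\<exists>u. (\<forall>i. BUC (UNIV \<times> {0..T}) (\<lambda>z. u z $ i)) \<and>
             viscosity_solution (effective_Hamiltonian H) u0 T u \<and>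
             (\<forall>w. (\<forall>i. BUC (UNIV \<times> {0..T}) (\<lambda>z. w z $ i)) \<and>
                  viscosity_solution (effective_Hamiltonian H) u0 T w \<longrightarrow>
                  (\<forall>z \<in> UNIV \<times> {0..T}. w z = u z))"
proof -
  interpret structural_hamiltonian H by (rule structural_hamiltonian.intro) fact+
  show ?thesis by (rule Hbar.well_posed[OF assms(1,5)])
qed

end
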